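(* Let $A$ be a finite set, $S=F(A)$ the free left regular band with identity on $A$, and $k$ a field. Then the quiver of the semigroup algebra $kS$ has one vertex for each subset $X$ of $A$, and for subsets $Y\subsetneq X$ it has exactly $\#(X\setminus Y)-1$ arrows from $X$ to $Y$, and there are no other arrows.
   Context: $F(A)$ is the set of all finite sequences (words) of distinct elements of $A$ (including the empty sequence, the identity), with product $(a_1,\dots,a_l)(b_1,\dots,b_m)$ equal to the sequence $(a_1,\dots,a_l,b_1,\dots,b_m)$ with every element that has occurred earlier deleted. Its simple modules are one-dimensional and indexed by subsets of $A$: for $X\subseteq A$, an element $s$ acts on $M_X=k$ by $1$ if the set of letters of $s$ is contained in $X$ and by $0$ otherwise. The quiver of a finite-dimensional algebra whose simple modules are all one-dimensional has one vertex per isomorphism class of simple modules $M_X$ and $\dim_k\operatorname{Ext}^1(M_X,M_Y)$ arrows from $X$ to $Y$. *)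

theory Defs
  imports "Jordan_Normal_Form.Missing_VectorSpace" "HOL-Algebra.AbelCoset"
begin

section \<open>Left modules over a not necessarily commutative ring\<close>

text \<open>The library locale \<open>module\<close> requires a commutative ring of scalars; the axioms below are the
  same ones over an arbitrary unital ring.\<close>

locale left_module = R?: ring R + M?: abelian_group M
  for R :: "('r, 'x) ring_scheme" (structure) and M :: "('r, 'm, 'y) module_scheme" (structure) +
  assumes smult_closed:
      "\<lbrakk>a \<in> carrier R; x \<in> carrier M\<rbrakk> \<Longrightarrow> a \<odot>\<^bsub>M\<^esub> x \<in> carrier M"
    and smult_l_distr:
      "\<lbrakk>a \<in> carrier R; b \<in> carrier R; x \<in> carrier M\<rbrakk> \<Longrightarrow>
        (a \<oplus>\<^bsub>R\<^esub> b) \<odot>\<^bsub>M\<^esub> x = a \<odot>\<^bsub>M\<^esub> x \<oplus>\<^bsub>M\<^esub> b \<odot>\<^bsub>M\<^esub> x"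
    and smult_r_distr:
      "\<lbrakk>a \<in> carrier R; x \<in> carrier M; y \<in> carrier M\<rbrakk> \<Longrightarrow>
        a \<odot>\<^bsub>M\<^esub> (x \<oplus>\<^bsub>M\<^esub> y) = a \<odot>\<^bsub>M\<^esub> x \<oplus>\<^bsub>M\<^esub> a \<odot>\<^bsub>M\<^esub> y"
    and smult_assoc1:
      "\<lbrakk>a \<in> carrier R; b \<in> carrier R; x \<in> carrier M\<rbrakk> \<Longrightarrow>
        (a \<otimes>\<^bsub>R\<^esub> b) \<odot>\<^bsub>M\<^esub> x = a \<odot>\<^bsub>M\<^esub> (b \<odot>\<^bsub>M\<^esub> x)"
    and smult_one:
      "x \<in> carrier M \<Longrightarrow> \<one>\<^bsub>R\<^esub> \<odot>\<^bsub>M\<^esub> x = x"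

text \<open>Homomorphisms are extensional functions, so that each one is a single element of the set.\<close>

definition left_module_hom ::
    "('r, 'x) ring_scheme \<Rightarrow> ('r, 'm) module \<Rightarrow> ('r, 'n) module \<Rightarrow> ('m \<Rightarrow> 'n) set" where
  "left_module_hom R M N = {f \<in> carrier M \<rightarrow>\<^sub>E carrier N.
     (\<forall>x\<in>carrier M. \<forall>y\<in>carrier M. f (x \<oplus>\<^bsub>M\<^esub> y) = f x \<oplus>\<^bsub>N\<^esub> f y) \<and>
     (\<forall>a\<in>carrier R. \<forall>x\<in>carrier M. f (a \<odot>\<^bsub>M\<^esub> x) = a \<odot>\<^bsub>N\<^esub> f x)}"

definition left_module_iso ::
    "('r, 'x) ring_scheme \<Rightarrow> ('r, 'm) module \<Rightarrow> ('r, 'n) module \<Rightarrow> bool" where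
  "left_module_iso R M N \<longleftrightarrow> (\<exists>f\<in>left_module_hom R M N. bij_betw f (carrier M) (carrier N))"

definition simple_left_module :: "('r, 'x) ring_scheme \<Rightarrow> ('r, 'm) module \<Rightarrow> bool" where
  "simple_left_module R M \<longleftrightarrow> left_module R M \<and> carrier M \<noteq> {\<zero>\<^bsub>M\<^esub>} \<and>
     (\<forall>N. Module.submodule N R M \<longrightarrow> N = {\<zero>\<^bsub>M\<^esub>} \<or> N = carrier M)"

section \<open>The first Ext group\<close>

text \<open>In the \<open>module\<close> records below the fields \<open>mult\<close> and \<open>one\<close> play no role.\<close>

definition free_left_module :: "('r, 'x) ring_scheme \<Rightarrow> 'b set \<Rightarrow> ('r, 'b \<Rightarrow> 'r) module" where
  "free_left_module R B =
    \<lparr>carrier = {f \<in> B \<rightarrow>\<^sub>E carrier R. finite {b \<in> B. f b \<noteq> \<zero>\<^bsub>R\<^esub>}},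
     mult = undefined, one = undefined,
     zero = (\<lambda>b\<in>B. \<zero>\<^bsub>R\<^esub>),
     add = (\<lambda>f g. \<lambda>b\<in>B. f b \<oplus>\<^bsub>R\<^esub> g b),
     smult = (\<lambda>r f. \<lambda>b\<in>B. r \<otimes>\<^bsub>R\<^esub> f b)\<rparr>"

text \<open>For \<open>B \<subseteq> carrier M\<close>, the homomorphism from the free module on \<open>B\<close> to \<open>M\<close> that extends the
  inclusion of \<open>B\<close>.\<close>

definition free_cover ::
    "('r, 'x) ring_scheme \<Rightarrow> ('r, 'm) module \<Rightarrow> 'm set \<Rightarrow> ('m \<Rightarrow> 'r) \<Rightarrow> 'm" where
  "free_cover R M B = (\<lambda>f\<in>carrier (free_left_module R B).
     \<Oplus>\<^bsub>M\<^esub>b\<in>{b \<in> B. f b \<noteq> \<zero>\<^bsub>R\<^esub>}. f b \<odot>\<^bsub>M\<^esub> b)"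

text \<open>The beginning \<open>res2 \<rightarrow> res1 \<rightarrow> res0 \<rightarrow> M \<rightarrow> 0\<close> of the standard free resolution of \<open>M\<close>: the
  module \<open>res0\<close> is free on the elements of \<open>M\<close>, and each further term is free on the elements of
  the kernel of the previous map.\<close>

definition res0 :: "('r, 'x) ring_scheme \<Rightarrow> ('r, 'm) module \<Rightarrow> ('r, 'm \<Rightarrow> 'r) module" where
  "res0 R M = free_left_module R (carrier M)"

definition res_ker0 :: "('r, 'x) ring_scheme \<Rightarrow> ('r, 'm) module \<Rightarrow> ('m \<Rightarrow> 'r) set" where
  "res_ker0 R M = {f \<in> carrier (res0 R M). free_cover R M (carrier M) f = \<zero>\<^bsub>M\<^esub>}"

definition res1 :: "('r, 'x) ring_scheme \<Rightarrow> ('r, 'm) module \<Rightarrow> ('r, ('m \<Rightarrow> 'r) \<Rightarrow> 'r) module" where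
  "res1 R M = free_left_module R (res_ker0 R M)"

definition res_d1 ::
    "('r, 'x) ring_scheme \<Rightarrow> ('r, 'm) module \<Rightarrow> (('m \<Rightarrow> 'r) \<Rightarrow> 'r) \<Rightarrow> 'm \<Rightarrow> 'r" where
  "res_d1 R M = free_cover R (res0 R M) (res_ker0 R M)"

definition res_ker1 :: "('r, 'x) ring_scheme \<Rightarrow> ('r, 'm) module \<Rightarrow> (('m \<Rightarrow> 'r) \<Rightarrow> 'r) set" where
  "res_ker1 R M = {f \<in> carrier (res1 R M). res_d1 R M f = \<zero>\<^bsub>res0 R M\<^esub>}"

definition res2 ::
    "('r, 'x) ring_scheme \<Rightarrow> ('r, 'm) module \<Rightarrow> ('r, (('m \<Rightarrow> 'r) \<Rightarrow> 'r) \<Rightarrow> 'r) module" where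
  "res2 R M = free_left_module R (res_ker1 R M)"

definition res_d2 ::
    "('r, 'x) ring_scheme \<Rightarrow> ('r, 'm) module \<Rightarrow> ((('m \<Rightarrow> 'r) \<Rightarrow> 'r) \<Rightarrow> 'r) \<Rightarrow> ('m \<Rightarrow> 'r) \<Rightarrow> 'r" where
  "res_d2 R M = free_cover R (res1 R M) (res_ker1 R M)"

text \<open>A \<open>k\<close>-algebra \<open>R\<close> is a \<open>module\<close> record whose ring fields are those of \<open>R\<close> and whose \<open>smult\<close> is
  the scalar multiplication by \<open>k\<close>, as in the library locale \<open>algebra\<close>. A scalar \<open>c\<close> then acts on
  an \<open>R\<close>-module through the element \<open>c \<odot> 1\<close> of \<open>R\<close>.\<close>

definition restrict_scalars :: "('k, 'r) module \<Rightarrow> ('r, 'm) module \<Rightarrow> ('k, 'm) module" where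
  "restrict_scalars R M =
    \<lparr>carrier = carrier M, mult = mult M, one = one M, zero = zero M, add = add M,
     smult = (\<lambda>c x. (c \<odot>\<^bsub>R\<^esub> \<one>\<^bsub>R\<^esub>) \<odot>\<^bsub>M\<^esub> x)\<rparr>"

definition hom_space ::
    "('k, 'r) module \<Rightarrow> ('r, 'm) module \<Rightarrow> ('r, 'n) module \<Rightarrow> ('k, 'm \<Rightarrow> 'n) module" where
  "hom_space R M N =
    \<lparr>carrier = left_module_hom R M N,
     mult = undefined, one = undefined,
     zero = (\<lambda>x\<in>carrier M. \<zero>\<^bsub>N\<^esub>),
     add = (\<lambda>f g. \<lambda>x\<in>carrier M. f x \<oplus>\<^bsub>N\<^esub> g x),
     smult = (\<lambda>c f. \<lambda>x\<in>carrier M. c \<odot>\<^bsub>restrict_scalars R N\<^esub> f x)\<rparr>"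

definition quotient_space :: "('k, 'v) module \<Rightarrow> 'v set \<Rightarrow> ('k, 'v set) module" where
  "quotient_space V W =
    \<lparr>carrier = a_rcosets\<^bsub>V\<^esub> W,
     mult = undefined, one = undefined,
     zero = W,
     add = (\<lambda>C D. C <+>\<^bsub>V\<^esub> D),
     smult = (\<lambda>c C. \<Union>x\<in>C. W +>\<^bsub>V\<^esub> (c \<odot>\<^bsub>V\<^esub> x))\<rparr>"

definition ext1_cocycles ::
    "('k, 'r) module \<Rightarrow> ('r, 'm) module \<Rightarrow> ('r, 'n) module \<Rightarrow> ((('m \<Rightarrow> 'r) \<Rightarrow> 'r) \<Rightarrow> 'n) set" where
  "ext1_cocycles R M N = {f \<in> left_module_hom R (res1 R M) N.
     \<forall>x\<in>carrier (res2 R M). f (res_d2 R M x) = \<zero>\<^bsub>N\<^esub>}"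

definition ext1_coboundaries ::
    "('k, 'r) module \<Rightarrow> ('r, 'm) module \<Rightarrow> ('r, 'n) module \<Rightarrow> ((('m \<Rightarrow> 'r) \<Rightarrow> 'r) \<Rightarrow> 'n) set" where
  "ext1_coboundaries R M N =
     (\<lambda>g. compose (carrier (res1 R M)) g (res_d1 R M)) ` left_module_hom R (res0 R M) N"

definition ext1 ::
    "('k, 'r) module \<Rightarrow> ('r, 'm) module \<Rightarrow> ('r, 'n) module \<Rightarrow>
      ('k, ((('m \<Rightarrow> 'r) \<Rightarrow> 'r) \<Rightarrow> 'n) set) module" where
  "ext1 R M N = quotient_space
     ((hom_space R (res1 R M) N)\<lparr>carrier := ext1_cocycles R M N\<rparr>)
     (ext1_coboundaries R M N)"

section \<open>Quivers\<close>

definition has_dim :: "('k, 'x) ring_scheme \<Rightarrow> ('k, 'v) module \<Rightarrow> nat \<Rightarrow> bool" where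
  "has_dim K V n \<longleftrightarrow>
     vectorspace K V \<and> vectorspace.fin_dim K V \<and> vectorspace.dim K V = n"

text \<open>The quiver of the \<open>K\<close>-algebra \<open>R\<close>, all of whose simple modules are one-dimensional, has the
  vertex set \<open>I\<close> and \<open>arrows i j\<close> arrows from \<open>i\<close> to \<open>j\<close>. The vertex \<open>i\<close> stands for the isomorphism
  class of the simple module \<open>S i\<close>. That these are all the classes is expressed for simple modules
  whose elements lie in the type \<open>'v\<close>; a theorem with \<open>'v\<close> as a type variable covers every
  simple module.\<close>

definition is_quiver ::
    "'v itself \<Rightarrow> ('k, 'x) ring_scheme \<Rightarrow> ('k, 'r) module \<Rightarrow> 'i set \<Rightarrow>
      ('i \<Rightarrow> ('r, 'm) module) \<Rightarrow> ('i \<Rightarrow> 'i \<Rightarrow> nat) \<Rightarrow> bool" where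
  "is_quiver (T :: 'v itself) K R I S arrows \<longleftrightarrow>
     (\<forall>i\<in>I. simple_left_module R (S i) \<and> has_dim K (restrict_scalars R (S i)) 1) \<and>
     (\<forall>i\<in>I. \<forall>j\<in>I. left_module_iso R (S i) (S j) \<longrightarrow> i = j) \<and>
     (\<forall>V :: ('r, 'v) module. simple_left_module R V \<longrightarrow> (\<exists>i\<in>I. left_module_iso R V (S i))) \<and>
     (\<forall>i\<in>I. \<forall>j\<in>I. has_dim K (ext1 R (S i) (S j)) (arrows i j))"

section \<open>The free left regular band and its algebra\<close>

definition free_lrb :: "'a set \<Rightarrow> 'a list monoid" where
  "free_lrb A =
    \<lparr>carrier = {w. distinct w \<and> set w \<subseteq> A},
     mult = (\<lambda>u v. u @ filter (\<lambda>x. x \<notin> set u) v),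
     one = []\<rparr>"

definition monoid_algebra ::
    "('k, 'x) ring_scheme \<Rightarrow> ('s, 'y) monoid_scheme \<Rightarrow> ('k, 's \<Rightarrow> 'k) module" where
  "monoid_algebra K S =
    \<lparr>carrier = {f \<in> carrier S \<rightarrow>\<^sub>E carrier K. finite {s \<in> carrier S. f s \<noteq> \<zero>\<^bsub>K\<^esub>}},
     mult = (\<lambda>f g. \<lambda>s\<in>carrier S.
       \<Oplus>\<^bsub>K\<^esub>p\<in>{(u, v). u \<in> carrier S \<and> v \<in> carrier S \<and> f u \<noteq> \<zero>\<^bsub>K\<^esub> \<and> g v \<noteq> \<zero>\<^bsub>K\<^esub> \<and> u \<otimes>\<^bsub>S\<^esub> v = s}.
         f (fst p) \<otimes>\<^bsub>K\<^esub> g (snd p)),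
     one = (\<lambda>s\<in>carrier S. if s = \<one>\<^bsub>S\<^esub> then \<one>\<^bsub>K\<^esub> else \<zero>\<^bsub>K\<^esub>),
     zero = (\<lambda>s\<in>carrier S. \<zero>\<^bsub>K\<^esub>),
     add = (\<lambda>f g. \<lambda>s\<in>carrier S. f s \<oplus>\<^bsub>K\<^esub> g s),
     smult = (\<lambda>c f. \<lambda>s\<in>carrier S. c \<otimes>\<^bsub>K\<^esub> f s)\<rparr>"

text \<open>The module \<open>M\<^sub>X\<close>: the action of the words on \<open>K\<close>, extended linearly to the algebra.\<close>

definition lrb_simple ::
    "('k, 'x) ring_scheme \<Rightarrow> 'a set \<Rightarrow> 'a set \<Rightarrow> ('a list \<Rightarrow> 'k, 'k) module" where
  "lrb_simple K A X =
    \<lparr>carrier = carrier K,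
     mult = undefined, one = undefined,
     zero = \<zero>\<^bsub>K\<^esub>,
     add = add K,
     smult = (\<lambda>f c. \<Oplus>\<^bsub>K\<^esub>s\<in>{s \<in> carrier (free_lrb A). f s \<noteq> \<zero>\<^bsub>K\<^esub>}.
       f s \<otimes>\<^bsub>K\<^esub> ((if set s \<subseteq> X then \<one>\<^bsub>K\<^esub> else \<zero>\<^bsub>K\<^esub>) \<otimes>\<^bsub>K\<^esub> c))\<rparr>"

end

theory Submission
  imports Defs
begin

text \<open>An extension of \<open>M\<^sub>X\<close> by \<open>M\<^sub>Y\<close> is a derivation \<open>d(uv) = \<chi>\<^sub>Y(u) d(v) + d(u) \<chi>\<^sub>X(v)\<close> on words modulo
  the inner ones \<open>c (\<chi>\<^sub>Y - \<chi>\<^sub>X)\<close>, and a derivation is determined by its values on letters. Since \<open>aa = a\<close>,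
  it vanishes on the letters lying in both or in neither of \<open>X\<close> and \<open>Y\<close>. If there is a letter \<open>a\<close> in \<open>Y\<close>
  but not in \<open>X\<close>, the relation \<open>aba = ab\<close> determines \<open>d\<close> by its value at \<open>a\<close>, so \<open>d\<close> is inner. If
  \<open>Y \<subseteq> X\<close>, the values on the letters of \<open>X - Y\<close> are arbitrary, as \<open>d\<close> may read off the first letter of
  a word outside \<open>Y\<close>, and the inner derivations are those with a constant value there.\<close>

section \<open>Dimensions from dual families\<close>

text \<open>The obstacle is the distance between words and the definition of Ext. The standard
  resolution of \<open>simp_mod X\<close> begins with a free module \<open>F\<close> that has one
  generator for every element of the field, and its later terms are free on whole kernels. Cocycles
  are therefore identified with linear maps on the kernel of the cover of \<open>simp_mod X\<close>
  by \<open>F\<close>, and coboundaries with those maps that extend to \<open>F\<close>. The summand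
  of \<open>F\<close> at the generator of 1 is a copy of the algebra. In it each word minus its
  value under \<open>chi X\<close> lies in the kernel, and evaluation there produces the derivation.
  The other generators contribute only maps that extend to \<open>F\<close>, because every element
  of \<open>F\<close> is brought into the kernel by subtracting a scalar multiple of the generator
  of 1.

  The dimension is read off from a dual family: for a fixed letter \<open>b\<close> in
  \<open>X - Y\<close>, the differences \<open>d [a] - d [b]\<close> over the remaining letters
  \<open>a\<close> of \<open>X - Y\<close> are functionals whose common zeros are the coboundaries,
  and the derivations that read off a first letter are dual to them. Fixing \<open>b\<close> is the
  origin of the -1 in the number of arrows.\<close>

lemma has_dim_dual_family:
  assumes vs: "vectorspace K V" and finI: "finite I"
    and q: "\<And>i. i \<in> I \<Longrightarrow> q i \<in> carrier V"
    and mu_closed: "\<And>i v. \<lbrakk>i \<in> I; v \<in> carrier V\<rbrakk> \<Longrightarrow> mu i v \<in> carrier K"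
    and mu_add: "\<And>i v w. \<lbrakk>i \<in> I; v \<in> carrier V; w \<in> carrier V\<rbrakk> \<Longrightarrow>
      mu i (v \<oplus>\<^bsub>V\<^esub> w) = mu i v \<oplus>\<^bsub>K\<^esub> mu i w"
    and mu_smult: "\<And>i c v. \<lbrakk>i \<in> I; c \<in> carrier K; v \<in> carrier V\<rbrakk> \<Longrightarrow>
      mu i (c \<odot>\<^bsub>V\<^esub> v) = c \<otimes>\<^bsub>K\<^esub> mu i v"
    and dual: "\<And>i j. \<lbrakk>i \<in> I; j \<in> I\<rbrakk> \<Longrightarrow> mu i (q j) = (if i = j then \<one>\<^bsub>K\<^esub> else \<zero>\<^bsub>K\<^esub>)"
    and sep: "\<And>v. \<lbrakk>v \<in> carrier V; \<And>i. i \<in> I \<Longrightarrow> mu i v = \<zero>\<^bsub>K\<^esub>\<rbrakk> \<Longrightarrow> v = \<zero>\<^bsub>V\<^esub>"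
  shows "has_dim K V (card I)"
proof -
  interpret vectorspace K V by (rule vs)
  have mu_zero: "mu i \<zero>\<^bsub>V\<^esub> = \<zero>\<^bsub>K\<^esub>" if "i \<in> I" for i
    using mu_smult[OF that, of "\<zero>\<^bsub>K\<^esub>" "\<zero>\<^bsub>V\<^esub>"] mu_closed[OF that] by simp
  have inj: "inj_on q I"
  proof (rule inj_onI)
    fix i j assume "i \<in> I" "j \<in> I" "q i = q j"
    then have "mu i (q j) = \<one>\<^bsub>K\<^esub>" using dual[of i i] by simp
    then show "i = j" using dual[of i j] \<open>i \<in> I\<close> \<open>j \<in> I\<close> by (auto split: if_splits)
  qed
  \<comment> \<open>A functional reads off its own coefficient from a combination of the
    \<open>q j\<close>. This gives independence, and below it also shows which coefficients a
    spanning combination must have.\<close>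
  have mu_sum: "mu i (\<Oplus>\<^bsub>V\<^esub>j\<in>J. a j \<odot>\<^bsub>V\<^esub> q j) = (if i \<in> J then a i else \<zero>\<^bsub>K\<^esub>)"
    if "i \<in> I" "J \<subseteq> I" "a \<in> I \<rightarrow> carrier K" for i J a
  proof -
    have "finite J" using that(2) finI by (rule finite_subset)
    then show ?thesis using that(2)
    proof (induction J)
      case empty then show ?case using mu_zero that by simp
    next
      case (insert j J)
      have aq: "(\<lambda>j. a j \<odot>\<^bsub>V\<^esub> q j) \<in> J \<rightarrow> carrier V" and aj: "a j \<in> carrier K" "q j \<in> carrier V"
        using insert that q by (auto simp: Pi_iff)
      have "(\<Oplus>\<^bsub>V\<^esub>j\<in>insert j J. a j \<odot>\<^bsub>V\<^esub> q j) = a j \<odot>\<^bsub>V\<^esub> q j \<oplus>\<^bsub>V\<^esub> (\<Oplus>\<^bsub>V\<^esub>j\<in>J. a j \<odot>\<^bsub>V\<^esub> q j)"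
        using insert.hyps aq aj by (simp add: M.finsum_insert)
      then have "mu i (\<Oplus>\<^bsub>V\<^esub>j\<in>insert j J. a j \<odot>\<^bsub>V\<^esub> q j)
          = a j \<otimes>\<^bsub>K\<^esub> mu i (q j) \<oplus>\<^bsub>K\<^esub> (if i \<in> J then a i else \<zero>\<^bsub>K\<^esub>)"
        using insert.IH insert.prems aq aj that(1) by (simp add: mu_add mu_smult)
      moreover have "mu i (q j) = (if i = j then \<one>\<^bsub>K\<^esub> else \<zero>\<^bsub>K\<^esub>)"
        using dual[OF that(1), of j] insert.prems by blast
      ultimately show ?case using insert.hyps that aj by (auto simp: Pi_iff)
    qed
  qed
  have lc: "lincomb a (q ` I) = (\<Oplus>\<^bsub>V\<^esub>i\<in>I. a (q i) \<odot>\<^bsub>V\<^esub> q i)"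
    if "a \<in> q ` I \<rightarrow> carrier K" for a
    unfolding lincomb_def using that q by (intro M.finsum_reindex inj) auto
  have qI: "q ` I \<subseteq> carrier V" using q by auto
  have "lin_indpt (q ` I)"
  proof (rule finite_lin_indpt2)
    fix a assume a: "a \<in> q ` I \<rightarrow> carrier K" and 0: "lincomb a (q ` I) = \<zero>\<^bsub>V\<^esub>"
    have "a (q i) = \<zero>\<^bsub>K\<^esub>" if "i \<in> I" for i
      using mu_sum[OF that subset_refl, of "\<lambda>i. a (q i)"] a 0 lc[OF a] that mu_zero[OF that]
      by (auto simp: Pi_iff)
    then show "\<forall>v\<in>q ` I. a v = \<zero>\<^bsub>K\<^esub>" by auto
  qed (use finI qI in auto)
  moreover have "span (q ` I) = carrier V"
  proof (rule antisym)
    show "span (q ` I) \<subseteq> carrier V" by (rule span_is_subset2[OF qI])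
  next
    show "carrier V \<subseteq> span (q ` I)"
    proof
      fix v assume v: "v \<in> carrier V"
      \<comment> \<open>The coefficient at \<open>q i\<close> is forced to be \<open>mu i v\<close>.
        Since \<open>lincomb\<close> indexes coefficients by vectors, the index is recovered through
        the inverse of \<open>q\<close>.\<close>
      define a where "a = (\<lambda>x. mu (inv_into I q x) v)"
      have aq: "a (q i) = mu i v" if "i \<in> I" for i
        using inj that by (simp add: a_def)
      have a: "a \<in> q ` I \<rightarrow> carrier K" using aq mu_closed v by auto
      have cl: "lincomb a (q ` I) \<in> carrier V" using a qI by (rule_tac lincomb_closed)
      have "v \<ominus>\<^bsub>V\<^esub> lincomb a (q ` I) = \<zero>\<^bsub>V\<^esub>"
      proof (rule sep)
        fix i assume i: "i \<in> I"
        have "mu i (lincomb a (q ` I)) = mu i v"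
          using mu_sum[OF i subset_refl, of "\<lambda>i. a (q i)"] a i aq lc[OF a]
          by (auto simp: Pi_iff)
        moreover have "mu i (\<ominus>\<^bsub>V\<^esub> lincomb a (q ` I)) = \<ominus>\<^bsub>K\<^esub> mu i (lincomb a (q ` I))"
          using mu_smult[OF i, of "\<ominus>\<^bsub>K\<^esub> \<one>\<^bsub>K\<^esub>" "lincomb a (q ` I)"] cl mu_closed[OF i cl]
          by (simp add: smult_minus_1 R.l_minus)
        ultimately show "mu i (v \<ominus>\<^bsub>V\<^esub> lincomb a (q ` I)) = \<zero>\<^bsub>K\<^esub>"
          using i v cl mu_closed[OF i v] by (simp add: a_minus_def mu_add R.r_neg)
      qed (use v cl in auto)
      then have "v = lincomb a (q ` I)" using v cl by simp
      then show "v \<in> span (q ` I)" using a finI qI by (auto simp: finite_span)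
    qed
  qed
  ultimately have "basis (q ` I)" using qI by (simp add: basis_def)
  then show ?thesis
    using dim_basis[of "q ` I"] finI inj vs qI
    by (auto simp: has_dim_def basis_def fin_dim_def card_image)
qed

section \<open>Quotients by the common kernel of finitely many functionals\<close>

lemma quotient_space_carrier: "carrier (quotient_space V W) = (\<lambda>v. W +>\<^bsub>V\<^esub> v) ` carrier V"
  by (auto simp: quotient_space_def A_RCOSETS_def')

text \<open>Since \<open>W\<close> is stable under scalars, \<open>c\<close> times any member of
  \<open>W + v\<close> lies in the coset of \<open>c v\<close>, so the union defining the scalar
  multiplication collapses to one coset. The bare set of multiples would not do: for
  \<open>c = 0\<close> it is only the zero vector.\<close>

lemma quotient_space_operations:
  assumes "vectorspace K V" and "Module.submodule W K V"
  shows "\<zero>\<^bsub>quotient_space V W\<^esub> = W +>\<^bsub>V\<^esub> \<zero>\<^bsub>V\<^esub>"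
    and "\<lbrakk>v \<in> carrier V; w \<in> carrier V\<rbrakk> \<Longrightarrow>
      (W +>\<^bsub>V\<^esub> v) \<oplus>\<^bsub>quotient_space V W\<^esub> (W +>\<^bsub>V\<^esub> w) = W +>\<^bsub>V\<^esub> (v \<oplus>\<^bsub>V\<^esub> w)"
    and "\<lbrakk>c \<in> carrier K; v \<in> carrier V\<rbrakk> \<Longrightarrow>
      c \<odot>\<^bsub>quotient_space V W\<^esub> (W +>\<^bsub>V\<^esub> v) = W +>\<^bsub>V\<^esub> (c \<odot>\<^bsub>V\<^esub> v)"
proof -
  interpret vectorspace K V by fact
  interpret W: Module.submodule W K V by fact
  interpret W: abelian_subgroup W V
    by (intro abelian_subgroupI2 M.a_comm_group W.subgroup_axioms)
  have rep: "W +>\<^bsub>V\<^esub> x = W +>\<^bsub>V\<^esub> v" if "x \<in> W +>\<^bsub>V\<^esub> v" "v \<in> carrier V" for x v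
    using W.a_repr_independence'[OF that] by simp
  show "\<zero>\<^bsub>quotient_space V W\<^esub> = W +>\<^bsub>V\<^esub> \<zero>\<^bsub>V\<^esub>"
    using W.a_rcos_const[OF W.one_closed] by (simp add: quotient_space_def)
  show "\<lbrakk>v \<in> carrier V; w \<in> carrier V\<rbrakk> \<Longrightarrow>
      (W +>\<^bsub>V\<^esub> v) \<oplus>\<^bsub>quotient_space V W\<^esub> (W +>\<^bsub>V\<^esub> w) = W +>\<^bsub>V\<^esub> (v \<oplus>\<^bsub>V\<^esub> w)"
    by (simp add: quotient_space_def W.a_rcos_sum)
  show "c \<odot>\<^bsub>quotient_space V W\<^esub> (W +>\<^bsub>V\<^esub> v) = W +>\<^bsub>V\<^esub> (c \<odot>\<^bsub>V\<^esub> v)"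
    if c: "c \<in> carrier K" and v: "v \<in> carrier V"
  proof -
    have "W +>\<^bsub>V\<^esub> (c \<odot>\<^bsub>V\<^esub> x) = W +>\<^bsub>V\<^esub> (c \<odot>\<^bsub>V\<^esub> v)" if "x \<in> W +>\<^bsub>V\<^esub> v" for x
    proof (rule rep)
      from that obtain w where w: "w \<in> W" "x = w \<oplus>\<^bsub>V\<^esub> v" by (auto simp: a_r_coset_def')
      then have "c \<odot>\<^bsub>V\<^esub> x = c \<odot>\<^bsub>V\<^esub> w \<oplus>\<^bsub>V\<^esub> c \<odot>\<^bsub>V\<^esub> v"
        using c v W.a_subset by (simp add: smult_r_distr subset_iff)
      then show "c \<odot>\<^bsub>V\<^esub> x \<in> W +>\<^bsub>V\<^esub> (c \<odot>\<^bsub>V\<^esub> v)"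
        using W.smult_closed[OF c w(1)] by (auto simp: a_r_coset_def')
    qed (use c v in simp)
    then have "(\<Union>x\<in>W +>\<^bsub>V\<^esub> v. W +>\<^bsub>V\<^esub> (c \<odot>\<^bsub>V\<^esub> x)) = (\<Union>x\<in>W +>\<^bsub>V\<^esub> v. W +>\<^bsub>V\<^esub> (c \<odot>\<^bsub>V\<^esub> v))"
      by (intro SUP_cong refl)
    also have "\<dots> = W +>\<^bsub>V\<^esub> (c \<odot>\<^bsub>V\<^esub> v)"
      using W.a_rcos_self[OF v] by (intro cSUP_const) blast
    finally show ?thesis by (simp add: quotient_space_def)
  qed
qed

lemma vectorspace_quotient_space:
  assumes vs: "vectorspace K V" and W: "Module.submodule W K V"
  shows "vectorspace K (quotient_space V W)"
proof -
  interpret vectorspace K V by (rule vs)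
  note ops = quotient_space_operations[OF vs W]
  show ?thesis
  proof (rule vs_criteria)
    show "\<forall>v\<in>carrier (quotient_space V W). \<exists>neg_v\<in>carrier (quotient_space V W).
        v \<oplus>\<^bsub>quotient_space V W\<^esub> neg_v = \<zero>\<^bsub>quotient_space V W\<^esub>"
    proof
      fix C assume "C \<in> carrier (quotient_space V W)"
      then obtain v where "v \<in> carrier V" "C = W +>\<^bsub>V\<^esub> v" by (auto simp: quotient_space_carrier)
      then show "\<exists>D\<in>carrier (quotient_space V W). C \<oplus>\<^bsub>quotient_space V W\<^esub> D = \<zero>\<^bsub>quotient_space V W\<^esub>"
        by (intro bexI[of _ "W +>\<^bsub>V\<^esub> (\<ominus>\<^bsub>V\<^esub> v)"]) (auto simp: quotient_space_carrier ops M.r_neg)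
    qed
  qed (auto simp: quotient_space_carrier ops M.a_ac R.m_assoc smult_assoc1 smult_l_distr
        smult_r_distr field_axioms)
qed

text \<open>The functionals \<open>mu i\<close> vanish on \<open>W\<close> and hence descend to the
  quotient. As they are the defining equations of \<open>W\<close>, they separate the cosets, and
  the cosets of the \<open>q i\<close> are dual to them.\<close>

lemma has_dim_quotient_space:
  assumes vs: "vectorspace K V" and finI: "finite I"
    and W: "W = {v \<in> carrier V. \<forall>i\<in>I. mu i v = \<zero>\<^bsub>K\<^esub>}"
    and q: "\<And>i. i \<in> I \<Longrightarrow> q i \<in> carrier V"
    and mu_closed: "\<And>i v. \<lbrakk>i \<in> I; v \<in> carrier V\<rbrakk> \<Longrightarrow> mu i v \<in> carrier K"
    and mu_add: "\<And>i v w. \<lbrakk>i \<in> I; v \<in> carrier V; w \<in> carrier V\<rbrakk> \<Longrightarrow>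
      mu i (v \<oplus>\<^bsub>V\<^esub> w) = mu i v \<oplus>\<^bsub>K\<^esub> mu i w"
    and mu_smult: "\<And>i c v. \<lbrakk>i \<in> I; c \<in> carrier K; v \<in> carrier V\<rbrakk> \<Longrightarrow>
      mu i (c \<odot>\<^bsub>V\<^esub> v) = c \<otimes>\<^bsub>K\<^esub> mu i v"
    and dual: "\<And>i j. \<lbrakk>i \<in> I; j \<in> I\<rbrakk> \<Longrightarrow> mu i (q j) = (if i = j then \<one>\<^bsub>K\<^esub> else \<zero>\<^bsub>K\<^esub>)"
  shows "has_dim K (quotient_space V W) (card I)"
proof -
  interpret vectorspace K V by (rule vs)
  have mu_zero: "mu i \<zero>\<^bsub>V\<^esub> = \<zero>\<^bsub>K\<^esub>" if "i \<in> I" for i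
    using mu_smult[OF that, of "\<zero>\<^bsub>K\<^esub>" "\<zero>\<^bsub>V\<^esub>"] mu_closed[OF that] by simp
  have mu_neg: "mu i (\<ominus>\<^bsub>V\<^esub> v) = \<ominus>\<^bsub>K\<^esub> mu i v" if "i \<in> I" "v \<in> carrier V" for i v
    using mu_smult[OF that(1), of "\<ominus>\<^bsub>K\<^esub> \<one>\<^bsub>K\<^esub>" v] that mu_closed[OF that]
    by (simp add: smult_minus_1 R.l_minus)
  have subW: "Module.submodule W K V"
    by (rule submoduleI) (auto simp: W mu_zero mu_neg mu_add mu_smult)
  interpret W: Module.submodule W K V by (rule subW)
  interpret W: abelian_subgroup W V
    by (intro abelian_subgroupI2 M.a_comm_group W.subgroup_axioms)
  note ops = quotient_space_operations[OF vs subW]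
  \<comment> \<open>A coset is evaluated at a chosen representative. Two representatives differ by
    an element of \<open>W\<close>, where \<open>mu i\<close> is zero, so the choice does not
    matter.\<close>
  define nu where "nu i C = mu i (SOME x. x \<in> C)" for i C
  have nu: "nu i (W +>\<^bsub>V\<^esub> v) = mu i v" if "i \<in> I" "v \<in> carrier V" for i v
  proof -
    have "(SOME x. x \<in> W +>\<^bsub>V\<^esub> v) \<in> W +>\<^bsub>V\<^esub> v"
      using W.a_rcos_self[OF that(2)] by (rule someI)
    then obtain w where w: "w \<in> W" "(SOME x. x \<in> W +>\<^bsub>V\<^esub> v) = w \<oplus>\<^bsub>V\<^esub> v"
      by (auto simp: a_r_coset_def')
    have "w \<in> carrier V" "mu i w = \<zero>\<^bsub>K\<^esub>" using w(1) that(1) unfolding W by blast+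
    then show ?thesis
      using that mu_closed[OF that] w(2) by (simp add: nu_def mu_add)
  qed
  show ?thesis
  proof (rule has_dim_dual_family[where mu = nu and q = "\<lambda>i. W +>\<^bsub>V\<^esub> q i"])
    show "vectorspace K (quotient_space V W)" using vs subW by (rule vectorspace_quotient_space)
  next
    fix C assume "C \<in> carrier (quotient_space V W)" and 0: "\<And>i. i \<in> I \<Longrightarrow> nu i C = \<zero>\<^bsub>K\<^esub>"
    then obtain v where v: "v \<in> carrier V" "C = W +>\<^bsub>V\<^esub> v" by (auto simp: quotient_space_carrier)
    have "mu i v = \<zero>\<^bsub>K\<^esub>" if "i \<in> I" for i using 0[OF that] nu[OF that v(1)] v(2) by simp
    then have "v \<in> W" using v(1) unfolding W by blast
    then show "C = \<zero>\<^bsub>quotient_space V W\<^esub>"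
      using v W.a_rcos_const by (simp add: quotient_space_def)
  qed (auto simp: finI quotient_space_carrier q nu ops mu_closed mu_add mu_smult dual)
qed

section \<open>Free left modules\<close>

context left_module
begin

lemma smult_zero_left [simp]: "x \<in> carrier M \<Longrightarrow> \<zero> \<odot>\<^bsub>M\<^esub> x = \<zero>\<^bsub>M\<^esub>"
  using smult_l_distr[of \<zero> \<zero> x] smult_closed[of \<zero> x] by (simp add: M.add.l_cancel_one')

lemma smult_zero_right [simp]: "a \<in> carrier R \<Longrightarrow> a \<odot>\<^bsub>M\<^esub> \<zero>\<^bsub>M\<^esub> = \<zero>\<^bsub>M\<^esub>"
  using smult_r_distr[of a "\<zero>\<^bsub>M\<^esub>" "\<zero>\<^bsub>M\<^esub>"] smult_closed[of a "\<zero>\<^bsub>M\<^esub>"]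
  by (simp add: M.add.l_cancel_one')

lemma smult_minus_one: "x \<in> carrier M \<Longrightarrow> (\<ominus> \<one>) \<odot>\<^bsub>M\<^esub> x = \<ominus>\<^bsub>M\<^esub> x"
  using smult_l_distr[of "\<ominus> \<one>" \<one> x] smult_closed[of "\<ominus> \<one>" x]
  by (simp add: R.l_neg smult_one M.minus_equality)

end

lemma additive_zero:
  assumes "abelian_group G" "abelian_group H" "h \<in> carrier G \<rightarrow> carrier H"
    and "\<And>x y. \<lbrakk>x \<in> carrier G; y \<in> carrier G\<rbrakk> \<Longrightarrow> h (x \<oplus>\<^bsub>G\<^esub> y) = h x \<oplus>\<^bsub>H\<^esub> h y"
  shows "h \<zero>\<^bsub>G\<^esub> = \<zero>\<^bsub>H\<^esub>"
proof -
  interpret G: abelian_group G by fact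
  interpret H: abelian_group H by fact
  have "h \<zero>\<^bsub>G\<^esub> \<in> carrier H" using assms(3) by auto
  then show ?thesis using assms(4)[of "\<zero>\<^bsub>G\<^esub>" "\<zero>\<^bsub>G\<^esub>"] by (simp add: H.add.l_cancel_one')
qed

text \<open>Two maps out of free modules have this form: the cover, with \<open>psi b r\<close> the
  action of \<open>r\<close> on \<open>b\<close>, and the map built later from a derivation, where
  \<open>psi b\<close> is additive but not linear over the algebra. For this reason
  \<open>psi\<close> is a family of additive maps and not just a choice of images of the
  generators.\<close>

definition support_sum ::
    "('r, 'x) ring_scheme \<Rightarrow> 'b set \<Rightarrow> ('n, 'y) ring_scheme \<Rightarrow> ('b \<Rightarrow> 'r \<Rightarrow> 'n) \<Rightarrow> ('b \<Rightarrow> 'r) \<Rightarrow> 'n" where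
  "support_sum R B N psi f = (\<Oplus>\<^bsub>N\<^esub>b\<in>{b \<in> B. f b \<noteq> \<zero>\<^bsub>R\<^esub>}. psi b (f b))"

text \<open>The multiple by \<open>r\<close> of the generator indexed by \<open>b\<close>. For
  \<open>b\<close> outside \<open>B\<close> it is the zero function, so it lies in the free module
  in every case.\<close>

definition free_single :: "('r, 'x) ring_scheme \<Rightarrow> 'b set \<Rightarrow> 'b \<Rightarrow> 'r \<Rightarrow> 'b \<Rightarrow> 'r" where
  "free_single R B b r = (\<lambda>x\<in>B. if x = b then r else \<zero>\<^bsub>R\<^esub>)"

lemma free_left_module_sel:
  "carrier (free_left_module R B) = {f \<in> B \<rightarrow>\<^sub>E carrier R. finite {b \<in> B. f b \<noteq> \<zero>\<^bsub>R\<^esub>}}"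
  "\<zero>\<^bsub>free_left_module R B\<^esub> = (\<lambda>b\<in>B. \<zero>\<^bsub>R\<^esub>)"
  "f \<oplus>\<^bsub>free_left_module R B\<^esub> g = (\<lambda>b\<in>B. f b \<oplus>\<^bsub>R\<^esub> g b)"
  "r \<odot>\<^bsub>free_left_module R B\<^esub> f = (\<lambda>b\<in>B. r \<otimes>\<^bsub>R\<^esub> f b)"
  by (simp_all add: free_left_module_def)

lemma free_left_moduleD:
  assumes "f \<in> carrier (free_left_module R B)"
  shows "b \<in> B \<Longrightarrow> f b \<in> carrier R" and "finite {b \<in> B. f b \<noteq> \<zero>\<^bsub>R\<^esub>}"
  using assms by (auto simp: free_left_module_sel)

lemma free_left_module_eqI:
  assumes "f \<in> carrier (free_left_module R B)" "g \<in> carrier (free_left_module R B)"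
    and "\<And>b. b \<in> B \<Longrightarrow> f b = g b"
  shows "f = g"
  using assms by (auto simp: free_left_module_sel intro: PiE_ext)

context ring
begin

lemma free_left_module_closed:
  shows "\<zero>\<^bsub>free_left_module R B\<^esub> \<in> carrier (free_left_module R B)"
    and "\<lbrakk>f \<in> carrier (free_left_module R B); g \<in> carrier (free_left_module R B)\<rbrakk> \<Longrightarrow>
      f \<oplus>\<^bsub>free_left_module R B\<^esub> g \<in> carrier (free_left_module R B)"
    and "\<lbrakk>r \<in> carrier R; f \<in> carrier (free_left_module R B)\<rbrakk> \<Longrightarrow>
      r \<odot>\<^bsub>free_left_module R B\<^esub> f \<in> carrier (free_left_module R B)"
proof -
  show "\<zero>\<^bsub>free_left_module R B\<^esub> \<in> carrier (free_left_module R B)"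
    by (auto simp: free_left_module_sel)
next
  assume f: "f \<in> carrier (free_left_module R B)" and g: "g \<in> carrier (free_left_module R B)"
  have "finite {b \<in> B. f b \<oplus> g b \<noteq> \<zero>}"
    by (rule finite_subset[of _ "{b \<in> B. f b \<noteq> \<zero>} \<union> {b \<in> B. g b \<noteq> \<zero>}"])
      (use free_left_moduleD[OF f] free_left_moduleD[OF g] in auto)
  moreover have "{b \<in> B. (if b \<in> B then f b \<oplus> g b else undefined) \<noteq> \<zero>} = {b \<in> B. f b \<oplus> g b \<noteq> \<zero>}"
    by auto
  ultimately show "f \<oplus>\<^bsub>free_left_module R B\<^esub> g \<in> carrier (free_left_module R B)"
    using free_left_moduleD(1)[OF f] free_left_moduleD(1)[OF g]
    by (simp add: free_left_module_sel restrict_def PiE_iff extensional_def)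
next
  assume r: "r \<in> carrier R" and f: "f \<in> carrier (free_left_module R B)"
  have "finite {b \<in> B. r \<otimes> f b \<noteq> \<zero>}"
    by (rule finite_subset[of _ "{b \<in> B. f b \<noteq> \<zero>}"]) (use r free_left_moduleD[OF f] in auto)
  moreover have "{b \<in> B. (if b \<in> B then r \<otimes> f b else undefined) \<noteq> \<zero>} = {b \<in> B. r \<otimes> f b \<noteq> \<zero>}"
    by auto
  ultimately show "r \<odot>\<^bsub>free_left_module R B\<^esub> f \<in> carrier (free_left_module R B)"
    using r free_left_moduleD(1)[OF f]
    by (simp add: free_left_module_sel restrict_def PiE_iff extensional_def)
qed

lemma free_single_closed:
  "r \<in> carrier R \<Longrightarrow> free_single R B b r \<in> carrier (free_left_module R B)"
proof -
  assume r: "r \<in> carrier R"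
  have "finite {x \<in> B. free_single R B b r x \<noteq> \<zero>}"
    by (rule finite_subset[of _ "{b}"]) (auto simp: free_single_def)
  then show ?thesis using r by (auto simp: free_left_module_sel free_single_def)
qed

lemma left_module_free_left_module: "left_module R (free_left_module R B)"
proof -
  let ?F = "free_left_module R B"
  have "abelian_group ?F"
  proof (rule abelian_groupI)
    fix f assume f: "f \<in> carrier ?F"
    show "\<exists>g\<in>carrier ?F. g \<oplus>\<^bsub>?F\<^esub> f = \<zero>\<^bsub>?F\<^esub>"
    proof (rule bexI)
      show "((\<ominus> \<one>) \<odot>\<^bsub>?F\<^esub> f) \<oplus>\<^bsub>?F\<^esub> f = \<zero>\<^bsub>?F\<^esub>"
        using free_left_moduleD(1)[OF f]
        by (auto simp: free_left_module_sel l_minus l_neg intro!: restrict_ext)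
    qed (simp add: free_left_module_closed f)
  next
    fix f assume f: "f \<in> carrier ?F"
    show "\<zero>\<^bsub>?F\<^esub> \<oplus>\<^bsub>?F\<^esub> f = f"
      using f free_left_moduleD(1)[OF f]
      by (intro free_left_module_eqI[of _ R B] free_left_module_closed) (auto simp: free_left_module_sel)
  qed (auto simp: free_left_module_closed, auto simp: free_left_module_sel a_ac PiE_iff intro!: restrict_ext)
  then show ?thesis
  proof (intro left_module.intro left_module_axioms.intro ring_axioms)
    fix f assume f: "f \<in> carrier ?F"
    show "\<one> \<odot>\<^bsub>?F\<^esub> f = f"
      using f free_left_moduleD(1)[OF f]
      by (intro free_left_module_eqI[of _ R B] free_left_module_closed) (auto simp: free_left_module_sel)
  qed (auto simp: free_left_module_closed,
      auto simp: free_left_module_sel l_distr r_distr m_assoc PiE_iff intro!: restrict_ext)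
qed

end

locale support_sum_map = R?: ring R + N?: abelian_group N
  for R :: "('r, 'x) ring_scheme" (structure) and N :: "('n, 'y) ring_scheme" (structure) +
  fixes B :: "'b set" and psi :: "'b \<Rightarrow> 'r \<Rightarrow> 'n"
  assumes psi_closed: "\<lbrakk>b \<in> B; r \<in> carrier R\<rbrakk> \<Longrightarrow> psi b r \<in> carrier N"
    and psi_add: "\<lbrakk>b \<in> B; r \<in> carrier R; s \<in> carrier R\<rbrakk> \<Longrightarrow>
      psi b (r \<oplus>\<^bsub>R\<^esub> s) = psi b r \<oplus>\<^bsub>N\<^esub> psi b s"
begin

lemma psi_zero: "b \<in> B \<Longrightarrow> psi b \<zero>\<^bsub>R\<^esub> = \<zero>\<^bsub>N\<^esub>"
  by (rule additive_zero[OF R.abelian_group_axioms N.abelian_group_axioms])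
    (auto simp: psi_closed psi_add)

text \<open>Each \<open>psi b\<close> sends zero to zero, so extra indices add nothing. This brings
  sums over different supports to a common index set.\<close>

lemma support_sum_superset:
  assumes "\<And>b. b \<in> B \<Longrightarrow> f b \<in> carrier R" "finite T" "T \<subseteq> B" "{b \<in> B. f b \<noteq> \<zero>\<^bsub>R\<^esub>} \<subseteq> T"
  shows "support_sum R B N psi f = (\<Oplus>\<^bsub>N\<^esub>b\<in>T. psi b (f b))"
  unfolding support_sum_def using assms
  by (intro N.add.finprod_mono_neutral_cong_left) (auto simp: psi_closed psi_zero subset_iff)

lemma support_sum_closed:
  assumes f: "f \<in> carrier (free_left_module R B)"
  shows "support_sum R B N psi f \<in> carrier N"
  unfolding support_sum_def using free_left_moduleD[OF f] by (auto intro!: N.finsum_closed psi_closed)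

lemma support_sum_add:
  assumes f: "f \<in> carrier (free_left_module R B)" and g: "g \<in> carrier (free_left_module R B)"
  shows "support_sum R B N psi (f \<oplus>\<^bsub>free_left_module R B\<^esub> g) =
    support_sum R B N psi f \<oplus>\<^bsub>N\<^esub> support_sum R B N psi g"
proof -
  define T where "T = {b \<in> B. f b \<noteq> \<zero>\<^bsub>R\<^esub>} \<union> {b \<in> B. g b \<noteq> \<zero>\<^bsub>R\<^esub>}"
  note fD = free_left_moduleD[OF f] and gD = free_left_moduleD[OF g]
  have T: "finite T" "T \<subseteq> B" using fD(2) gD(2) by (auto simp: T_def)
  have cl: "\<And>b. b \<in> T \<Longrightarrow> f b \<in> carrier R" "\<And>b. b \<in> T \<Longrightarrow> g b \<in> carrier R"
    using fD(1) gD(1) T by auto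
  have "support_sum R B N psi (f \<oplus>\<^bsub>free_left_module R B\<^esub> g) =
      (\<Oplus>\<^bsub>N\<^esub>b\<in>T. psi b ((f \<oplus>\<^bsub>free_left_module R B\<^esub> g) b))"
    using T fD(1) gD(1) by (intro support_sum_superset) (auto simp: free_left_module_sel T_def)
  also have "\<dots> = (\<Oplus>\<^bsub>N\<^esub>b\<in>T. psi b (f b) \<oplus>\<^bsub>N\<^esub> psi b (g b))"
    using T cl by (intro N.finsum_cong') (auto simp: free_left_module_sel psi_add psi_closed subset_iff)
  also have "\<dots> = (\<Oplus>\<^bsub>N\<^esub>b\<in>T. psi b (f b)) \<oplus>\<^bsub>N\<^esub> (\<Oplus>\<^bsub>N\<^esub>b\<in>T. psi b (g b))"
    using T cl by (intro N.finsum_addf) (auto simp: psi_closed subset_iff)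
  also have "(\<Oplus>\<^bsub>N\<^esub>b\<in>T. psi b (f b)) = support_sum R B N psi f"
    using T fD(1) by (intro support_sum_superset[symmetric]) (auto simp: T_def)
  also have "(\<Oplus>\<^bsub>N\<^esub>b\<in>T. psi b (g b)) = support_sum R B N psi g"
    using T gD(1) by (intro support_sum_superset[symmetric]) (auto simp: T_def)
  finally show ?thesis .
qed

text \<open>With \<open>psi\<close> merely additive, the factor \<open>r\<close> can only be moved
  inside; what becomes of it there depends on the particular \<open>psi\<close>.\<close>

lemma support_sum_smult:
  assumes r: "r \<in> carrier R" and f: "f \<in> carrier (free_left_module R B)"
  shows "support_sum R B N psi (r \<odot>\<^bsub>free_left_module R B\<^esub> f) =
    support_sum R B N (\<lambda>b s. psi b (r \<otimes>\<^bsub>R\<^esub> s)) f"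
proof -
  note fD = free_left_moduleD[OF f]
  have "support_sum R B N psi (r \<odot>\<^bsub>free_left_module R B\<^esub> f) =
      (\<Oplus>\<^bsub>N\<^esub>b\<in>{b \<in> B. f b \<noteq> \<zero>\<^bsub>R\<^esub>}. psi b ((r \<odot>\<^bsub>free_left_module R B\<^esub> f) b))"
    using fD r by (intro support_sum_superset) (auto simp: free_left_module_sel)
  also have "\<dots> = support_sum R B N (\<lambda>b s. psi b (r \<otimes>\<^bsub>R\<^esub> s)) f"
    unfolding support_sum_def using fD r
    by (intro N.finsum_cong') (auto simp: free_left_module_sel psi_closed)
  finally show ?thesis .
qed

lemma support_sum_single:
  assumes b: "b \<in> B" and r: "r \<in> carrier R"
  shows "support_sum R B N psi (free_single R B b r) = psi b r"
proof -
  have "support_sum R B N psi (free_single R B b r) = (\<Oplus>\<^bsub>N\<^esub>x\<in>{b}. psi x (free_single R B b r x))"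
    using assms by (intro support_sum_superset) (auto simp: free_single_def)
  also have "\<dots> = psi b r"
    using assms psi_closed[of b r] by (simp add: free_single_def)
  finally show ?thesis .
qed

text \<open>Additivity of \<open>h\<close> is enough to pass through a finite sum. It is applied
  with \<open>h\<close> the action of a ring element and with \<open>h\<close> a module
  homomorphism.\<close>

lemma support_sum_additive_image:
  assumes N': "abelian_group N'" and h: "h \<in> carrier N \<rightarrow> carrier N'"
    and h_add: "\<And>x y. \<lbrakk>x \<in> carrier N; y \<in> carrier N\<rbrakk> \<Longrightarrow> h (x \<oplus>\<^bsub>N\<^esub> y) = h x \<oplus>\<^bsub>N'\<^esub> h y"
    and f: "f \<in> carrier (free_left_module R B)"
  shows "h (support_sum R B N psi f) = support_sum R B N' (\<lambda>b r. h (psi b r)) f"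
proof -
  interpret N': abelian_group N' by fact
  have h0: "h \<zero>\<^bsub>N\<^esub> = \<zero>\<^bsub>N'\<^esub>"
    by (rule additive_zero[OF N.abelian_group_axioms N' h h_add])
  note fD = free_left_moduleD[OF f]
  have "h (\<Oplus>\<^bsub>N\<^esub>b\<in>T. psi b (f b)) = (\<Oplus>\<^bsub>N'\<^esub>b\<in>T. h (psi b (f b)))"
    if "finite T" "T \<subseteq> B" for T
    using that
  proof (induction T)
    case empty then show ?case using h0 by simp
  next
    case (insert t T)
    have cl: "psi b (f b) \<in> carrier N" if "b \<in> insert t T" for b
      using that insert.prems fD(1) psi_closed by blast
    have cl': "h (psi b (f b)) \<in> carrier N'" if "b \<in> insert t T" for b
      using cl[OF that] h by blast
    have "(\<Oplus>\<^bsub>N\<^esub>b\<in>insert t T. psi b (f b)) = psi t (f t) \<oplus>\<^bsub>N\<^esub> (\<Oplus>\<^bsub>N\<^esub>b\<in>T. psi b (f b))"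
      using insert.hyps cl by (intro N.finsum_insert) auto
    moreover have "(\<Oplus>\<^bsub>N'\<^esub>b\<in>insert t T. h (psi b (f b))) =
        h (psi t (f t)) \<oplus>\<^bsub>N'\<^esub> (\<Oplus>\<^bsub>N'\<^esub>b\<in>T. h (psi b (f b)))"
      using insert.hyps cl' by (intro N'.finsum_insert) auto
    moreover have "(\<Oplus>\<^bsub>N\<^esub>b\<in>T. psi b (f b)) \<in> carrier N"
      using cl by (intro N.finsum_closed) auto
    ultimately show ?case using insert.IH insert.prems cl by (simp add: h_add)
  qed
  then show ?thesis unfolding support_sum_def using fD(2) by auto
qed

end

section \<open>Homomorphisms and the free cover\<close>

lemma left_module_homD:
  assumes "f \<in> left_module_hom R M N"
  shows "x \<in> carrier M \<Longrightarrow> f x \<in> carrier N"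
    and "\<lbrakk>x \<in> carrier M; y \<in> carrier M\<rbrakk> \<Longrightarrow> f (x \<oplus>\<^bsub>M\<^esub> y) = f x \<oplus>\<^bsub>N\<^esub> f y"
    and "\<lbrakk>a \<in> carrier R; x \<in> carrier M\<rbrakk> \<Longrightarrow> f (a \<odot>\<^bsub>M\<^esub> x) = a \<odot>\<^bsub>N\<^esub> f x"
    and "f \<in> extensional (carrier M)"
  using assms by (auto simp: left_module_hom_def PiE_iff)

lemma left_module_homI:
  assumes "\<And>x. x \<in> carrier M \<Longrightarrow> f x \<in> carrier N"
    and "\<And>x y. \<lbrakk>x \<in> carrier M; y \<in> carrier M\<rbrakk> \<Longrightarrow> f (x \<oplus>\<^bsub>M\<^esub> y) = f x \<oplus>\<^bsub>N\<^esub> f y"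
    and "\<And>a x. \<lbrakk>a \<in> carrier R; x \<in> carrier M\<rbrakk> \<Longrightarrow> f (a \<odot>\<^bsub>M\<^esub> x) = a \<odot>\<^bsub>N\<^esub> f x"
    and "f \<in> extensional (carrier M)"
  shows "f \<in> left_module_hom R M N"
  using assms by (auto simp: left_module_hom_def PiE_iff)

lemma left_module_hom_zero:
  assumes "left_module R M" "left_module R N" "f \<in> left_module_hom R M N"
  shows "f \<zero>\<^bsub>M\<^esub> = \<zero>\<^bsub>N\<^esub>"
  using assms left_module_homD[OF assms(3)]
  by (intro additive_zero[of M N]) (auto simp: left_module_def)

lemma left_module_hom_minus:
  assumes M: "left_module R M" and N: "left_module R N" and f: "f \<in> left_module_hom R M N"
    and x: "x \<in> carrier M"
  shows "f (\<ominus>\<^bsub>M\<^esub> x) = \<ominus>\<^bsub>N\<^esub> f x"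
proof -
  interpret M: left_module R M by fact
  interpret N: left_module R N by fact
  show ?thesis
    using x left_module_homD(1)[OF f x] left_module_homD(3)[OF f _ x, of "\<ominus>\<^bsub>R\<^esub> \<one>\<^bsub>R\<^esub>"]
    by (simp add: M.smult_minus_one N.smult_minus_one)
qed

lemma (in left_module) support_sum_map_smult:
  assumes "B \<subseteq> carrier M"
  shows "support_sum_map R M B (\<lambda>b r. r \<odot>\<^bsub>M\<^esub> b)"
  using assms by unfold_locales (auto simp: smult_closed smult_l_distr)

lemma free_cover_eq:
  "f \<in> carrier (free_left_module R B) \<Longrightarrow> free_cover R M B f = support_sum R B M (\<lambda>b r. r \<odot>\<^bsub>M\<^esub> b) f"
  by (simp add: free_cover_def support_sum_def)

context
  fixes R :: "('r, 'x) ring_scheme" and M :: "('r, 'm) module" and B :: "'m set"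
  assumes M: "left_module R M" and B: "B \<subseteq> carrier M"
begin

interpretation M: left_module R M by (rule M)
interpretation S: support_sum_map R M B "\<lambda>b r. r \<odot>\<^bsub>M\<^esub> b" by (rule M.support_sum_map_smult[OF B])

lemma free_cover_hom: "free_cover R M B \<in> left_module_hom R (free_left_module R B) M"
proof (rule left_module_homI)
  show "free_cover R M B \<in> extensional (carrier (free_left_module R B))"
    by (simp add: free_cover_def)
next
  fix a f assume a: "a \<in> carrier R" and f: "f \<in> carrier (free_left_module R B)"
  have "a \<odot>\<^bsub>M\<^esub> free_cover R M B f = support_sum R B M (\<lambda>b r. a \<odot>\<^bsub>M\<^esub> (r \<odot>\<^bsub>M\<^esub> b)) f"
    unfolding free_cover_eq[OF f] using a f
    by (intro S.support_sum_additive_image M.M.abelian_group_axioms)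
      (auto simp: M.smult_closed M.smult_r_distr)
  also have "\<dots> = support_sum R B M (\<lambda>b r. (a \<otimes>\<^bsub>R\<^esub> r) \<odot>\<^bsub>M\<^esub> b) f"
    unfolding support_sum_def using a B free_left_moduleD[OF f]
    by (intro M.M.finsum_cong') (auto simp: M.smult_assoc1 M.smult_closed subset_iff)
  finally show "free_cover R M B (a \<odot>\<^bsub>free_left_module R B\<^esub> f) = a \<odot>\<^bsub>M\<^esub> free_cover R M B f"
    using a f by (simp add: free_cover_eq M.free_left_module_closed S.support_sum_smult)
qed (auto simp: free_cover_eq M.free_left_module_closed S.support_sum_add S.support_sum_closed)

lemma free_cover_single:
  "\<lbrakk>b \<in> B; r \<in> carrier R\<rbrakk> \<Longrightarrow> free_cover R M B (free_single R B b r) = r \<odot>\<^bsub>M\<^esub> b"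
  by (simp add: free_cover_eq M.free_single_closed S.support_sum_single)

text \<open>A homomorphism that kills the generators kills all their combinations. Taking a kernel
  for \<open>B\<close>, this is how consecutive maps of the resolution are seen to compose to
  zero.\<close>

lemma free_cover_hom_eq_zero:
  assumes N: "left_module R N" and g: "g \<in> left_module_hom R M N"
    and gB: "\<And>b. b \<in> B \<Longrightarrow> g b = \<zero>\<^bsub>N\<^esub>" and f: "f \<in> carrier (free_left_module R B)"
  shows "g (free_cover R M B f) = \<zero>\<^bsub>N\<^esub>"
proof -
  interpret N: left_module R N by fact
  have "g (free_cover R M B f) = support_sum R B N (\<lambda>b r. g (r \<odot>\<^bsub>M\<^esub> b)) f"
    unfolding free_cover_eq[OF f] using g f
    by (intro S.support_sum_additive_image N.M.abelian_group_axioms) (auto dest: left_module_homD)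
  also have "\<dots> = \<zero>\<^bsub>N\<^esub>"
    unfolding support_sum_def using B free_left_moduleD[OF f]
    by (intro N.M.add.finprod_one_eqI) (auto simp: left_module_homD(3)[OF g] gB subset_iff)
  finally show ?thesis .
qed

end

section \<open>Cocycles as homomorphisms on the kernel of the cover\<close>

context
  fixes R :: "('k, 'r) module" and M :: "('r, 'm) module"
  assumes M: "left_module R M"
begin

interpretation M: left_module R M by (rule M)

lemma left_module_res0: "left_module R (res0 R M)"
  unfolding res0_def by (rule M.left_module_free_left_module)

interpretation F0: left_module R "res0 R M" by (rule left_module_res0)

lemma res_d0_hom: "free_cover R M (carrier M) \<in> left_module_hom R (res0 R M) M"
  unfolding res0_def by (rule free_cover_hom[OF M subset_refl])

lemma res_ker0_subset: "res_ker0 R M \<subseteq> carrier (res0 R M)"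
  by (auto simp: res_ker0_def)

lemma res_ker0_closed:
  shows "\<lbrakk>k \<in> res_ker0 R M; l \<in> res_ker0 R M\<rbrakk> \<Longrightarrow> k \<oplus>\<^bsub>res0 R M\<^esub> l \<in> res_ker0 R M"
    and "\<lbrakk>a \<in> carrier R; k \<in> res_ker0 R M\<rbrakk> \<Longrightarrow> a \<odot>\<^bsub>res0 R M\<^esub> k \<in> res_ker0 R M"
  using left_module_homD[OF res_d0_hom] by (auto simp: res_ker0_def F0.smult_closed)

lemma left_module_res1: "left_module R (res1 R M)"
  unfolding res1_def by (rule M.left_module_free_left_module)

interpretation F1: left_module R "res1 R M" by (rule left_module_res1)

lemma res_d1_hom: "res_d1 R M \<in> left_module_hom R (res1 R M) (res0 R M)"
  unfolding res1_def res_d1_def by (rule free_cover_hom[OF left_module_res0 res_ker0_subset])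

lemma res_d1_in_ker0: "x \<in> carrier (res1 R M) \<Longrightarrow> res_d1 R M x \<in> res_ker0 R M"
  using free_cover_hom_eq_zero[OF left_module_res0 res_ker0_subset M res_d0_hom, of x]
    left_module_homD(1)[OF res_d1_hom]
  by (simp add: res_ker0_def res_d1_def res1_def)

text \<open>The generator of \<open>res1\<close> belonging to a kernel element \<open>k\<close>. As
  a function of \<open>k\<close> it is a section of \<open>res_d1\<close> that is not linear; the
  next lemmas show that cocycles do not notice this.\<close>

abbreviation res1_gen :: "('m \<Rightarrow> 'r) \<Rightarrow> ('m \<Rightarrow> 'r) \<Rightarrow> 'r" where
  "res1_gen k \<equiv> free_single R (res_ker0 R M) k \<one>\<^bsub>R\<^esub>"

lemma res1_gen_closed: "res1_gen k \<in> carrier (res1 R M)"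
  unfolding res1_def by (simp add: M.free_single_closed)

lemma res_d1_gen: "k \<in> res_ker0 R M \<Longrightarrow> res_d1 R M (res1_gen k) = k"
  using free_cover_single[OF left_module_res0 res_ker0_subset, of k "\<one>\<^bsub>R\<^esub>"] res_ker0_subset
  by (auto simp: res_d1_def F0.smult_one)

lemma res_d1_d2:
  assumes "x \<in> carrier (res2 R M)"
  shows "res_d2 R M x \<in> carrier (res1 R M)" and "res_d1 R M (res_d2 R M x) = \<zero>\<^bsub>res0 R M\<^esub>"
proof -
  have sub: "res_ker1 R M \<subseteq> carrier (res1 R M)" by (auto simp: res_ker1_def)
  show "res_d2 R M x \<in> carrier (res1 R M)"
    using left_module_homD(1)[OF free_cover_hom[OF left_module_res1 sub]] assms
    by (simp add: res_d2_def res2_def)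
  show "res_d1 R M (res_d2 R M x) = \<zero>\<^bsub>res0 R M\<^esub>"
    unfolding res_d2_def using assms
    by (intro free_cover_hom_eq_zero[OF left_module_res1 sub left_module_res0 res_d1_hom])
      (auto simp: res_ker1_def res2_def)
qed

context
  fixes N :: "('r, 'n) module"
  assumes N: "left_module R N"
begin

interpretation N: left_module R N by (rule N)

text \<open>Every element of \<open>res_ker1\<close> is the image under \<open>res_d2\<close> of its
  own generator in \<open>res2\<close>.\<close>

lemma ext1_cocycle_vanishes:
  assumes f: "f \<in> ext1_cocycles R M N" and x: "x \<in> res_ker1 R M"
  shows "f x = \<zero>\<^bsub>N\<^esub>"
proof -
  have sub: "res_ker1 R M \<subseteq> carrier (res1 R M)" by (auto simp: res_ker1_def)
  have "res_d2 R M (free_single R (res_ker1 R M) x \<one>\<^bsub>R\<^esub>) = x"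
    using free_cover_single[OF left_module_res1 sub x, of "\<one>\<^bsub>R\<^esub>"] x sub
    by (auto simp: res_d2_def F1.smult_one)
  moreover have "free_single R (res_ker1 R M) x \<one>\<^bsub>R\<^esub> \<in> carrier (res2 R M)"
    unfolding res2_def by (simp add: M.free_single_closed)
  ultimately show ?thesis using f by (force simp: ext1_cocycles_def)
qed

text \<open>The element \<open>x\<close> and the generator lying over \<open>res_d1 R M x\<close>
  have the same image under \<open>res_d1\<close>, so their difference lies in
  \<open>res_ker1\<close>.\<close>

lemma ext1_cocycle_factor:
  assumes f: "f \<in> ext1_cocycles R M N" and x: "x \<in> carrier (res1 R M)"
  shows "f x = f (res1_gen (res_d1 R M x))"
proof -
  define e where "e = res1_gen (res_d1 R M x)"
  have fh: "f \<in> left_module_hom R (res1 R M) N" using f by (simp add: ext1_cocycles_def)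
  have e: "e \<in> carrier (res1 R M)" unfolding e_def by (rule res1_gen_closed)
  have de: "res_d1 R M e = res_d1 R M x"
    unfolding e_def using res_d1_gen res_d1_in_ker0[OF x] by blast
  have dx: "res_d1 R M x \<in> carrier (res0 R M)" using left_module_homD(1)[OF res_d1_hom x] .
  have "x \<oplus>\<^bsub>res1 R M\<^esub> (\<ominus>\<^bsub>res1 R M\<^esub> e) \<in> res_ker1 R M"
    using x e dx de left_module_homD[OF res_d1_hom]
      left_module_hom_minus[OF left_module_res1 left_module_res0 res_d1_hom e]
    by (simp add: res_ker1_def F0.M.r_neg)
  from ext1_cocycle_vanishes[OF f this] have "f x \<oplus>\<^bsub>N\<^esub> (\<ominus>\<^bsub>N\<^esub> f e) = \<zero>\<^bsub>N\<^esub>"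
    using x e left_module_homD[OF fh] left_module_hom_minus[OF left_module_res1 N fh e] by simp
  then show ?thesis
    using left_module_homD(1)[OF fh] x e unfolding e_def
    by (metis N.M.minus_equality N.M.minus_minus N.M.a_inv_closed)
qed

text \<open>The generator of a sum and the sum of the generators differ, but have the same image
  under \<open>res_d1\<close>, and a cocycle depends only on that image. The same holds for
  multiples.\<close>

lemma ext1_cocycle_linear:
  assumes f: "f \<in> ext1_cocycles R M N"
  shows "f (res1_gen k) \<in> carrier N"
    and "\<lbrakk>k \<in> res_ker0 R M; l \<in> res_ker0 R M\<rbrakk> \<Longrightarrow>
      f (res1_gen (k \<oplus>\<^bsub>res0 R M\<^esub> l)) = f (res1_gen k) \<oplus>\<^bsub>N\<^esub> f (res1_gen l)"
    and "\<lbrakk>a \<in> carrier R; k \<in> res_ker0 R M\<rbrakk> \<Longrightarrow>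
      f (res1_gen (a \<odot>\<^bsub>res0 R M\<^esub> k)) = a \<odot>\<^bsub>N\<^esub> f (res1_gen k)"
proof -
  have fh: "f \<in> left_module_hom R (res1 R M) N" using f by (simp add: ext1_cocycles_def)
  show "f (res1_gen k) \<in> carrier N" using left_module_homD(1)[OF fh res1_gen_closed] .
  show "f (res1_gen (k \<oplus>\<^bsub>res0 R M\<^esub> l)) = f (res1_gen k) \<oplus>\<^bsub>N\<^esub> f (res1_gen l)"
    if "k \<in> res_ker0 R M" "l \<in> res_ker0 R M"
    using ext1_cocycle_factor[OF f, of "res1_gen k \<oplus>\<^bsub>res1 R M\<^esub> res1_gen l"] that
    by (simp add: res1_gen_closed left_module_homD(2)[OF fh] left_module_homD(2)[OF res_d1_hom]
        res_d1_gen)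
  show "f (res1_gen (a \<odot>\<^bsub>res0 R M\<^esub> k)) = a \<odot>\<^bsub>N\<^esub> f (res1_gen k)"
    if "a \<in> carrier R" "k \<in> res_ker0 R M"
    using ext1_cocycle_factor[OF f, of "a \<odot>\<^bsub>res1 R M\<^esub> res1_gen k"] that
    by (simp add: res1_gen_closed F1.smult_closed left_module_homD(3)[OF fh]
        left_module_homD(3)[OF res_d1_hom] res_d1_gen)
qed

text \<open>The inverse passage, from linear maps on the kernel back to cocycles: composition with
  \<open>res_d1\<close> vanishes on the image of \<open>res_d2\<close> because \<open>res_d1\<close>
  does.\<close>

lemma ext1_cocycle_of_linear:
  assumes cl: "\<And>k. k \<in> res_ker0 R M \<Longrightarrow> phi k \<in> carrier N"
    and add: "\<And>k l. \<lbrakk>k \<in> res_ker0 R M; l \<in> res_ker0 R M\<rbrakk> \<Longrightarrow>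
      phi (k \<oplus>\<^bsub>res0 R M\<^esub> l) = phi k \<oplus>\<^bsub>N\<^esub> phi l"
    and smult: "\<And>a k. \<lbrakk>a \<in> carrier R; k \<in> res_ker0 R M\<rbrakk> \<Longrightarrow>
      phi (a \<odot>\<^bsub>res0 R M\<^esub> k) = a \<odot>\<^bsub>N\<^esub> phi k"
  shows "(\<lambda>x\<in>carrier (res1 R M). phi (res_d1 R M x)) \<in> ext1_cocycles R M N"
proof -
  have zero: "\<zero>\<^bsub>res0 R M\<^esub> \<in> res_ker0 R M"
    using left_module_hom_zero[OF left_module_res0 M res_d0_hom] by (simp add: res_ker0_def)
  have "phi \<zero>\<^bsub>res0 R M\<^esub> = \<zero>\<^bsub>N\<^esub>"
    using smult[OF M.R.zero_closed zero] cl[OF zero] by simp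
  then show ?thesis
    unfolding ext1_cocycles_def
    by (auto intro!: left_module_homI simp: cl add smult res_d1_in_ker0 res_d1_d2 F1.smult_closed
        left_module_homD(2,3)[OF res_d1_hom])
qed

text \<open>When cocycles are viewed as linear maps on \<open>res_ker0\<close>, composing a map on
  \<open>res0\<close> with \<open>res_d1\<close> amounts to restricting it to the kernel. Thus
  \<open>ext1\<close> consists of the linear maps on the kernel modulo those that extend to
  \<open>res0\<close>.\<close>

lemma ext1_coboundary_iff:
  "f \<in> ext1_coboundaries R M N \<longleftrightarrow> f \<in> ext1_cocycles R M N \<and>
     (\<exists>g\<in>left_module_hom R (res0 R M) N. \<forall>k\<in>res_ker0 R M. f (res1_gen k) = g k)"
proof (intro iffI conjI)
  assume "f \<in> ext1_coboundaries R M N"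
  then obtain g where g: "g \<in> left_module_hom R (res0 R M) N"
    and f: "f = (\<lambda>x\<in>carrier (res1 R M). g (res_d1 R M x))"
    by (auto simp: ext1_coboundaries_def compose_def)
  have "phi \<in> res_ker0 R M \<Longrightarrow> phi \<in> carrier (res0 R M)" for phi using res_ker0_subset by auto
  then show "f \<in> ext1_cocycles R M N"
    unfolding f by (intro ext1_cocycle_of_linear) (auto simp: left_module_homD[OF g])
  show "\<exists>g\<in>left_module_hom R (res0 R M) N. \<forall>k\<in>res_ker0 R M. f (res1_gen k) = g k"
    using g by (intro bexI[of _ g]) (auto simp: f res1_gen_closed res_d1_gen)
next
  assume "f \<in> ext1_cocycles R M N \<and>
     (\<exists>g\<in>left_module_hom R (res0 R M) N. \<forall>k\<in>res_ker0 R M. f (res1_gen k) = g k)"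
  then obtain g where f: "f \<in> ext1_cocycles R M N" and g: "g \<in> left_module_hom R (res0 R M) N"
    and fg: "\<And>k. k \<in> res_ker0 R M \<Longrightarrow> f (res1_gen k) = g k" by blast
  have "f = compose (carrier (res1 R M)) g (res_d1 R M)"
  proof (rule extensionalityI)
    show "f \<in> extensional (carrier (res1 R M))"
      using f left_module_homD(4) by (auto simp: ext1_cocycles_def)
    fix x assume x: "x \<in> carrier (res1 R M)"
    show "f x = compose (carrier (res1 R M)) g (res_d1 R M) x"
      using ext1_cocycle_factor[OF f x] fg[OF res_d1_in_ker0[OF x]] x by (simp add: compose_eq)
  qed (rule compose_extensional)
  then show "f \<in> ext1_coboundaries R M N" using g by (auto simp: ext1_coboundaries_def)
qed

end

end

section \<open>Algebras of finite monoids\<close>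

locale finite_monoid_algebra = K: cring K + S: monoid S
  for K :: "('k, 'x) ring_scheme" and S :: "('s, 'y) monoid_scheme" +
  assumes finite_S: "finite (carrier S)"
begin

abbreviation alg :: "('k, 's \<Rightarrow> 'k) module" where
  "alg \<equiv> monoid_algebra K S"

text \<open>The linear extension to the algebra of a function on the monoid. Testing against all
  such functionals replaces computation with the coefficients of products.\<close>

definition lin :: "('s \<Rightarrow> 'k) \<Rightarrow> ('s \<Rightarrow> 'k) \<Rightarrow> 'k" where
  "lin phi f = (\<Oplus>\<^bsub>K\<^esub>s\<in>carrier S. f s \<otimes>\<^bsub>K\<^esub> phi s)"

definition elt :: "'s \<Rightarrow> 's \<Rightarrow> 'k" where
  "elt s = (\<lambda>t\<in>carrier S. if t = s then \<one>\<^bsub>K\<^esub> else \<zero>\<^bsub>K\<^esub>)"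

definition scalar :: "'k \<Rightarrow> 's \<Rightarrow> 'k" where
  "scalar c = c \<odot>\<^bsub>alg\<^esub> \<one>\<^bsub>alg\<^esub>"

lemma alg_sel:
  "carrier alg = carrier S \<rightarrow>\<^sub>E carrier K"
  "\<zero>\<^bsub>alg\<^esub> = (\<lambda>s\<in>carrier S. \<zero>\<^bsub>K\<^esub>)"
  "\<one>\<^bsub>alg\<^esub> = elt \<one>\<^bsub>S\<^esub>"
  "f \<oplus>\<^bsub>alg\<^esub> g = (\<lambda>s\<in>carrier S. f s \<oplus>\<^bsub>K\<^esub> g s)"
  "c \<odot>\<^bsub>alg\<^esub> f = (\<lambda>s\<in>carrier S. c \<otimes>\<^bsub>K\<^esub> f s)"
  using finite_S by (auto simp: monoid_algebra_def elt_def)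

lemma alg_app: "\<lbrakk>f \<in> carrier alg; s \<in> carrier S\<rbrakk> \<Longrightarrow> f s \<in> carrier K"
  by (auto simp: alg_sel)

lemma alg_closed [simp, intro]:
  "\<zero>\<^bsub>alg\<^esub> \<in> carrier alg" "elt s \<in> carrier alg"
  "\<lbrakk>f \<in> carrier alg; g \<in> carrier alg\<rbrakk> \<Longrightarrow> f \<oplus>\<^bsub>alg\<^esub> g \<in> carrier alg"
  "\<lbrakk>c \<in> carrier K; f \<in> carrier alg\<rbrakk> \<Longrightarrow> c \<odot>\<^bsub>alg\<^esub> f \<in> carrier alg"
  "c \<in> carrier K \<Longrightarrow> scalar c \<in> carrier alg"
  by (auto simp: alg_sel elt_def scalar_def)

lemma lin_closed [simp, intro]:
  "\<lbrakk>phi \<in> carrier S \<rightarrow> carrier K; f \<in> carrier alg\<rbrakk> \<Longrightarrow> lin phi f \<in> carrier K"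
  unfolding lin_def by (intro K.finsum_closed) (auto simp: alg_app)

lemma lin_cong:
  assumes "\<And>s. s \<in> carrier S \<Longrightarrow> phi s = psi s" "psi \<in> carrier S \<rightarrow> carrier K" "f \<in> carrier alg"
  shows "lin phi f = lin psi f"
  unfolding lin_def using assms by (intro K.finsum_cong') (auto simp: alg_app)

lemma lin_add_alg:
  assumes "phi \<in> carrier S \<rightarrow> carrier K" "f \<in> carrier alg" "g \<in> carrier alg"
  shows "lin phi (f \<oplus>\<^bsub>alg\<^esub> g) = lin phi f \<oplus>\<^bsub>K\<^esub> lin phi g"
proof -
  have "lin phi (f \<oplus>\<^bsub>alg\<^esub> g) = (\<Oplus>\<^bsub>K\<^esub>s\<in>carrier S. f s \<otimes>\<^bsub>K\<^esub> phi s \<oplus>\<^bsub>K\<^esub> g s \<otimes>\<^bsub>K\<^esub> phi s)"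
    unfolding lin_def using assms
    by (intro K.finsum_cong') (auto simp: alg_sel K.l_distr Pi_iff PiE_iff)
  also have "\<dots> = lin phi f \<oplus>\<^bsub>K\<^esub> lin phi g"
    unfolding lin_def using assms by (intro K.finsum_addf) (auto simp: alg_app)
  finally show ?thesis .
qed

lemma lin_smult_alg:
  assumes "phi \<in> carrier S \<rightarrow> carrier K" "f \<in> carrier alg" "c \<in> carrier K"
  shows "lin phi (c \<odot>\<^bsub>alg\<^esub> f) = c \<otimes>\<^bsub>K\<^esub> lin phi f"
proof -
  have "lin phi (c \<odot>\<^bsub>alg\<^esub> f) = (\<Oplus>\<^bsub>K\<^esub>s\<in>carrier S. c \<otimes>\<^bsub>K\<^esub> (f s \<otimes>\<^bsub>K\<^esub> phi s))"
    unfolding lin_def using assms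
    by (intro K.finsum_cong') (auto simp: alg_sel K.m_assoc Pi_iff PiE_iff)
  also have "\<dots> = c \<otimes>\<^bsub>K\<^esub> lin phi f"
    unfolding lin_def using assms finite_S by (intro K.finsum_rdistr[symmetric]) (auto simp: alg_app)
  finally show ?thesis .
qed

lemma lin_add:
  assumes "phi \<in> carrier S \<rightarrow> carrier K" "psi \<in> carrier S \<rightarrow> carrier K" "f \<in> carrier alg"
  shows "lin (\<lambda>s. phi s \<oplus>\<^bsub>K\<^esub> psi s) f = lin phi f \<oplus>\<^bsub>K\<^esub> lin psi f"
proof -
  have "lin (\<lambda>s. phi s \<oplus>\<^bsub>K\<^esub> psi s) f = (\<Oplus>\<^bsub>K\<^esub>s\<in>carrier S. f s \<otimes>\<^bsub>K\<^esub> phi s \<oplus>\<^bsub>K\<^esub> f s \<otimes>\<^bsub>K\<^esub> psi s)"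
    unfolding lin_def using assms
    by (intro K.finsum_cong') (auto simp: alg_sel K.r_distr Pi_iff PiE_iff)
  also have "\<dots> = lin phi f \<oplus>\<^bsub>K\<^esub> lin psi f"
    unfolding lin_def using assms by (intro K.finsum_addf) (auto simp: alg_app)
  finally show ?thesis .
qed

lemma lin_smult:
  assumes "phi \<in> carrier S \<rightarrow> carrier K" "f \<in> carrier alg" "c \<in> carrier K"
  shows "lin (\<lambda>s. c \<otimes>\<^bsub>K\<^esub> phi s) f = c \<otimes>\<^bsub>K\<^esub> lin phi f"
proof -
  have "lin (\<lambda>s. c \<otimes>\<^bsub>K\<^esub> phi s) f = (\<Oplus>\<^bsub>K\<^esub>s\<in>carrier S. c \<otimes>\<^bsub>K\<^esub> (f s \<otimes>\<^bsub>K\<^esub> phi s))"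
    unfolding lin_def using assms
    by (intro K.finsum_cong') (auto simp: alg_sel K.m_lcomm Pi_iff PiE_iff)
  also have "\<dots> = c \<otimes>\<^bsub>K\<^esub> lin phi f"
    unfolding lin_def using assms finite_S by (intro K.finsum_rdistr[symmetric]) (auto simp: alg_app)
  finally show ?thesis .
qed

lemma lin_elt:
  assumes "phi \<in> carrier S \<rightarrow> carrier K" "s \<in> carrier S"
  shows "lin phi (elt s) = phi s"
proof -
  have "lin phi (elt s) = (\<Oplus>\<^bsub>K\<^esub>t\<in>carrier S. if s = t then phi t else \<zero>\<^bsub>K\<^esub>)"
    unfolding lin_def using assms by (intro K.finsum_cong') (auto simp: elt_def Pi_iff)
  also have "\<dots> = phi s"
    using assms finite_S by (intro K.finsum_singleton) auto
  finally show ?thesis .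
qed

lemma lin_scalar:
  "\<lbrakk>phi \<in> carrier S \<rightarrow> carrier K; c \<in> carrier K\<rbrakk> \<Longrightarrow> lin phi (scalar c) = c \<otimes>\<^bsub>K\<^esub> phi \<one>\<^bsub>S\<^esub>"
  by (simp add: scalar_def lin_smult_alg alg_sel(3) lin_elt)

lemma lin_delta:
  assumes "f \<in> carrier alg" "s \<in> carrier S"
  shows "lin (\<lambda>t. if s = t then \<one>\<^bsub>K\<^esub> else \<zero>\<^bsub>K\<^esub>) f = f s"
proof -
  have "lin (\<lambda>t. if s = t then \<one>\<^bsub>K\<^esub> else \<zero>\<^bsub>K\<^esub>) f = (\<Oplus>\<^bsub>K\<^esub>t\<in>carrier S. if s = t then f t else \<zero>\<^bsub>K\<^esub>)"
    unfolding lin_def using assms by (intro K.finsum_cong') (auto simp: alg_app)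
  also have "\<dots> = f s"
    using assms finite_S by (intro K.finsum_singleton) (auto simp: alg_app)
  finally show ?thesis .
qed

text \<open>The delta functions are among the functionals and read off coefficients. Together with
  \<open>lin_mult\<close> this reduces identities in the algebra to identities in the
  monoid.\<close>

lemma alg_eqI:
  assumes "f \<in> carrier alg" "g \<in> carrier alg"
    and "\<And>phi. phi \<in> carrier S \<rightarrow> carrier K \<Longrightarrow> lin phi f = lin phi g"
  shows "f = g"
proof (rule PiE_ext)
  show "f \<in> carrier S \<rightarrow>\<^sub>E carrier K" "g \<in> carrier S \<rightarrow>\<^sub>E carrier K" using assms alg_sel(1) by auto
  fix s assume "s \<in> carrier S"
  then show "f s = g s"
    using assms(3)[of "\<lambda>t. if s = t then \<one>\<^bsub>K\<^esub> else \<zero>\<^bsub>K\<^esub>"] by (simp add: lin_delta assms(1,2))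
qed

text \<open>The pairs added to the sum have a zero term. Its range no longer depends on
  \<open>f\<close>, \<open>g\<close> or \<open>s\<close>, so sums over \<open>s\<close> and over
  pairs can be interchanged.\<close>

lemma alg_mult_apply:
  assumes f: "f \<in> carrier alg" and g: "g \<in> carrier alg" and s: "s \<in> carrier S"
  shows "(f \<otimes>\<^bsub>alg\<^esub> g) s = (\<Oplus>\<^bsub>K\<^esub>p\<in>carrier S \<times> carrier S.
    if fst p \<otimes>\<^bsub>S\<^esub> snd p = s then f (fst p) \<otimes>\<^bsub>K\<^esub> g (snd p) else \<zero>\<^bsub>K\<^esub>)"
proof -
  have "(f \<otimes>\<^bsub>alg\<^esub> g) s = (\<Oplus>\<^bsub>K\<^esub>p\<in>{(u, v). u \<in> carrier S \<and> v \<in> carrier S \<and> f u \<noteq> \<zero>\<^bsub>K\<^esub> \<and>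
      g v \<noteq> \<zero>\<^bsub>K\<^esub> \<and> u \<otimes>\<^bsub>S\<^esub> v = s}. f (fst p) \<otimes>\<^bsub>K\<^esub> g (snd p))"
    using s by (simp add: monoid_algebra_def)
  also have "\<dots> = (\<Oplus>\<^bsub>K\<^esub>p\<in>carrier S \<times> carrier S.
    if fst p \<otimes>\<^bsub>S\<^esub> snd p = s then f (fst p) \<otimes>\<^bsub>K\<^esub> g (snd p) else \<zero>\<^bsub>K\<^esub>)"
    using finite_S f g
    by (intro K.add.finprod_mono_neutral_cong_left) (auto simp: alg_app)
  finally show ?thesis .
qed

lemma alg_mult_closed:
  assumes f: "f \<in> carrier alg" and g: "g \<in> carrier alg"
  shows "f \<otimes>\<^bsub>alg\<^esub> g \<in> carrier alg"
proof -
  have "(f \<otimes>\<^bsub>alg\<^esub> g) s \<in> carrier K" if "s \<in> carrier S" for s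
    unfolding alg_mult_apply[OF f g that] using f g by (intro K.finsum_closed) (auto simp: alg_app)
  moreover have "f \<otimes>\<^bsub>alg\<^esub> g \<in> extensional (carrier S)" by (simp add: monoid_algebra_def)
  ultimately show ?thesis by (auto simp: alg_sel(1) PiE_iff)
qed

text \<open>After the interchange of summations, each pair of monoid elements meets exactly one
  \<open>s\<close>, namely its product, and the sum over pairs is then taken iteratively.\<close>

lemma lin_mult:
  assumes phi: "phi \<in> carrier S \<rightarrow> carrier K" and f: "f \<in> carrier alg" and g: "g \<in> carrier alg"
  shows "lin phi (f \<otimes>\<^bsub>alg\<^esub> g) = lin (\<lambda>u. lin (\<lambda>v. phi (u \<otimes>\<^bsub>S\<^esub> v)) g) f"
proof -
  let ?S = "carrier S"
  let ?F = "\<lambda>p. f (fst p) \<otimes>\<^bsub>K\<^esub> g (snd p)"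
  have F: "?F p \<in> carrier K" "fst p \<otimes>\<^bsub>S\<^esub> snd p \<in> ?S" if "p \<in> ?S \<times> ?S" for p
    using that f g by (auto simp: alg_app)
  have phi': "phi s \<in> carrier K" if "s \<in> ?S" for s using phi that by auto
  have "lin phi (f \<otimes>\<^bsub>alg\<^esub> g) = (\<Oplus>\<^bsub>K\<^esub>s\<in>?S. \<Oplus>\<^bsub>K\<^esub>p\<in>?S \<times> ?S.
      if fst p \<otimes>\<^bsub>S\<^esub> snd p = s then ?F p \<otimes>\<^bsub>K\<^esub> phi s else \<zero>\<^bsub>K\<^esub>)"
    unfolding lin_def
  proof (intro K.finsum_cong' refl)
    fix s assume s: "s \<in> ?S"
    have "(f \<otimes>\<^bsub>alg\<^esub> g) s \<otimes>\<^bsub>K\<^esub> phi s = (\<Oplus>\<^bsub>K\<^esub>p\<in>?S \<times> ?S.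
        (if fst p \<otimes>\<^bsub>S\<^esub> snd p = s then ?F p else \<zero>\<^bsub>K\<^esub>) \<otimes>\<^bsub>K\<^esub> phi s)"
      unfolding alg_mult_apply[OF f g s] using finite_S F phi'[OF s]
      by (intro K.finsum_ldistr) auto
    also have "\<dots> = (\<Oplus>\<^bsub>K\<^esub>p\<in>?S \<times> ?S.
      if fst p \<otimes>\<^bsub>S\<^esub> snd p = s then ?F p \<otimes>\<^bsub>K\<^esub> phi s else \<zero>\<^bsub>K\<^esub>)"
      using F phi'[OF s] by (intro K.finsum_cong') auto
    finally show "(f \<otimes>\<^bsub>alg\<^esub> g) s \<otimes>\<^bsub>K\<^esub> phi s = \<dots>" .
  qed (use F phi' in \<open>auto intro!: K.finsum_closed\<close>)
  also have "\<dots> = (\<Oplus>\<^bsub>K\<^esub>p\<in>?S \<times> ?S. \<Oplus>\<^bsub>K\<^esub>s\<in>?S.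
      if fst p \<otimes>\<^bsub>S\<^esub> snd p = s then ?F p \<otimes>\<^bsub>K\<^esub> phi s else \<zero>\<^bsub>K\<^esub>)"
    using finite_S F phi' by (intro K.finsum_finsum_swap) auto
  also have "\<dots> = (\<Oplus>\<^bsub>K\<^esub>p\<in>?S \<times> ?S. ?F p \<otimes>\<^bsub>K\<^esub> phi (fst p \<otimes>\<^bsub>S\<^esub> snd p))"
  proof (intro K.finsum_cong' refl)
    fix p assume p: "p \<in> ?S \<times> ?S"
    show "(\<Oplus>\<^bsub>K\<^esub>s\<in>?S. if fst p \<otimes>\<^bsub>S\<^esub> snd p = s then ?F p \<otimes>\<^bsub>K\<^esub> phi s else \<zero>\<^bsub>K\<^esub>) =
        ?F p \<otimes>\<^bsub>K\<^esub> phi (fst p \<otimes>\<^bsub>S\<^esub> snd p)"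
      using finite_S F[OF p] phi' by (intro K.finsum_singleton) auto
  qed (use F phi' in auto)
  also have "\<dots> = finsum K (\<lambda>(u, v). f u \<otimes>\<^bsub>K\<^esub> (g v \<otimes>\<^bsub>K\<^esub> phi (u \<otimes>\<^bsub>S\<^esub> v))) (?S \<times> ?S)"
    using f g phi' by (intro K.finsum_cong') (auto simp: alg_app K.m_assoc)
  also have "\<dots> = (\<Oplus>\<^bsub>K\<^esub>u\<in>?S. \<Oplus>\<^bsub>K\<^esub>v\<in>?S. f u \<otimes>\<^bsub>K\<^esub> (g v \<otimes>\<^bsub>K\<^esub> phi (u \<otimes>\<^bsub>S\<^esub> v)))"
    using finite_S f g phi' by (intro K.add.finprod_finprod[symmetric]) (auto simp: alg_app)
  also have "\<dots> = lin (\<lambda>u. lin (\<lambda>v. phi (u \<otimes>\<^bsub>S\<^esub> v)) g) f"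
    unfolding lin_def using finite_S f g phi'
    by (intro K.finsum_cong' refl K.finsum_rdistr[symmetric]) (auto simp: alg_app intro!: K.finsum_closed)
  finally show ?thesis .
qed

lemma ring_alg: "ring alg"
proof (rule ringI)
  show "abelian_group alg"
  proof (rule abelian_groupI)
    fix f assume f: "f \<in> carrier alg"
    show "\<exists>g\<in>carrier alg. g \<oplus>\<^bsub>alg\<^esub> f = \<zero>\<^bsub>alg\<^esub>"
    proof (rule bexI)
      show "((\<ominus>\<^bsub>K\<^esub> \<one>\<^bsub>K\<^esub>) \<odot>\<^bsub>alg\<^esub> f) \<oplus>\<^bsub>alg\<^esub> f = \<zero>\<^bsub>alg\<^esub>"
        using alg_app[OF f]
        by (auto simp: alg_sel K.l_minus K.l_neg intro!: restrict_ext)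
    qed (simp add: f)
    show "\<zero>\<^bsub>alg\<^esub> \<oplus>\<^bsub>alg\<^esub> f = f"
      using f by (intro PiE_ext[of _ "carrier S" "\<lambda>_. carrier K"]) (auto simp: alg_sel PiE_iff)
  qed (simp_all, auto simp: alg_sel K.a_ac PiE_iff intro!: restrict_ext)
  have lin2: "(\<lambda>u. lin (\<lambda>v. phi (u \<otimes>\<^bsub>S\<^esub> v)) g) \<in> carrier S \<rightarrow> carrier K"
    if "phi \<in> carrier S \<rightarrow> carrier K" "g \<in> carrier alg" for phi g
    using that by auto
  show "monoid alg"
  proof (rule monoidI)
    show "\<one>\<^bsub>alg\<^esub> \<in> carrier alg" by (simp add: alg_sel(3))
  next
    fix f g h assume fgh: "f \<in> carrier alg" "g \<in> carrier alg" "h \<in> carrier alg"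
    show "f \<otimes>\<^bsub>alg\<^esub> g \<otimes>\<^bsub>alg\<^esub> h = f \<otimes>\<^bsub>alg\<^esub> (g \<otimes>\<^bsub>alg\<^esub> h)"
    proof (rule alg_eqI)
      fix phi assume phi: "phi \<in> carrier S \<rightarrow> carrier K"
      have "lin phi (f \<otimes>\<^bsub>alg\<^esub> g \<otimes>\<^bsub>alg\<^esub> h) =
          lin (\<lambda>u. lin (\<lambda>v. lin (\<lambda>w. phi (u \<otimes>\<^bsub>S\<^esub> v \<otimes>\<^bsub>S\<^esub> w)) h) g) f"
        using phi fgh by (simp add: lin_mult lin2 alg_mult_closed)
      \<comment> \<open>Associativity of the monoid enters here; the remaining steps only unfold
        products.\<close>
      also have "\<dots> = lin (\<lambda>u. lin (\<lambda>v. lin (\<lambda>w. phi (u \<otimes>\<^bsub>S\<^esub> (v \<otimes>\<^bsub>S\<^esub> w))) h) g) f"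
        using phi fgh by (intro lin_cong) (auto simp: S.m_assoc Pi_iff)
      also have "\<dots> = lin (\<lambda>u. lin (\<lambda>x. phi (u \<otimes>\<^bsub>S\<^esub> x)) (g \<otimes>\<^bsub>alg\<^esub> h)) f"
        using phi fgh by (intro lin_cong lin_mult[symmetric] lin2) (auto simp: alg_mult_closed)
      also have "\<dots> = lin phi (f \<otimes>\<^bsub>alg\<^esub> (g \<otimes>\<^bsub>alg\<^esub> h))"
        using phi fgh by (intro lin_mult[symmetric]) (auto simp: alg_mult_closed)
      finally show "lin phi (f \<otimes>\<^bsub>alg\<^esub> g \<otimes>\<^bsub>alg\<^esub> h) = lin phi (f \<otimes>\<^bsub>alg\<^esub> (g \<otimes>\<^bsub>alg\<^esub> h))" .
    qed (simp_all add: fgh alg_mult_closed)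
  next
    fix f assume f: "f \<in> carrier alg"
    show "\<one>\<^bsub>alg\<^esub> \<otimes>\<^bsub>alg\<^esub> f = f"
    proof (rule alg_eqI)
      fix phi assume phi: "phi \<in> carrier S \<rightarrow> carrier K"
      have "lin phi (\<one>\<^bsub>alg\<^esub> \<otimes>\<^bsub>alg\<^esub> f) = lin (\<lambda>v. phi (\<one>\<^bsub>S\<^esub> \<otimes>\<^bsub>S\<^esub> v)) f"
        using phi f lin2[OF phi f] by (simp add: alg_sel(3) lin_mult lin_elt)
      also have "\<dots> = lin phi f" using phi f by (intro lin_cong) auto
      finally show "lin phi (\<one>\<^bsub>alg\<^esub> \<otimes>\<^bsub>alg\<^esub> f) = lin phi f" .
    qed (simp_all add: f alg_sel(3) alg_mult_closed)
    show "f \<otimes>\<^bsub>alg\<^esub> \<one>\<^bsub>alg\<^esub> = f"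
    proof (rule alg_eqI)
      fix phi assume phi: "phi \<in> carrier S \<rightarrow> carrier K"
      have "lin phi (f \<otimes>\<^bsub>alg\<^esub> \<one>\<^bsub>alg\<^esub>) = lin (\<lambda>u. lin (\<lambda>v. phi (u \<otimes>\<^bsub>S\<^esub> v)) (elt \<one>\<^bsub>S\<^esub>)) f"
        using phi f by (simp add: alg_sel(3) lin_mult)
      also have "\<dots> = lin phi f"
        using phi f by (intro lin_cong) (auto simp: lin_elt Pi_iff)
      finally show "lin phi (f \<otimes>\<^bsub>alg\<^esub> \<one>\<^bsub>alg\<^esub>) = lin phi f" .
    qed (simp_all add: f alg_sel(3) alg_mult_closed)
  qed (simp add: alg_mult_closed)
  fix f g h assume fgh: "f \<in> carrier alg" "g \<in> carrier alg" "h \<in> carrier alg"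
  show "(f \<oplus>\<^bsub>alg\<^esub> g) \<otimes>\<^bsub>alg\<^esub> h = f \<otimes>\<^bsub>alg\<^esub> h \<oplus>\<^bsub>alg\<^esub> g \<otimes>\<^bsub>alg\<^esub> h"
    using fgh lin2 by (intro alg_eqI) (simp_all add: alg_mult_closed lin_mult lin_add_alg)
  show "h \<otimes>\<^bsub>alg\<^esub> (f \<oplus>\<^bsub>alg\<^esub> g) = h \<otimes>\<^bsub>alg\<^esub> f \<oplus>\<^bsub>alg\<^esub> h \<otimes>\<^bsub>alg\<^esub> g"
  proof (rule alg_eqI)
    fix phi assume phi: "phi \<in> carrier S \<rightarrow> carrier K"
    have "lin phi (h \<otimes>\<^bsub>alg\<^esub> (f \<oplus>\<^bsub>alg\<^esub> g)) =
        lin (\<lambda>u. lin (\<lambda>v. phi (u \<otimes>\<^bsub>S\<^esub> v)) f \<oplus>\<^bsub>K\<^esub> lin (\<lambda>v. phi (u \<otimes>\<^bsub>S\<^esub> v)) g) h"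
      unfolding lin_mult[OF phi fgh(3) alg_closed(3)[OF fgh(1,2)]]
      using phi fgh by (intro lin_cong lin_add_alg) auto
    also have "\<dots> = lin phi (h \<otimes>\<^bsub>alg\<^esub> f \<oplus>\<^bsub>alg\<^esub> h \<otimes>\<^bsub>alg\<^esub> g)"
      using phi fgh lin2 by (simp add: lin_add lin_add_alg lin_mult alg_mult_closed)
    finally show "lin phi (h \<otimes>\<^bsub>alg\<^esub> (f \<oplus>\<^bsub>alg\<^esub> g)) = \<dots>" .
  qed (simp_all add: fgh alg_mult_closed)
qed

sublocale alg: ring alg by (rule ring_alg)

lemma elt_mult:
  assumes "s \<in> carrier S" "t \<in> carrier S"
  shows "elt s \<otimes>\<^bsub>alg\<^esub> elt t = elt (s \<otimes>\<^bsub>S\<^esub> t)"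
proof (rule alg_eqI)
  fix phi assume phi: "phi \<in> carrier S \<rightarrow> carrier K"
  then have "(\<lambda>u. lin (\<lambda>v. phi (u \<otimes>\<^bsub>S\<^esub> v)) (elt t)) \<in> carrier S \<rightarrow> carrier K" by auto
  moreover have "(\<lambda>v. phi (s \<otimes>\<^bsub>S\<^esub> v)) \<in> carrier S \<rightarrow> carrier K" using phi assms by auto
  ultimately show "lin phi (elt s \<otimes>\<^bsub>alg\<^esub> elt t) = lin phi (elt (s \<otimes>\<^bsub>S\<^esub> t))"
    using phi assms by (simp add: lin_mult lin_elt)
qed simp_all

lemma scalar_mult:
  assumes c: "c \<in> carrier K" and f: "f \<in> carrier alg"
  shows "scalar c \<otimes>\<^bsub>alg\<^esub> f = c \<odot>\<^bsub>alg\<^esub> f" and "f \<otimes>\<^bsub>alg\<^esub> scalar c = c \<odot>\<^bsub>alg\<^esub> f"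
proof -
  show "scalar c \<otimes>\<^bsub>alg\<^esub> f = c \<odot>\<^bsub>alg\<^esub> f"
  proof (rule alg_eqI)
    fix phi assume phi: "phi \<in> carrier S \<rightarrow> carrier K"
    then have "(\<lambda>u. lin (\<lambda>v. phi (u \<otimes>\<^bsub>S\<^esub> v)) f) \<in> carrier S \<rightarrow> carrier K" using f by auto
    then have "lin phi (scalar c \<otimes>\<^bsub>alg\<^esub> f) = c \<otimes>\<^bsub>K\<^esub> lin (\<lambda>v. phi (\<one>\<^bsub>S\<^esub> \<otimes>\<^bsub>S\<^esub> v)) f"
      using phi c f by (simp add: lin_mult lin_scalar)
    also have "lin (\<lambda>v. phi (\<one>\<^bsub>S\<^esub> \<otimes>\<^bsub>S\<^esub> v)) f = lin phi f" using phi f by (intro lin_cong) auto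
    finally show "lin phi (scalar c \<otimes>\<^bsub>alg\<^esub> f) = lin phi (c \<odot>\<^bsub>alg\<^esub> f)"
      using phi c f by (simp add: lin_smult_alg)
  qed (simp_all add: c f)
  show "f \<otimes>\<^bsub>alg\<^esub> scalar c = c \<odot>\<^bsub>alg\<^esub> f"
  proof (rule alg_eqI)
    fix phi assume phi: "phi \<in> carrier S \<rightarrow> carrier K"
    have "lin phi (f \<otimes>\<^bsub>alg\<^esub> scalar c) = lin (\<lambda>u. lin (\<lambda>v. phi (u \<otimes>\<^bsub>S\<^esub> v)) (scalar c)) f"
      using phi c f by (simp add: lin_mult)
    also have "\<dots> = lin (\<lambda>u. c \<otimes>\<^bsub>K\<^esub> phi u) f"
      using phi c f by (intro lin_cong) (auto simp: lin_scalar Pi_iff)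
    also have "\<dots> = lin phi (c \<odot>\<^bsub>alg\<^esub> f)" using phi c f by (simp add: lin_smult lin_smult_alg)
    finally show "lin phi (f \<otimes>\<^bsub>alg\<^esub> scalar c) = lin phi (c \<odot>\<^bsub>alg\<^esub> f)" .
  qed (simp_all add: c f)
qed

lemma scalar_ring_hom:
  shows "scalar \<one>\<^bsub>K\<^esub> = \<one>\<^bsub>alg\<^esub>"
    and "\<lbrakk>c \<in> carrier K; d \<in> carrier K\<rbrakk> \<Longrightarrow> scalar (c \<oplus>\<^bsub>K\<^esub> d) = scalar c \<oplus>\<^bsub>alg\<^esub> scalar d"
    and "\<lbrakk>c \<in> carrier K; d \<in> carrier K\<rbrakk> \<Longrightarrow> scalar (c \<otimes>\<^bsub>K\<^esub> d) = scalar c \<otimes>\<^bsub>alg\<^esub> scalar d"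
proof -
  show "scalar \<one>\<^bsub>K\<^esub> = \<one>\<^bsub>alg\<^esub>"
    by (rule alg_eqI) (auto simp: lin_scalar alg_sel(3) lin_elt Pi_iff)
  show "\<lbrakk>c \<in> carrier K; d \<in> carrier K\<rbrakk> \<Longrightarrow> scalar (c \<oplus>\<^bsub>K\<^esub> d) = scalar c \<oplus>\<^bsub>alg\<^esub> scalar d"
    by (rule alg_eqI) (auto simp: lin_scalar lin_add_alg K.l_distr Pi_iff)
  show "\<lbrakk>c \<in> carrier K; d \<in> carrier K\<rbrakk> \<Longrightarrow> scalar (c \<otimes>\<^bsub>K\<^esub> d) = scalar c \<otimes>\<^bsub>alg\<^esub> scalar d"
    by (rule alg_eqI) (auto simp: scalar_mult lin_scalar lin_smult_alg K.m_ac Pi_iff)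
qed

text \<open>Induction over a finite set containing the support, splitting off one coefficient at a
  time.\<close>

lemma alg_induct [consumes 1, case_names zero add]:
  assumes f: "f \<in> carrier alg" and zero: "P \<zero>\<^bsub>alg\<^esub>"
    and add: "\<And>c s g. \<lbrakk>c \<in> carrier K; s \<in> carrier S; g \<in> carrier alg; P g\<rbrakk> \<Longrightarrow>
      P (scalar c \<otimes>\<^bsub>alg\<^esub> elt s \<oplus>\<^bsub>alg\<^esub> g)"
  shows "P f"
proof -
  have "P f" if "finite T" "T \<subseteq> carrier S" "f \<in> carrier alg"
    "\<And>s. \<lbrakk>s \<in> carrier S; s \<notin> T\<rbrakk> \<Longrightarrow> f s = \<zero>\<^bsub>K\<^esub>" for T f
    using that
  proof (induction T arbitrary: f rule: finite_induct)
    case empty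
    then have "f = \<zero>\<^bsub>alg\<^esub>"
      by (intro PiE_ext[of _ "carrier S" "\<lambda>_. carrier K"]) (auto simp: alg_sel)
    then show ?case using zero by simp
  next
    case (insert t T)
    define g where "g = (\<lambda>s\<in>carrier S. if s = t then \<zero>\<^bsub>K\<^esub> else f s)"
    have g: "g \<in> carrier alg" using insert.prems(2) by (auto simp: g_def alg_sel)
    have ft: "f t \<in> carrier K" using insert.prems by (auto simp: alg_app)
    have "g s = \<zero>\<^bsub>K\<^esub>" if "s \<in> carrier S" "s \<notin> T" for s
      using insert.prems(3)[of s] that by (auto simp: g_def)
    then have "P g" using insert.prems(1) g by (intro insert.IH) auto
    moreover have "f = (f t \<odot>\<^bsub>alg\<^esub> elt t) \<oplus>\<^bsub>alg\<^esub> g"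
      using insert.prems ft
      by (intro PiE_ext[of _ "carrier S" "\<lambda>_. carrier K"]) (auto simp: alg_sel g_def elt_def PiE_iff)
    ultimately show ?case
      using add[OF ft _ g, of t] insert.prems(1) ft by (simp add: scalar_mult)
  qed
  from this[OF finite_S subset_refl f] show ?thesis by simp
qed

end

section \<open>The simple modules of the free left regular band\<close>

lemma (in left_module) submodule_criterion:
  assumes "H \<subseteq> carrier M" "\<zero>\<^bsub>M\<^esub> \<in> H"
    and "\<And>x y. \<lbrakk>x \<in> H; y \<in> H\<rbrakk> \<Longrightarrow> x \<oplus>\<^bsub>M\<^esub> y \<in> H"
    and smult: "\<And>a x. \<lbrakk>a \<in> carrier R; x \<in> H\<rbrakk> \<Longrightarrow> a \<odot>\<^bsub>M\<^esub> x \<in> H"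
  shows "Module.submodule H R M"
proof -
  have "inv\<^bsub>add_monoid M\<^esub> x \<in> H" if "x \<in> H" for x
    using smult[of "\<ominus> \<one>" x] that assms(1) by (auto simp: smult_minus_one a_inv_def[symmetric])
  then show ?thesis
    using assms by (intro Module.submodule.intro subgroup.intro submodule_axioms.intro) auto
qed

locale free_lrb_algebra = K: field K
  for K :: "('k, 'x) ring_scheme" and A :: "'a set" +
  assumes finite_A: "finite A"
begin

abbreviation S :: "'a list monoid" where "S \<equiv> free_lrb A"

lemma free_lrb_sel:
  "w \<in> carrier S \<longleftrightarrow> distinct w \<and> set w \<subseteq> A"
  "u \<otimes>\<^bsub>S\<^esub> v = u @ filter (\<lambda>x. x \<notin> set u) v"
  "\<one>\<^bsub>S\<^esub> = []"
  by (simp_all add: free_lrb_def)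

lemma set_mult: "set (u \<otimes>\<^bsub>S\<^esub> v) = set u \<union> set v"
  by (auto simp: free_lrb_sel)

text \<open>Every letter of \<open>v\<close> is deleted from the product. Idempotence of words is
  the case \<open>v = u\<close>.\<close>

lemma mult_absorb: "set v \<subseteq> set u \<Longrightarrow> u \<otimes>\<^bsub>S\<^esub> v = u"
  by (auto simp: free_lrb_sel filter_empty_conv)

sublocale finite_monoid_algebra K S
proof (intro finite_monoid_algebra.intro finite_monoid_algebra_axioms.intro K.is_cring)
  show "monoid S"
    by (rule monoidI) (auto simp: free_lrb_sel intro!: filter_cong)
  have "carrier S \<subseteq> {w. set w \<subseteq> A \<and> length w \<le> card A}"
    by (auto simp: free_lrb_sel distinct_card[symmetric] intro!: card_mono finite_A)
  then show "finite (carrier S)"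
    using finite_lists_length_le[OF finite_A] finite_subset by blast
qed

section \<open>Characters of the algebra and twisted derivations\<close>

definition chi :: "'a set \<Rightarrow> 'a list \<Rightarrow> 'k" where
  "chi X w = (if set w \<subseteq> X then \<one>\<^bsub>K\<^esub> else \<zero>\<^bsub>K\<^esub>)"

abbreviation character :: "'a set \<Rightarrow> ('a list \<Rightarrow> 'k) \<Rightarrow> 'k" where
  "character X \<equiv> lin (chi X)"

lemma chi_closed [simp]: "chi X w \<in> carrier K"
  by (simp add: chi_def)

lemma chi_fun [simp, intro]: "chi X \<in> carrier S \<rightarrow> carrier K"
  by simp

lemma chi_mult: "chi X (u \<otimes>\<^bsub>S\<^esub> v) = chi X u \<otimes>\<^bsub>K\<^esub> chi X v"
  by (auto simp: chi_def set_mult)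

lemma chi_one: "chi X \<one>\<^bsub>S\<^esub> = \<one>\<^bsub>K\<^esub>"
  by (simp add: chi_def free_lrb_sel)

text \<open>Both sides are bilinear in \<open>f\<close> and \<open>g\<close>, so the rule passes
  from words to the algebra.\<close>

lemma lin_derivation:
  assumes d: "d \<in> carrier S \<rightarrow> carrier K"
    and der: "\<And>u v. \<lbrakk>u \<in> carrier S; v \<in> carrier S\<rbrakk> \<Longrightarrow>
      d (u \<otimes>\<^bsub>S\<^esub> v) = chi Y u \<otimes>\<^bsub>K\<^esub> d v \<oplus>\<^bsub>K\<^esub> chi X v \<otimes>\<^bsub>K\<^esub> d u"
    and f: "f \<in> carrier alg" and g: "g \<in> carrier alg"
  shows "lin d (f \<otimes>\<^bsub>alg\<^esub> g) = character Y f \<otimes>\<^bsub>K\<^esub> lin d g \<oplus>\<^bsub>K\<^esub> lin d f \<otimes>\<^bsub>K\<^esub> character X g"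
proof -
  have d': "d u \<in> carrier K" if "u \<in> carrier S" for u using d that by auto
  have "lin d (f \<otimes>\<^bsub>alg\<^esub> g) = lin (\<lambda>u. lin d g \<otimes>\<^bsub>K\<^esub> chi Y u \<oplus>\<^bsub>K\<^esub> character X g \<otimes>\<^bsub>K\<^esub> d u) f"
    unfolding lin_mult[OF d f g]
  proof (rule lin_cong[OF _ _ f])
    fix u assume u: "u \<in> carrier S"
    have "lin (\<lambda>v. d (u \<otimes>\<^bsub>S\<^esub> v)) g = lin (\<lambda>v. chi Y u \<otimes>\<^bsub>K\<^esub> d v \<oplus>\<^bsub>K\<^esub> d u \<otimes>\<^bsub>K\<^esub> chi X v) g"
      using u d' g by (intro lin_cong) (auto simp: der K.m_comm)
    also have "\<dots> = lin (\<lambda>v. chi Y u \<otimes>\<^bsub>K\<^esub> d v) g \<oplus>\<^bsub>K\<^esub> lin (\<lambda>v. d u \<otimes>\<^bsub>K\<^esub> chi X v) g"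
      using u d' g by (intro lin_add) auto
    also have "\<dots> = lin d g \<otimes>\<^bsub>K\<^esub> chi Y u \<oplus>\<^bsub>K\<^esub> character X g \<otimes>\<^bsub>K\<^esub> d u"
      using u d' g d by (simp add: lin_smult K.m_comm)
    finally show "lin (\<lambda>v. d (u \<otimes>\<^bsub>S\<^esub> v)) g = \<dots>" .
  qed (use d' g d in auto)
  also have "\<dots> = lin (\<lambda>u. lin d g \<otimes>\<^bsub>K\<^esub> chi Y u) f \<oplus>\<^bsub>K\<^esub> lin (\<lambda>u. character X g \<otimes>\<^bsub>K\<^esub> d u) f"
    using d' f g d by (intro lin_add) auto
  also have "\<dots> = character Y f \<otimes>\<^bsub>K\<^esub> lin d g \<oplus>\<^bsub>K\<^esub> lin d f \<otimes>\<^bsub>K\<^esub> character X g"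
    using f g d by (simp add: lin_smult) (simp add: K.m_comm)
  finally show ?thesis .
qed

lemma character_mult:
  assumes f: "f \<in> carrier alg" and g: "g \<in> carrier alg"
  shows "character X (f \<otimes>\<^bsub>alg\<^esub> g) = character X f \<otimes>\<^bsub>K\<^esub> character X g"
proof -
  have "character X (f \<otimes>\<^bsub>alg\<^esub> g) = lin (\<lambda>u. lin (\<lambda>v. chi X u \<otimes>\<^bsub>K\<^esub> chi X v) g) f"
    unfolding lin_mult[OF chi_fun f g] chi_mult ..
  also have "\<dots> = lin (\<lambda>u. character X g \<otimes>\<^bsub>K\<^esub> chi X u) f"
    using f g by (intro lin_cong) (auto simp: lin_smult K.m_comm)
  also have "\<dots> = character X f \<otimes>\<^bsub>K\<^esub> character X g"
    using f g by (subst lin_smult) (auto simp: K.m_comm)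
  finally show ?thesis .
qed

lemma character_scalar: "c \<in> carrier K \<Longrightarrow> character X (scalar c) = c"
  by (simp add: lin_scalar chi_one)

section \<open>The one-dimensional modules\<close>

abbreviation simp_mod :: "'a set \<Rightarrow> ('a list \<Rightarrow> 'k, 'k) module" where
  "simp_mod X \<equiv> lrb_simple K A X"

lemma lrb_simple_sel:
  "carrier (simp_mod X) = carrier K" "\<zero>\<^bsub>simp_mod X\<^esub> = \<zero>\<^bsub>K\<^esub>"
  "x \<oplus>\<^bsub>simp_mod X\<^esub> y = x \<oplus>\<^bsub>K\<^esub> y"
  by (simp_all add: lrb_simple_def)

lemma lrb_simple_smult:
  assumes f: "f \<in> carrier alg" and c: "c \<in> carrier K"
  shows "f \<odot>\<^bsub>simp_mod X\<^esub> c = character X f \<otimes>\<^bsub>K\<^esub> c"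
proof -
  have "f \<odot>\<^bsub>simp_mod X\<^esub> c = (\<Oplus>\<^bsub>K\<^esub>s\<in>carrier S. f s \<otimes>\<^bsub>K\<^esub> chi X s \<otimes>\<^bsub>K\<^esub> c)"
    unfolding lrb_simple_def chi_def[symmetric] using f c finite_S
    by (auto simp: alg_app K.m_assoc intro!: K.add.finprod_mono_neutral_cong_left)
  also have "\<dots> = character X f \<otimes>\<^bsub>K\<^esub> c"
    unfolding lin_def using f c finite_S by (intro K.finsum_ldistr[symmetric]) (auto simp: alg_app)
  finally show ?thesis .
qed

lemma left_module_lrb_simple: "left_module alg (simp_mod X)"
proof (intro left_module.intro left_module_axioms.intro ring_alg)
  show "abelian_group (simp_mod X)"
  proof (rule abelian_groupI)
    fix x assume "x \<in> carrier (simp_mod X)"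
    then show "\<exists>y\<in>carrier (simp_mod X). y \<oplus>\<^bsub>simp_mod X\<^esub> x = \<zero>\<^bsub>simp_mod X\<^esub>"
      by (auto simp: lrb_simple_sel K.l_neg intro!: bexI[of _ "\<ominus>\<^bsub>K\<^esub> x"])
  qed (auto simp: lrb_simple_sel K.a_ac)
qed (auto simp: lrb_simple_sel lrb_simple_smult lin_add_alg character_mult K.l_distr K.r_distr
    K.m_assoc alg_sel(3) lin_elt chi_one)

lemma restrict_scalars_lrb_simple_smult:
  "\<lbrakk>c \<in> carrier K; x \<in> carrier K\<rbrakk> \<Longrightarrow> c \<odot>\<^bsub>restrict_scalars alg (simp_mod X)\<^esub> x = c \<otimes>\<^bsub>K\<^esub> x"
  by (simp add: restrict_scalars_def scalar_def[symmetric] lrb_simple_smult character_scalar)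

lemma has_dim_lrb_simple: "has_dim K (restrict_scalars alg (simp_mod X)) 1"
proof -
  have sel: "carrier (restrict_scalars alg (simp_mod X)) = carrier K"
    "\<zero>\<^bsub>restrict_scalars alg (simp_mod X)\<^esub> = \<zero>\<^bsub>K\<^esub>"
    "x \<oplus>\<^bsub>restrict_scalars alg (simp_mod X)\<^esub> y = x \<oplus>\<^bsub>K\<^esub> y" for x y
    by (simp_all add: restrict_scalars_def lrb_simple_sel)
  have "vectorspace K (restrict_scalars alg (simp_mod X))"
  proof (rule vs_criteria)
    show "\<forall>v\<in>carrier (restrict_scalars alg (simp_mod X)).
       \<exists>neg_v\<in>carrier (restrict_scalars alg (simp_mod X)).
          v \<oplus>\<^bsub>restrict_scalars alg (simp_mod X)\<^esub> neg_v = \<zero>\<^bsub>restrict_scalars alg (simp_mod X)\<^esub>"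
      using K.r_neg K.a_inv_closed by (auto simp: sel)
  qed (auto simp: sel restrict_scalars_lrb_simple_smult K.a_ac K.m_assoc K.l_distr K.r_distr K.field_axioms)
  then have "has_dim K (restrict_scalars alg (simp_mod X)) (card {()})"
    by (rule has_dim_dual_family[where q = "\<lambda>_. \<one>\<^bsub>K\<^esub>" and mu = "\<lambda>_ x. x"])
      (auto simp: sel restrict_scalars_lrb_simple_smult)
  then show ?thesis by simp
qed

lemma simple_lrb_simple: "simple_left_module alg (simp_mod X)"
  unfolding simple_left_module_def
proof (intro conjI allI impI left_module_lrb_simple)
  show "carrier (simp_mod X) \<noteq> {\<zero>\<^bsub>simp_mod X\<^esub>}"
    unfolding lrb_simple_sel using K.one_closed K.one_not_zero by blast
  fix H assume "Module.submodule H alg (simp_mod X)"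
  then interpret H: Module.submodule H alg "simp_mod X" .
  have HK: "H \<subseteq> carrier K" using H.subset by (simp add: lrb_simple_sel)
  show "H = {\<zero>\<^bsub>simp_mod X\<^esub>} \<or> H = carrier (simp_mod X)"
  proof (cases "H \<subseteq> {\<zero>\<^bsub>K\<^esub>}")
    case True
    then show ?thesis using H.one_closed by (auto simp: lrb_simple_sel)
  next
    case False
    then obtain x where x: "x \<in> H" "x \<in> carrier K" "x \<noteq> \<zero>\<^bsub>K\<^esub>" using HK by auto
    have "y \<in> H" if y: "y \<in> carrier K" for y
    proof -
      \<comment> \<open>The scalar \<open>y / x\<close> carries the nonzero element \<open>x\<close>
        to \<open>y\<close>.\<close>
      have c: "y \<otimes>\<^bsub>K\<^esub> inv\<^bsub>K\<^esub> x \<in> carrier K" using x y by simp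
      have "scalar (y \<otimes>\<^bsub>K\<^esub> inv\<^bsub>K\<^esub> x) \<odot>\<^bsub>simp_mod X\<^esub> x = y \<otimes>\<^bsub>K\<^esub> (inv\<^bsub>K\<^esub> x \<otimes>\<^bsub>K\<^esub> x)"
        using x y c by (simp add: lrb_simple_smult character_scalar K.m_assoc)
      also have "\<dots> = y" using x y K.field_Units by (simp add: K.Units_l_inv)
      finally show ?thesis using H.smult_closed[OF alg_closed(5)[OF c] x(1)] by simp
    qed
    then show ?thesis using HK by (auto simp: lrb_simple_sel)
  qed
qed

text \<open>The word \<open>[a]\<close> acts by 1 or by 0 according to whether \<open>a\<close>
  belongs to the indexing set. Comparing \<open>h (chi X [a])\<close> with \<open>chi Y [a]\<close>
  times the nonzero value \<open>h 1\<close> shows that the two sets contain the same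
  letters.\<close>

lemma lrb_simple_iso_imp_eq:
  assumes X: "X \<subseteq> A" and Y: "Y \<subseteq> A" and iso: "left_module_iso alg (simp_mod X) (simp_mod Y)"
  shows "X = Y"
proof -
  obtain h where h: "h \<in> left_module_hom alg (simp_mod X) (simp_mod Y)"
    and bij: "bij_betw h (carrier K) (carrier K)"
    using iso by (auto simp: left_module_iso_def lrb_simple_sel)
  have h1: "h \<one>\<^bsub>K\<^esub> \<in> carrier K" using bij by (auto simp: bij_betw_def)
  have h0: "h \<zero>\<^bsub>K\<^esub> = \<zero>\<^bsub>K\<^esub>"
    using left_module_hom_zero[OF left_module_lrb_simple left_module_lrb_simple h]
    by (simp add: lrb_simple_sel)
  have h10: "h \<one>\<^bsub>K\<^esub> \<noteq> \<zero>\<^bsub>K\<^esub>"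
    using bij h0 inj_onD[of h "carrier K" "\<one>\<^bsub>K\<^esub>" "\<zero>\<^bsub>K\<^esub>"] by (auto simp: bij_betw_def)
  have "a \<in> X \<longleftrightarrow> a \<in> Y" if a: "a \<in> A" for a
  proof -
    have w: "[a] \<in> carrier S" using a by (simp add: free_lrb_sel)
    have "h (chi X [a]) = chi Y [a] \<otimes>\<^bsub>K\<^esub> h \<one>\<^bsub>K\<^esub>"
      using left_module_homD(3)[OF h alg_closed(2)[of "[a]"], of "\<one>\<^bsub>K\<^esub>"] h1 w
      by (simp add: lrb_simple_sel lrb_simple_smult lin_elt)
    then show ?thesis using h0 h1 h10 by (auto simp: chi_def split: if_splits)
  qed
  then show ?thesis using X Y by auto
qed

text \<open>A word of maximal length among those that do not annihilate the module has as its
  kernel a submodule, so it acts injectively and, being idempotent, as the identity.\<close>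

lemma simple_module_character:
  fixes V :: "('a list \<Rightarrow> 'k, 'v) module"
  assumes simple: "simple_left_module alg V"
  obtains X where "X \<subseteq> A" and
    "\<And>f v. \<lbrakk>f \<in> carrier alg; v \<in> carrier V\<rbrakk> \<Longrightarrow> f \<odot>\<^bsub>V\<^esub> v = scalar (character X f) \<odot>\<^bsub>V\<^esub> v"
proof -
  interpret V: left_module alg V using simple by (simp add: simple_left_module_def)
  define T where "T = {w \<in> carrier S. \<exists>v\<in>carrier V. elt w \<odot>\<^bsub>V\<^esub> v \<noteq> \<zero>\<^bsub>V\<^esub>}"
  have "carrier V \<noteq> {\<zero>\<^bsub>V\<^esub>}" using simple by (simp add: simple_left_module_def)
  then obtain v where "v \<in> carrier V" "v \<noteq> \<zero>\<^bsub>V\<^esub>" using V.M.zero_closed by blast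
  \<comment> \<open>The identity acts trivially on a nonzero module, so there is a word from which a
    longest one can be chosen.\<close>
  then have "\<one>\<^bsub>S\<^esub> \<in> T" using V.smult_one by (auto simp: T_def alg_sel(3))
  then have T: "finite T" "T \<noteq> {}" using finite_S by (auto simp: T_def)
  then have "Max (length ` T) \<in> length ` T" by (intro Max_in) auto
  then obtain w where "w \<in> T" and len: "length w = Max (length ` T)" by auto
  then have w: "w \<in> carrier S" by (simp add: T_def)
  have max: "length u \<le> length w" if "u \<in> T" for u
    using that T len by simp
  define H where "H = {v \<in> carrier V. elt w \<odot>\<^bsub>V\<^esub> v = \<zero>\<^bsub>V\<^esub>}"
  \<comment> \<open>If \<open>w\<close> already contains the letters of \<open>s\<close>, it absorbs
    \<open>s\<close>. Otherwise the product is strictly longer than \<open>w\<close> and annihilates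
    \<open>V\<close> by maximality.\<close>
  have elt_w: "elt w \<odot>\<^bsub>V\<^esub> (elt s \<odot>\<^bsub>V\<^esub> v) = (if set s \<subseteq> set w then elt w \<odot>\<^bsub>V\<^esub> v else \<zero>\<^bsub>V\<^esub>)"
    if s: "s \<in> carrier S" and v: "v \<in> carrier V" for s v
  proof -
    have eq: "elt w \<odot>\<^bsub>V\<^esub> (elt s \<odot>\<^bsub>V\<^esub> v) = elt (w \<otimes>\<^bsub>S\<^esub> s) \<odot>\<^bsub>V\<^esub> v"
      using w s v by (simp add: V.smult_assoc1[symmetric] elt_mult)
    show ?thesis
    proof (cases "set s \<subseteq> set w")
      case True
      then show ?thesis using eq by (simp add: mult_absorb)
    next
      case False
      then have "filter (\<lambda>x. x \<notin> set w) s \<noteq> []" by (auto simp: filter_empty_conv)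
      then have "length w < length (w \<otimes>\<^bsub>S\<^esub> s)" by (simp add: free_lrb_sel)
      then have "w \<otimes>\<^bsub>S\<^esub> s \<notin> T" using max leD by blast
      then show ?thesis using False eq v w s by (auto simp: T_def)
    qed
  qed
  \<comment> \<open>Scalars are central, so stability of \<open>H\<close> may be checked one word at
    a time.\<close>
  have scalar_elt: "scalar c \<otimes>\<^bsub>alg\<^esub> elt w = elt w \<otimes>\<^bsub>alg\<^esub> scalar c" if "c \<in> carrier K" for c
    using that by (simp add: scalar_mult)
  have "Module.submodule H alg V"
  proof (rule V.submodule_criterion)
    fix f x assume f: "f \<in> carrier alg" and x: "x \<in> H"
    have xV: "x \<in> carrier V" and wx: "elt w \<odot>\<^bsub>V\<^esub> x = \<zero>\<^bsub>V\<^esub>" using x by (auto simp: H_def)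
    from f have "elt w \<odot>\<^bsub>V\<^esub> (f \<odot>\<^bsub>V\<^esub> x) = \<zero>\<^bsub>V\<^esub>"
    proof (induction rule: alg_induct)
      case zero then show ?case using xV by simp
    next
      case (add c s g)
      have "elt w \<odot>\<^bsub>V\<^esub> ((scalar c \<otimes>\<^bsub>alg\<^esub> elt s) \<odot>\<^bsub>V\<^esub> x) = (elt w \<otimes>\<^bsub>alg\<^esub> (scalar c \<otimes>\<^bsub>alg\<^esub> elt s)) \<odot>\<^bsub>V\<^esub> x"
        using add.hyps xV by (intro V.smult_assoc1[symmetric]) auto
      also have "elt w \<otimes>\<^bsub>alg\<^esub> (scalar c \<otimes>\<^bsub>alg\<^esub> elt s) = scalar c \<otimes>\<^bsub>alg\<^esub> (elt w \<otimes>\<^bsub>alg\<^esub> elt s)"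
        using add.hyps by (simp add: alg.m_assoc[symmetric] scalar_elt)
      also have "\<dots> \<odot>\<^bsub>V\<^esub> x = scalar c \<odot>\<^bsub>V\<^esub> (elt w \<odot>\<^bsub>V\<^esub> (elt s \<odot>\<^bsub>V\<^esub> x))"
        using add.hyps xV by (simp add: V.smult_assoc1)
      also have "\<dots> = \<zero>\<^bsub>V\<^esub>" using elt_w[OF add.hyps(2) xV] wx add.hyps by simp
      finally show ?case using add xV by (simp add: V.smult_l_distr V.smult_r_distr V.smult_closed)
    qed
    then show "f \<odot>\<^bsub>V\<^esub> x \<in> H" using f xV by (simp add: H_def V.smult_closed)
  qed (auto simp: H_def V.smult_r_distr)
  moreover have "H \<noteq> carrier V" using \<open>w \<in> T\<close> by (auto simp: H_def T_def)
  ultimately have H0: "H = {\<zero>\<^bsub>V\<^esub>}" using simple by (auto simp: simple_left_module_def)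
  have w_id: "elt w \<odot>\<^bsub>V\<^esub> v = v" if v: "v \<in> carrier V" for v
  proof -
    \<comment> \<open>Applying \<open>w\<close> once more to \<open>w v - v\<close> gives zero,
      since \<open>w\<close> absorbs itself.\<close>
    have "elt w \<odot>\<^bsub>V\<^esub> v \<oplus>\<^bsub>V\<^esub> (\<ominus>\<^bsub>alg\<^esub> \<one>\<^bsub>alg\<^esub>) \<odot>\<^bsub>V\<^esub> v \<in> H"
    proof -
      have "elt w \<odot>\<^bsub>V\<^esub> ((\<ominus>\<^bsub>alg\<^esub> \<one>\<^bsub>alg\<^esub>) \<odot>\<^bsub>V\<^esub> v) = \<ominus>\<^bsub>V\<^esub> (elt w \<odot>\<^bsub>V\<^esub> v)"
      proof -
        have "elt w \<odot>\<^bsub>V\<^esub> ((\<ominus>\<^bsub>alg\<^esub> \<one>\<^bsub>alg\<^esub>) \<odot>\<^bsub>V\<^esub> v) = (elt w \<otimes>\<^bsub>alg\<^esub> (\<ominus>\<^bsub>alg\<^esub> \<one>\<^bsub>alg\<^esub>)) \<odot>\<^bsub>V\<^esub> v"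
          using v by (simp add: V.smult_assoc1)
        also have "elt w \<otimes>\<^bsub>alg\<^esub> (\<ominus>\<^bsub>alg\<^esub> \<one>\<^bsub>alg\<^esub>) = (\<ominus>\<^bsub>alg\<^esub> \<one>\<^bsub>alg\<^esub>) \<otimes>\<^bsub>alg\<^esub> elt w"
          by (simp add: alg.l_minus alg.r_minus)
        also have "\<dots> \<odot>\<^bsub>V\<^esub> v = \<ominus>\<^bsub>V\<^esub> (elt w \<odot>\<^bsub>V\<^esub> v)"
          using v by (simp add: V.smult_assoc1 V.smult_minus_one V.smult_closed)
        finally show ?thesis .
      qed
      then show ?thesis
        using v elt_w[OF w v] by (simp add: H_def V.smult_closed V.smult_r_distr V.M.r_neg)
    qed
    then show ?thesis
      using H0 v V.smult_closed[of "elt w" v] V.M.minus_other_side[of "elt w \<odot>\<^bsub>V\<^esub> v" v]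
      by (simp add: V.smult_minus_one a_minus_def)
  qed
  have elt_act: "elt s \<odot>\<^bsub>V\<^esub> v = (if set s \<subseteq> set w then v else \<zero>\<^bsub>V\<^esub>)"
    if "s \<in> carrier S" "v \<in> carrier V" for s v
    using elt_w[OF that] w_id that by (simp add: V.smult_closed)
  show ?thesis
  proof (rule that)
    show "set w \<subseteq> A" using w by (simp add: free_lrb_sel)
    fix f v assume "f \<in> carrier alg" and v: "v \<in> carrier V"
    then show "f \<odot>\<^bsub>V\<^esub> v = scalar (character (set w) f) \<odot>\<^bsub>V\<^esub> v"
    proof (induction rule: alg_induct)
      case zero
      have "lin (chi (set w)) \<zero>\<^bsub>alg\<^esub> = \<zero>\<^bsub>K\<^esub>"
        by (rule additive_zero[OF alg.abelian_group_axioms K.abelian_group_axioms]) (auto simp: lin_add_alg)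
      moreover have "scalar \<zero>\<^bsub>K\<^esub> = \<zero>\<^bsub>alg\<^esub>"
        by (rule additive_zero[OF K.abelian_group_axioms alg.abelian_group_axioms])
          (auto simp: scalar_ring_hom)
      ultimately show ?case using v by simp
    next
      case (add c s g)
      let ?Z = "set w"
      have "character ?Z (scalar c \<otimes>\<^bsub>alg\<^esub> elt s \<oplus>\<^bsub>alg\<^esub> g) = c \<otimes>\<^bsub>K\<^esub> chi ?Z s \<oplus>\<^bsub>K\<^esub> character ?Z g"
        using add.hyps by (simp add: lin_add_alg character_mult character_scalar lin_elt)
      moreover have "scalar (c \<otimes>\<^bsub>K\<^esub> chi ?Z s) \<odot>\<^bsub>V\<^esub> v = (scalar c \<otimes>\<^bsub>alg\<^esub> elt s) \<odot>\<^bsub>V\<^esub> v"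
      proof -
        have "scalar (chi ?Z s) \<odot>\<^bsub>V\<^esub> v = elt s \<odot>\<^bsub>V\<^esub> v"
          using elt_act[OF add.hyps(2) v] v additive_zero[OF K.abelian_group_axioms alg.abelian_group_axioms, of scalar]
          by (auto simp: chi_def scalar_ring_hom V.smult_one)
        then show ?thesis using add.hyps v by (simp add: scalar_ring_hom V.smult_assoc1)
      qed
      ultimately show ?case
        using add v by (simp add: V.smult_l_distr scalar_ring_hom)
    qed
  qed
qed

text \<open>Once the algebra acts through a character, every line over the field is a submodule. By
  simplicity \<open>V\<close> is the line through any nonzero \<open>v\<close>, and \<open>h\<close>
  is its coordinate map read backwards.\<close>

lemma simple_module_iso_lrb_simple:
  fixes V :: "('a list \<Rightarrow> 'k, 'v) module"
  assumes simple: "simple_left_module alg V"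
  shows "\<exists>X\<in>Pow A. left_module_iso alg V (simp_mod X)"
proof -
  interpret V: left_module alg V using simple by (simp add: simple_left_module_def)
  obtain X where X: "X \<subseteq> A"
    and act: "\<And>f v. \<lbrakk>f \<in> carrier alg; v \<in> carrier V\<rbrakk> \<Longrightarrow> f \<odot>\<^bsub>V\<^esub> v = scalar (character X f) \<odot>\<^bsub>V\<^esub> v"
    using simple_module_character[OF simple] by blast
  have "carrier V \<noteq> {\<zero>\<^bsub>V\<^esub>}" using simple by (simp add: simple_left_module_def)
  then obtain v where v: "v \<in> carrier V" "v \<noteq> \<zero>\<^bsub>V\<^esub>" using V.M.zero_closed by blast
  define h where "h c = scalar c \<odot>\<^bsub>V\<^esub> v" for c
  have h_add: "h (c \<oplus>\<^bsub>K\<^esub> d) = h c \<oplus>\<^bsub>V\<^esub> h d" if "c \<in> carrier K" "d \<in> carrier K" for c d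
    using that v by (simp add: h_def scalar_ring_hom V.smult_l_distr)
  have h_cl: "h c \<in> carrier V" if "c \<in> carrier K" for c
    using that v by (simp add: h_def V.smult_closed)
  have h_act: "h (character X f \<otimes>\<^bsub>K\<^esub> c) = f \<odot>\<^bsub>V\<^esub> h c" if "f \<in> carrier alg" "c \<in> carrier K" for f c
    using that v act[OF that(1) h_cl[OF that(2)]] by (simp add: h_def scalar_ring_hom V.smult_assoc1)
  have h0: "h \<zero>\<^bsub>K\<^esub> = \<zero>\<^bsub>V\<^esub>"
    using h_cl h_add by (intro additive_zero[OF K.abelian_group_axioms V.M.abelian_group_axioms]) auto
  have h_ker: "c = \<zero>\<^bsub>K\<^esub>" if c: "c \<in> carrier K" "h c = \<zero>\<^bsub>V\<^esub>" for c
  proof (rule ccontr)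
    assume "c \<noteq> \<zero>\<^bsub>K\<^esub>"
    then have u: "c \<in> Units K" using c K.field_Units by simp
    have "v = h \<one>\<^bsub>K\<^esub>" using v by (simp add: h_def scalar_ring_hom V.smult_one)
    also have "\<dots> = h (character X (scalar (inv\<^bsub>K\<^esub> c)) \<otimes>\<^bsub>K\<^esub> c)"
      using u c by (simp add: character_scalar K.Units_l_inv)
    also have "\<dots> = scalar (inv\<^bsub>K\<^esub> c) \<odot>\<^bsub>V\<^esub> h c" using u c by (intro h_act) auto
    also have "\<dots> = \<zero>\<^bsub>V\<^esub>" using u c by simp
    finally show False using v by simp
  qed
  have "inj_on h (carrier K)"
  proof (rule inj_onI)
    fix c d assume cd: "c \<in> carrier K" "d \<in> carrier K" "h c = h d"
    have "h (c \<ominus>\<^bsub>K\<^esub> d) \<oplus>\<^bsub>V\<^esub> h d = h c"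
      using cd h_add[of "c \<ominus>\<^bsub>K\<^esub> d" d] by (simp add: K.minus_eq K.a_assoc K.l_neg)
    then have "h (c \<ominus>\<^bsub>K\<^esub> d) = \<zero>\<^bsub>V\<^esub>"
      using cd h_cl by (simp add: V.M.add.r_cancel_one)
    then show "c = d" using h_ker[of "c \<ominus>\<^bsub>K\<^esub> d"] cd by simp
  qed
  moreover have "h ` carrier K = carrier V"
  proof -
    have "Module.submodule (h ` carrier K) alg V"
    proof (rule V.submodule_criterion)
      show "\<zero>\<^bsub>V\<^esub> \<in> h ` carrier K" using h0 by (intro image_eqI[of _ _ "\<zero>\<^bsub>K\<^esub>"]) simp_all
    qed (use h_cl in \<open>auto simp flip: h_add h_act intro!: imageI\<close>)
    moreover have "v \<in> h ` carrier K"
      using v by (intro image_eqI[of _ _ "\<one>\<^bsub>K\<^esub>"]) (simp_all add: h_def scalar_ring_hom V.smult_one)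
    ultimately show ?thesis using simple v by (auto simp: simple_left_module_def)
  qed
  ultimately have bij: "bij_betw h (carrier K) (carrier V)" by (simp add: bij_betw_def)
  \<comment> \<open>The isomorphism is the inverse of \<open>h\<close>, restricted because
    homomorphisms are required to be extensional.\<close>
  define k where "k = restrict (inv_into (carrier K) h) (carrier V)"
  have k_cl: "k x \<in> carrier K" and hk: "h (k x) = x" if "x \<in> carrier V" for x
    using that bij by (auto simp: k_def bij_betw_def f_inv_into_f intro: inv_into_into)
  have kI: "k x = c" if "h c = x" "c \<in> carrier K" for c x
    using that bij h_cl by (auto simp: k_def bij_betw_def)
  have "k \<in> left_module_hom alg V (simp_mod X)"
  proof (rule left_module_homI)
    fix x y assume "x \<in> carrier V" "y \<in> carrier V"
    then show "k (x \<oplus>\<^bsub>V\<^esub> y) = k x \<oplus>\<^bsub>simp_mod X\<^esub> k y"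
      by (intro kI) (simp_all add: lrb_simple_sel h_add k_cl hk)
  next
    fix f x assume "f \<in> carrier alg" "x \<in> carrier V"
    then show "k (f \<odot>\<^bsub>V\<^esub> x) = f \<odot>\<^bsub>simp_mod X\<^esub> k x"
      by (intro kI) (simp_all add: lrb_simple_smult h_act k_cl hk)
  qed (simp_all add: lrb_simple_sel k_cl, simp add: k_def)
  moreover have "bij_betw k (carrier V) (carrier (simp_mod X))"
    unfolding lrb_simple_sel k_def using bij_betw_inv_into[OF bij]
    by (simp cong: bij_betw_cong)
  ultimately show ?thesis using X by (auto simp: left_module_iso_def)
qed

end

section \<open>Derivations and extensions\<close>

context free_lrb_algebra
begin

text \<open>In an extension with submodule \<open>simp_mod Y\<close> and quotient
  \<open>simp_mod X\<close>, a word acts by a triangular matrix with diagonal \<open>chi Y\<close>,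
  \<open>chi X\<close>, and \<open>d\<close> is the corner entry: the equation says that these
  matrices multiply as the words do. The values of \<open>d\<close> off the words are left
  free.\<close>

definition derivation :: "'a set \<Rightarrow> 'a set \<Rightarrow> ('a list \<Rightarrow> 'k) \<Rightarrow> bool" where
  "derivation X Y d \<longleftrightarrow> d \<in> carrier S \<rightarrow> carrier K \<and>
     (\<forall>u\<in>carrier S. \<forall>v\<in>carrier S.
       d (u \<otimes>\<^bsub>S\<^esub> v) = chi Y u \<otimes>\<^bsub>K\<^esub> d v \<oplus>\<^bsub>K\<^esub> chi X v \<otimes>\<^bsub>K\<^esub> d u)"

lemma derivationD:
  assumes "derivation X Y d"
  shows "u \<in> carrier S \<Longrightarrow> d u \<in> carrier K"
    and "\<lbrakk>u \<in> carrier S; v \<in> carrier S\<rbrakk> \<Longrightarrow>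
      d (u \<otimes>\<^bsub>S\<^esub> v) = chi Y u \<otimes>\<^bsub>K\<^esub> d v \<oplus>\<^bsub>K\<^esub> chi X v \<otimes>\<^bsub>K\<^esub> d u"
  using assms by (auto simp: derivation_def)

section \<open>Values of a derivation on letters\<close>

lemma derivation_Nil:
  assumes d: "derivation X Y d"
  shows "d [] = \<zero>\<^bsub>K\<^esub>"
proof -
  have nil: "[] \<in> carrier S" "[] \<otimes>\<^bsub>S\<^esub> [] = []" by (simp_all add: free_lrb_sel)
  then have "d [] = d [] \<oplus>\<^bsub>K\<^esub> d []"
    using derivationD(2)[OF d nil(1,1)] derivationD(1)[OF d nil(1)] by (simp add: chi_def)
  then show ?thesis using derivationD(1)[OF d nil(1)] by simp
qed

lemma derivation_singleton_eq_zero: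
  assumes d: "derivation X Y d" and a: "a \<in> A" and eq: "a \<in> X \<longleftrightarrow> a \<in> Y"
  shows "d [a] = \<zero>\<^bsub>K\<^esub>"
proof -
  have w: "[a] \<in> carrier S" "[a] \<otimes>\<^bsub>S\<^esub> [a] = [a]" using a by (simp_all add: free_lrb_sel)
  \<comment> \<open>Idempotence reads \<open>d [a] = d [a] + d [a]\<close> for a letter in both sets
    and \<open>d [a] = 0\<close> for a letter in neither.\<close>
  show ?thesis
    using derivationD(2)[OF d w(1,1)] derivationD(1)[OF d w(1)] w(2) eq
    by (cases "a \<in> X") (simp_all add: chi_def)
qed

text \<open>The equations below say that the derivation is the inner one given by \<open>c\<close>, with the
  subtraction moved to the other side.\<close>

lemma derivation_inner_words:
  assumes d: "derivation X Y d" and c: "c \<in> carrier K"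
    and letters: "\<And>a. a \<in> A \<Longrightarrow> d [a] \<oplus>\<^bsub>K\<^esub> c \<otimes>\<^bsub>K\<^esub> chi X [a] = c \<otimes>\<^bsub>K\<^esub> chi Y [a]"
    and w: "w \<in> carrier S"
  shows "d w \<oplus>\<^bsub>K\<^esub> c \<otimes>\<^bsub>K\<^esub> chi X w = c \<otimes>\<^bsub>K\<^esub> chi Y w"
  using w
proof (induction w)
  case Nil
  then show ?case using c by (simp add: derivation_Nil[OF d] chi_def)
next
  case (Cons a w)
  \<comment> \<open>Since the letters are distinct, nothing is deleted and the word is the product
    of its first letter with the rest.\<close>
  have "filter (\<lambda>x. x \<noteq> a) w = w" using Cons.prems by (auto simp: free_lrb_sel filter_id_conv)
  then have a: "a \<in> A" "[a] \<in> carrier S" and w: "w \<in> carrier S" and aw: "a # w = [a] \<otimes>\<^bsub>S\<^esub> w"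
    using Cons.prems by (auto simp: free_lrb_sel)
  note cl = derivationD(1)[OF d a(2)] derivationD(1)[OF d w] c
  have "d (a # w) \<oplus>\<^bsub>K\<^esub> c \<otimes>\<^bsub>K\<^esub> chi X (a # w) =
      chi Y [a] \<otimes>\<^bsub>K\<^esub> d w \<oplus>\<^bsub>K\<^esub> chi X w \<otimes>\<^bsub>K\<^esub> (d [a] \<oplus>\<^bsub>K\<^esub> c \<otimes>\<^bsub>K\<^esub> chi X [a])"
    unfolding aw derivationD(2)[OF d a(2) w] chi_mult using cl
    by (simp add: K.r_distr K.a_assoc K.m_ac)
  also have "\<dots> = chi Y [a] \<otimes>\<^bsub>K\<^esub> (d w \<oplus>\<^bsub>K\<^esub> c \<otimes>\<^bsub>K\<^esub> chi X w)"
    unfolding letters[OF a(1)] using cl by (simp add: K.r_distr K.m_ac)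
  also have "\<dots> = c \<otimes>\<^bsub>K\<^esub> chi Y (a # w)"
    unfolding Cons.IH[OF w] aw chi_mult using cl by (simp add: K.m_ac)
  finally show ?case .
qed

text \<open>The difference of \<open>chi Y\<close> and \<open>chi X\<close> is 1 at
  \<open>a0\<close>, so the inner constant can only be \<open>d [a0]\<close>. The products of
  \<open>[a0, b]\<close> with its own letters then determine the value at \<open>b\<close>.\<close>

lemma derivation_inner_if_not_subset:
  assumes d: "derivation X Y d" and Y: "Y \<subseteq> A" and a0: "a0 \<in> Y" "a0 \<notin> X" and b: "b \<in> A"
  shows "d [b] \<oplus>\<^bsub>K\<^esub> d [a0] \<otimes>\<^bsub>K\<^esub> chi X [b] = d [a0] \<otimes>\<^bsub>K\<^esub> chi Y [b]"
proof (cases "b = a0 \<or> (b \<in> X \<longleftrightarrow> b \<in> Y)")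
  case True
  have "[a0] \<in> carrier S" using a0 Y by (auto simp: free_lrb_sel)
  note cl = derivationD(1)[OF d this]
  show ?thesis
    using True cl a0 derivation_singleton_eq_zero[OF d b] by (auto simp: chi_def)
next
  case False
  have w: "[a0] \<in> carrier S" "[b] \<in> carrier S" "[a0, b] \<in> carrier S"
    and prod: "[a0] \<otimes>\<^bsub>S\<^esub> [b] = [a0, b]"
    and absorb: "[a0, b] \<otimes>\<^bsub>S\<^esub> [a0] = [a0, b]" "[a0, b] \<otimes>\<^bsub>S\<^esub> [b] = [a0, b]"
    using a0 Y b False by (auto simp: free_lrb_sel)
  note cl = derivationD(1)[OF d w(1)] derivationD(1)[OF d w(2)] derivationD(1)[OF d w(3)]
  note eqs = derivationD(2)[OF d w(1,2)] derivationD(2)[OF d w(3,1)] derivationD(2)[OF d w(3,2)]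
  show ?thesis
  proof (cases "b \<in> Y")
    case True
    \<comment> \<open>Absorbing \<open>[a0]\<close> gives \<open>d [a0, b] = d [a0]\<close>, and
      absorbing \<open>[b]\<close> gives \<open>d [a0, b] = d [b]\<close>.\<close>
    then have "b \<notin> X" using False by auto
    then show ?thesis using eqs(2,3) absorb cl a0 True by (simp add: chi_def)
  next
    case False2: False
    \<comment> \<open>The product rule gives \<open>d [a0, b] = d [b] + d [a0]\<close>, while
      absorbing \<open>[a0]\<close> gives \<open>d [a0, b] = 0\<close>.\<close>
    then have "b \<in> X" using False by auto
    then show ?thesis using eqs(1,2) prod absorb cl a0 False2 by (simp add: chi_def)
  qed
qed

text \<open>For \<open>j\<close> in \<open>X - Y\<close> it is 1 at \<open>[j]\<close> and 0 at the
  other letters. The restriction to words inside \<open>X\<close> matches the rule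
  \<open>d(uv) = chi X v * d u\<close>, valid for a word \<open>u\<close> that leaves
  \<open>Y\<close>.\<close>

definition first_letter :: "'a set \<Rightarrow> 'a set \<Rightarrow> 'a \<Rightarrow> 'a list \<Rightarrow> 'k" where
  "first_letter X Y j w =
    (if set w \<subseteq> X \<and> List.find (\<lambda>x. x \<notin> Y) w = Some j then \<one>\<^bsub>K\<^esub> else \<zero>\<^bsub>K\<^esub>)"

text \<open>If \<open>u\<close> lies inside \<open>Y\<close>, only letters of \<open>Y\<close> are
  deleted from \<open>v\<close>, so the first letter of the product outside \<open>Y\<close> is that
  of \<open>v\<close>. If \<open>u\<close> leaves \<open>Y\<close>, it is that of
  \<open>u\<close>.\<close>

lemma derivation_first_letter:
  assumes "Y \<subseteq> X"
  shows "derivation X Y (first_letter X Y j)"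
  unfolding derivation_def
proof (intro conjI ballI)
  show "first_letter X Y j \<in> carrier S \<rightarrow> carrier K" by (simp add: first_letter_def)
  fix u v
  have append: "List.find P (xs @ ys) =
      (case List.find P xs of None \<Rightarrow> List.find P ys | Some x \<Rightarrow> Some x)" for P and xs ys :: "'a list"
    by (induction xs) auto
  have filt: "List.find (\<lambda>x. x \<notin> Y) (filter (\<lambda>x. x \<notin> set u) v) = List.find (\<lambda>x. x \<notin> Y) v"
    if "set u \<subseteq> Y"
    using that by (induction v) auto
  show "first_letter X Y j (u \<otimes>\<^bsub>S\<^esub> v) =
      chi Y u \<otimes>\<^bsub>K\<^esub> first_letter X Y j v \<oplus>\<^bsub>K\<^esub> chi X v \<otimes>\<^bsub>K\<^esub> first_letter X Y j u"
  proof (cases "set u \<subseteq> Y")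
    case True
    then have "List.find (\<lambda>x. x \<notin> Y) u = None" by (auto simp: find_None_iff)
    then have "List.find (\<lambda>x. x \<notin> Y) (u \<otimes>\<^bsub>S\<^esub> v) = List.find (\<lambda>x. x \<notin> Y) v"
      using filt[OF True] by (simp add: free_lrb_sel append)
    moreover have "set u \<subseteq> X" using True assms by blast
    ultimately show ?thesis
      using True \<open>List.find (\<lambda>x. x \<notin> Y) u = None\<close>
      by (simp add: first_letter_def set_mult) (simp add: chi_def)
  next
    case False
    then obtain x where "List.find (\<lambda>x. x \<notin> Y) u = Some x"
      by (cases "List.find (\<lambda>x. x \<notin> Y) u") (auto simp: find_None_iff)
    then have "List.find (\<lambda>x. x \<notin> Y) (u \<otimes>\<^bsub>S\<^esub> v) = List.find (\<lambda>x. x \<notin> Y) u"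
      by (simp add: free_lrb_sel append)
    then show ?thesis using False by (simp add: first_letter_def set_mult) (simp add: chi_def)
  qed
qed

section \<open>The kernel of the cover and its linear maps to the simple modules\<close>

abbreviation F :: "('a list \<Rightarrow> 'k, 'k \<Rightarrow> 'a list \<Rightarrow> 'k) module" where
  "F \<equiv> free_left_module alg (carrier K)"

interpretation F: left_module alg F by (rule alg.left_module_free_left_module)

abbreviation cover :: "'a set \<Rightarrow> ('k \<Rightarrow> 'a list \<Rightarrow> 'k) \<Rightarrow> 'k" where
  "cover X \<equiv> free_cover alg (simp_mod X) (carrier K)"

lemma res0_lrb_simple: "res0 alg (simp_mod X) = F"
  by (simp add: res0_def lrb_simple_sel)

lemma res_ker0_lrb_simple:
  "k \<in> res_ker0 alg (simp_mod X) \<longleftrightarrow> k \<in> carrier F \<and> cover X k = \<zero>\<^bsub>K\<^esub>"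
  by (simp add: res_ker0_def res0_lrb_simple lrb_simple_sel)

lemma cover_linear:
  shows "k \<in> carrier F \<Longrightarrow> cover X k \<in> carrier K"
    and "\<lbrakk>k \<in> carrier F; l \<in> carrier F\<rbrakk> \<Longrightarrow> cover X (k \<oplus>\<^bsub>F\<^esub> l) = cover X k \<oplus>\<^bsub>K\<^esub> cover X l"
    and "\<lbrakk>r \<in> carrier alg; k \<in> carrier F\<rbrakk> \<Longrightarrow> cover X (r \<odot>\<^bsub>F\<^esub> k) = character X r \<otimes>\<^bsub>K\<^esub> cover X k"
proof -
  have hom: "cover X \<in> left_module_hom alg F (simp_mod X)"
    by (rule free_cover_hom[OF left_module_lrb_simple]) (simp add: lrb_simple_sel)
  show cl: "k \<in> carrier F \<Longrightarrow> cover X k \<in> carrier K" for k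
    using left_module_homD(1)[OF hom] by (simp add: lrb_simple_sel)
  show "\<lbrakk>k \<in> carrier F; l \<in> carrier F\<rbrakk> \<Longrightarrow> cover X (k \<oplus>\<^bsub>F\<^esub> l) = cover X k \<oplus>\<^bsub>K\<^esub> cover X l"
    using left_module_homD(2)[OF hom] by (simp add: lrb_simple_sel)
  show "\<lbrakk>r \<in> carrier alg; k \<in> carrier F\<rbrakk> \<Longrightarrow> cover X (r \<odot>\<^bsub>F\<^esub> k) = character X r \<otimes>\<^bsub>K\<^esub> cover X k"
    using left_module_homD(3)[OF hom] by (simp add: lrb_simple_smult cl)
qed

text \<open>The multiple \<open>r [1]\<close> of the generator of \<open>F\<close> indexed by \<open>1 \<in> K\<close>, and the projection
  \<open>r \<mapsto> r - \<chi>\<^sub>X(r)\<close> of the algebra onto the kernel of the character.\<close>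

definition iota :: "('a list \<Rightarrow> 'k) \<Rightarrow> 'k \<Rightarrow> 'a list \<Rightarrow> 'k" where
  "iota r = free_single alg (carrier K) \<one>\<^bsub>K\<^esub> r"

definition aug :: "'a set \<Rightarrow> ('a list \<Rightarrow> 'k) \<Rightarrow> 'a list \<Rightarrow> 'k" where
  "aug X r = r \<oplus>\<^bsub>alg\<^esub> scalar (\<ominus>\<^bsub>K\<^esub> character X r)"

lemma iota_linear:
  shows "r \<in> carrier alg \<Longrightarrow> iota r \<in> carrier F"
    and "\<lbrakk>r \<in> carrier alg; s \<in> carrier alg\<rbrakk> \<Longrightarrow> iota (r \<oplus>\<^bsub>alg\<^esub> s) = iota r \<oplus>\<^bsub>F\<^esub> iota s"
    and "\<lbrakk>r \<in> carrier alg; s \<in> carrier alg\<rbrakk> \<Longrightarrow> iota (r \<otimes>\<^bsub>alg\<^esub> s) = r \<odot>\<^bsub>F\<^esub> iota s"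
    and "iota \<zero>\<^bsub>alg\<^esub> = \<zero>\<^bsub>F\<^esub>"
  using alg.free_single_closed
  by (auto simp: iota_def free_single_def free_left_module_sel(2-4) intro!: restrict_ext)

lemma cover_iota: "r \<in> carrier alg \<Longrightarrow> cover X (iota r) = character X r"
  unfolding iota_def
  by (subst free_cover_single[OF left_module_lrb_simple]) (simp_all add: lrb_simple_sel lrb_simple_smult)

lemma scalar_zero: "scalar \<zero>\<^bsub>K\<^esub> = \<zero>\<^bsub>alg\<^esub>"
  by (rule additive_zero[OF K.abelian_group_axioms alg.abelian_group_axioms])
    (auto simp: scalar_ring_hom)

lemma aug_closed [simp]: "r \<in> carrier alg \<Longrightarrow> aug X r \<in> carrier alg"
  by (simp add: aug_def)

lemma iota_aug_ker: "r \<in> carrier alg \<Longrightarrow> iota (aug X r) \<in> res_ker0 alg (simp_mod X)"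
  by (simp add: res_ker0_lrb_simple iota_linear cover_iota)
    (simp add: aug_def lin_add_alg character_scalar K.r_neg)

lemma lin_mult_scalar:
  assumes "phi \<in> carrier S \<rightarrow> carrier K" "r \<in> carrier alg" "c \<in> carrier K"
  shows "lin phi (scalar c \<otimes>\<^bsub>alg\<^esub> r) = c \<otimes>\<^bsub>K\<^esub> lin phi r"
    and "lin phi (r \<otimes>\<^bsub>alg\<^esub> scalar c) = c \<otimes>\<^bsub>K\<^esub> lin phi r"
  using assms by (simp_all add: scalar_mult lin_smult_alg)

lemma aug_add:
  assumes "r \<in> carrier alg" "s \<in> carrier alg"
  shows "aug X (r \<oplus>\<^bsub>alg\<^esub> s) = aug X r \<oplus>\<^bsub>alg\<^esub> aug X s"
  using assms
  by (simp add: aug_def lin_add_alg K.minus_add scalar_ring_hom alg.a_ac)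

lemma aug_scalar: "c \<in> carrier K \<Longrightarrow> aug X (scalar c) = \<zero>\<^bsub>alg\<^esub>"
  by (simp add: aug_def character_scalar scalar_ring_hom(2)[symmetric] K.r_neg scalar_zero)

text \<open>Writing out \<open>aug X r\<close>, the two multiples of \<open>r\<close> by
  \<open>p\<close> cancel. With \<open>p\<close> a character value this yields the product rule for
  \<open>aug X\<close>; with \<open>p\<close> a value of the cover it measures how far
  \<open>rho\<close> below is from being linear.\<close>

lemma scalar_minus_split:
  assumes r: "r \<in> carrier alg" and p: "p \<in> carrier K"
  shows "scalar (\<ominus>\<^bsub>K\<^esub> (character X r \<otimes>\<^bsub>K\<^esub> p)) =
    r \<otimes>\<^bsub>alg\<^esub> scalar (\<ominus>\<^bsub>K\<^esub> p) \<oplus>\<^bsub>alg\<^esub> scalar p \<otimes>\<^bsub>alg\<^esub> aug X r"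
proof (rule alg_eqI)
  fix phi assume phi: "phi \<in> carrier S \<rightarrow> carrier K"
  have cl: "lin phi r \<in> carrier K" "character X r \<in> carrier K" "phi \<one>\<^bsub>S\<^esub> \<in> carrier K"
    using phi r by auto
  have "lin phi (r \<otimes>\<^bsub>alg\<^esub> scalar (\<ominus>\<^bsub>K\<^esub> p) \<oplus>\<^bsub>alg\<^esub> scalar p \<otimes>\<^bsub>alg\<^esub> aug X r) =
      (\<ominus>\<^bsub>K\<^esub> p) \<otimes>\<^bsub>K\<^esub> lin phi r \<oplus>\<^bsub>K\<^esub>
      p \<otimes>\<^bsub>K\<^esub> (lin phi r \<oplus>\<^bsub>K\<^esub> (\<ominus>\<^bsub>K\<^esub> character X r) \<otimes>\<^bsub>K\<^esub> phi \<one>\<^bsub>S\<^esub>)"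
    using phi r p by (simp add: lin_add_alg lin_mult_scalar alg_mult_closed)
      (simp add: aug_def lin_add_alg lin_scalar)
  also have "\<dots> = (\<ominus>\<^bsub>K\<^esub> (character X r \<otimes>\<^bsub>K\<^esub> p)) \<otimes>\<^bsub>K\<^esub> phi \<one>\<^bsub>S\<^esub>"
    using cl p by (simp add: K.r_distr K.l_minus K.r_minus K.m_ac K.r_neg1)
  finally show "lin phi (scalar (\<ominus>\<^bsub>K\<^esub> (character X r \<otimes>\<^bsub>K\<^esub> p))) =
      lin phi (r \<otimes>\<^bsub>alg\<^esub> scalar (\<ominus>\<^bsub>K\<^esub> p) \<oplus>\<^bsub>alg\<^esub> scalar p \<otimes>\<^bsub>alg\<^esub> aug X r)"
    using phi r p by (simp add: lin_scalar)
qed (use r p in \<open>simp_all add: alg_mult_closed\<close>)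

text \<open>The term \<open>r\<close> times the character value of \<open>s\<close> is subtracted
  and added back. This rule is the origin of the derivation property, as a linear map on the kernel
  turns the left factor \<open>r\<close> into \<open>character Y r\<close>.\<close>

lemma aug_mult:
  assumes r: "r \<in> carrier alg" and s: "s \<in> carrier alg"
  shows "aug X (r \<otimes>\<^bsub>alg\<^esub> s) =
    r \<otimes>\<^bsub>alg\<^esub> aug X s \<oplus>\<^bsub>alg\<^esub> scalar (character X s) \<otimes>\<^bsub>alg\<^esub> aug X r"
  using r s scalar_minus_split[OF r, of "character X s" X]
  by (simp add: aug_def[of X "r \<otimes>\<^bsub>alg\<^esub> s"] aug_def[of X s] character_mult alg.r_distr alg.a_assoc)

text \<open>Homomorphisms from the kernel to \<open>simp_mod Y\<close>, written out over the field
  because the kernel occurs only as a set and not as a module record.\<close>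

definition ker_linear :: "'a set \<Rightarrow> 'a set \<Rightarrow> (('k \<Rightarrow> 'a list \<Rightarrow> 'k) \<Rightarrow> 'k) \<Rightarrow> bool" where
  "ker_linear X Y phi \<longleftrightarrow>
     (\<forall>k\<in>res_ker0 alg (simp_mod X). phi k \<in> carrier K) \<and>
     (\<forall>k\<in>res_ker0 alg (simp_mod X). \<forall>l\<in>res_ker0 alg (simp_mod X).
       phi (k \<oplus>\<^bsub>F\<^esub> l) = phi k \<oplus>\<^bsub>K\<^esub> phi l) \<and>
     (\<forall>r\<in>carrier alg. \<forall>k\<in>res_ker0 alg (simp_mod X).
       phi (r \<odot>\<^bsub>F\<^esub> k) = character Y r \<otimes>\<^bsub>K\<^esub> phi k)"

lemma ker_linearD:
  assumes "ker_linear X Y phi"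
  shows "k \<in> res_ker0 alg (simp_mod X) \<Longrightarrow> phi k \<in> carrier K"
    and "\<lbrakk>k \<in> res_ker0 alg (simp_mod X); l \<in> res_ker0 alg (simp_mod X)\<rbrakk> \<Longrightarrow>
      phi (k \<oplus>\<^bsub>F\<^esub> l) = phi k \<oplus>\<^bsub>K\<^esub> phi l"
    and "\<lbrakk>r \<in> carrier alg; k \<in> res_ker0 alg (simp_mod X)\<rbrakk> \<Longrightarrow>
      phi (r \<odot>\<^bsub>F\<^esub> k) = character Y r \<otimes>\<^bsub>K\<^esub> phi k"
  using assms by (auto simp: ker_linear_def)

lemmas ker_closed = res_ker0_closed[OF left_module_lrb_simple, unfolded res0_lrb_simple]

text \<open>In the product rule for \<open>aug X\<close>, the scalar \<open>character X s\<close>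
  acts on \<open>simp_mod Y\<close> as that element of the field. Hence the character of
  \<open>X\<close> survives next to the one of \<open>Y\<close>.\<close>

lemma ker_linear_aug:
  assumes phi: "ker_linear X Y phi"
  shows "r \<in> carrier alg \<Longrightarrow> phi (iota (aug X r)) \<in> carrier K"
    and "\<lbrakk>r \<in> carrier alg; s \<in> carrier alg\<rbrakk> \<Longrightarrow>
      phi (iota (aug X (r \<oplus>\<^bsub>alg\<^esub> s))) = phi (iota (aug X r)) \<oplus>\<^bsub>K\<^esub> phi (iota (aug X s))"
    and "\<lbrakk>r \<in> carrier alg; s \<in> carrier alg\<rbrakk> \<Longrightarrow>
      phi (iota (aug X (r \<otimes>\<^bsub>alg\<^esub> s))) =
        character Y r \<otimes>\<^bsub>K\<^esub> phi (iota (aug X s)) \<oplus>\<^bsub>K\<^esub> character X s \<otimes>\<^bsub>K\<^esub> phi (iota (aug X r))"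
    and "c \<in> carrier K \<Longrightarrow> phi (iota (aug X (scalar c))) = \<zero>\<^bsub>K\<^esub>"
proof -
  show "r \<in> carrier alg \<Longrightarrow> phi (iota (aug X r)) \<in> carrier K"
    using ker_linearD(1)[OF phi] iota_aug_ker by blast
  show "\<lbrakk>r \<in> carrier alg; s \<in> carrier alg\<rbrakk> \<Longrightarrow>
      phi (iota (aug X (r \<oplus>\<^bsub>alg\<^esub> s))) = phi (iota (aug X r)) \<oplus>\<^bsub>K\<^esub> phi (iota (aug X s))"
    by (simp add: aug_add iota_linear ker_linearD(2)[OF phi] iota_aug_ker)
  show "\<lbrakk>r \<in> carrier alg; s \<in> carrier alg\<rbrakk> \<Longrightarrow>
      phi (iota (aug X (r \<otimes>\<^bsub>alg\<^esub> s))) =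
        character Y r \<otimes>\<^bsub>K\<^esub> phi (iota (aug X s)) \<oplus>\<^bsub>K\<^esub> character X s \<otimes>\<^bsub>K\<^esub> phi (iota (aug X r))"
    by (simp add: aug_mult iota_linear ker_linearD(2,3)[OF phi] iota_aug_ker ker_closed
        character_scalar alg_mult_closed)
  show "phi (iota (aug X (scalar c))) = \<zero>\<^bsub>K\<^esub>" if c: "c \<in> carrier K"
  proof -
    have "\<zero>\<^bsub>alg\<^esub> = aug X (\<zero>\<^bsub>alg\<^esub>)" using aug_scalar[of "\<zero>\<^bsub>K\<^esub>" X] by (simp add: scalar_zero)
    then have k: "iota \<zero>\<^bsub>alg\<^esub> \<in> res_ker0 alg (simp_mod X)" using iota_aug_ker[of "\<zero>\<^bsub>alg\<^esub>" X] by simp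
    have "phi (\<zero>\<^bsub>alg\<^esub> \<odot>\<^bsub>F\<^esub> iota \<zero>\<^bsub>alg\<^esub>) = character Y (scalar \<zero>\<^bsub>K\<^esub>) \<otimes>\<^bsub>K\<^esub> phi (iota \<zero>\<^bsub>alg\<^esub>)"
      using ker_linearD(3)[OF phi alg_closed(1) k] by (simp add: scalar_zero)
    then show ?thesis
      using c ker_linearD(1)[OF phi k] by (simp add: aug_scalar character_scalar iota_linear)
  qed
qed

lemma derivation_of_ker_linear:
  assumes phi: "ker_linear X Y phi"
  shows "derivation X Y (\<lambda>w. phi (iota (aug X (elt w))))"
  unfolding derivation_def
proof (intro conjI ballI)
  show "(\<lambda>w. phi (iota (aug X (elt w)))) \<in> carrier S \<rightarrow> carrier K"
    by (simp add: ker_linear_aug(1)[OF phi])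
  fix u v assume "u \<in> carrier S" "v \<in> carrier S"
  then show "phi (iota (aug X (elt (u \<otimes>\<^bsub>S\<^esub> v)))) =
      chi Y u \<otimes>\<^bsub>K\<^esub> phi (iota (aug X (elt v))) \<oplus>\<^bsub>K\<^esub> chi X v \<otimes>\<^bsub>K\<^esub> phi (iota (aug X (elt u)))"
    using ker_linear_aug(3)[OF phi, of "elt u" "elt v"] by (simp add: elt_mult lin_elt)
qed

text \<open>An element of \<open>F\<close> differs from an element of the kernel by a multiple of
  the generator of 1, so an extension is fixed by its value \<open>c\<close> there. Linearity of the
  extension is exactly the inner equation.\<close>

lemma ker_linear_inner_extends:
  assumes phi: "ker_linear X Y phi" and c: "c \<in> carrier K"
    and inner: "\<And>w. w \<in> carrier S \<Longrightarrow>
      phi (iota (aug X (elt w))) \<oplus>\<^bsub>K\<^esub> c \<otimes>\<^bsub>K\<^esub> chi X w = c \<otimes>\<^bsub>K\<^esub> chi Y w"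
  shows "\<exists>g\<in>left_module_hom alg F (simp_mod Y). \<forall>k\<in>res_ker0 alg (simp_mod X). phi k = g k"
proof -
  let ?D = "\<lambda>r. phi (iota (aug X r))"
  note D = ker_linear_aug[OF phi]
  \<comment> \<open>Both sides are linear in \<open>r\<close>, and the equation is given on
    words.\<close>
  have D_inner: "?D r \<oplus>\<^bsub>K\<^esub> c \<otimes>\<^bsub>K\<^esub> character X r = c \<otimes>\<^bsub>K\<^esub> character Y r" if "r \<in> carrier alg" for r
    using that
  proof (induction rule: alg_induct)
    case zero
    show ?case
      using D(4)[of "\<zero>\<^bsub>K\<^esub>"] c character_scalar[of "\<zero>\<^bsub>K\<^esub>"] by (simp add: scalar_zero)
  next
    case (add a s g)
    note cl = add.hyps c D(1)[OF alg_closed(2)[of s]] D(1)[OF add.hyps(3)]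
    have chg: "character X g \<in> carrier K" "character Y g \<in> carrier K" using add.hyps by auto
    have "?D (scalar a \<otimes>\<^bsub>alg\<^esub> elt s \<oplus>\<^bsub>alg\<^esub> g) = a \<otimes>\<^bsub>K\<^esub> ?D (elt s) \<oplus>\<^bsub>K\<^esub> ?D g"
      using cl by (simp add: D(2-4) alg_mult_closed character_scalar lin_elt)
    moreover have "character Z (scalar a \<otimes>\<^bsub>alg\<^esub> elt s \<oplus>\<^bsub>alg\<^esub> g) = a \<otimes>\<^bsub>K\<^esub> chi Z s \<oplus>\<^bsub>K\<^esub> character Z g" for Z
      using cl by (simp add: lin_add_alg lin_mult_scalar lin_elt alg_mult_closed)
    ultimately have "?D (scalar a \<otimes>\<^bsub>alg\<^esub> elt s \<oplus>\<^bsub>alg\<^esub> g) \<oplus>\<^bsub>K\<^esub>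
        c \<otimes>\<^bsub>K\<^esub> character X (scalar a \<otimes>\<^bsub>alg\<^esub> elt s \<oplus>\<^bsub>alg\<^esub> g) =
        a \<otimes>\<^bsub>K\<^esub> (?D (elt s) \<oplus>\<^bsub>K\<^esub> c \<otimes>\<^bsub>K\<^esub> chi X s) \<oplus>\<^bsub>K\<^esub> (?D g \<oplus>\<^bsub>K\<^esub> c \<otimes>\<^bsub>K\<^esub> character X g)"
      using cl chg by (simp add: K.r_distr K.a_ac K.m_ac)
    also have "\<dots> = c \<otimes>\<^bsub>K\<^esub> character Y (scalar a \<otimes>\<^bsub>alg\<^esub> elt s \<oplus>\<^bsub>alg\<^esub> g)"
      unfolding inner[OF add.hyps(2)] add.IH
      using cl chg by (simp add: lin_add_alg lin_mult_scalar lin_elt alg_mult_closed K.r_distr K.m_ac)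
    finally show ?case .
  qed
  \<comment> \<open>\<open>rho\<close> projects \<open>F\<close> onto the kernel of the cover, but is not linear over the algebra; the
    term \<open>c * cover X k\<close> in \<open>g\<close> below makes up for this.\<close>
  define rho where "rho k = k \<oplus>\<^bsub>F\<^esub> iota (scalar (\<ominus>\<^bsub>K\<^esub> cover X k))" for k
  have rho_ker: "rho k \<in> res_ker0 alg (simp_mod X)" if "k \<in> carrier F" for k
    using that cover_linear(1)[OF that]
    by (simp add: rho_def res_ker0_lrb_simple iota_linear cover_linear cover_iota character_scalar K.r_neg)
  have rho_add: "rho (k \<oplus>\<^bsub>F\<^esub> l) = rho k \<oplus>\<^bsub>F\<^esub> rho l" if "k \<in> carrier F" "l \<in> carrier F" for k l
    using that cover_linear(1)[of k X] cover_linear(1)[of l X]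
    by (simp add: rho_def iota_linear cover_linear(2) K.minus_add scalar_ring_hom F.M.a_ac)
  have rho_smult: "rho (r \<odot>\<^bsub>F\<^esub> k) = r \<odot>\<^bsub>F\<^esub> rho k \<oplus>\<^bsub>F\<^esub> scalar (cover X k) \<odot>\<^bsub>F\<^esub> iota (aug X r)"
    if "r \<in> carrier alg" "k \<in> carrier F" for r k
    using that cover_linear(1)[OF that(2), of X] scalar_minus_split[OF that(1) cover_linear(1)[OF that(2)], of X X]
    by (simp add: rho_def cover_linear(3) iota_linear alg_mult_closed F.smult_r_distr F.smult_closed F.M.a_assoc)
  define g where "g = (\<lambda>k\<in>carrier F. phi (rho k) \<oplus>\<^bsub>K\<^esub> c \<otimes>\<^bsub>K\<^esub> cover X k)"
  have "g \<in> left_module_hom alg F (simp_mod Y)"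
  proof (rule left_module_homI)
    fix k assume k: "k \<in> carrier F"
    then show "g k \<in> carrier (simp_mod Y)"
      using c ker_linearD(1)[OF phi rho_ker[OF k]] cover_linear(1)[OF k] by (simp add: g_def lrb_simple_sel)
  next
    fix k l assume kl: "k \<in> carrier F" "l \<in> carrier F"
    show "g (k \<oplus>\<^bsub>F\<^esub> l) = g k \<oplus>\<^bsub>simp_mod Y\<^esub> g l"
      using c kl ker_linearD(1,2)[OF phi] rho_ker cover_linear(1)[of _ X]
      by (simp add: g_def lrb_simple_sel rho_add cover_linear(2) K.r_distr K.a_ac)
  next
    fix r k assume r: "r \<in> carrier alg" and k: "k \<in> carrier F"
    let ?p = "cover X k" and ?q = "phi (rho k)"
    have cl: "?p \<in> carrier K" "?q \<in> carrier K" "?D r \<in> carrier K" "character X r \<in> carrier K"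
      "character Y r \<in> carrier K"
      using r k cover_linear(1) ker_linearD(1)[OF phi rho_ker] D(1) by auto
    have "g (r \<odot>\<^bsub>F\<^esub> k) = character Y r \<otimes>\<^bsub>K\<^esub> ?q \<oplus>\<^bsub>K\<^esub> ?p \<otimes>\<^bsub>K\<^esub> ?D r \<oplus>\<^bsub>K\<^esub> c \<otimes>\<^bsub>K\<^esub> (character X r \<otimes>\<^bsub>K\<^esub> ?p)"
      using r k cl
      by (simp add: g_def F.smult_closed rho_smult ker_linearD(2,3)[OF phi] rho_ker iota_aug_ker
          ker_closed character_scalar cover_linear(3))
    also have "\<dots> = character Y r \<otimes>\<^bsub>K\<^esub> ?q \<oplus>\<^bsub>K\<^esub> ?p \<otimes>\<^bsub>K\<^esub> (?D r \<oplus>\<^bsub>K\<^esub> c \<otimes>\<^bsub>K\<^esub> character X r)"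
      using cl c by (simp add: K.r_distr K.a_assoc K.m_ac)
    \<comment> \<open>The defect of \<open>rho\<close> has been collected with the multiple of
      \<open>c\<close> into the left side of the inner equation.\<close>
    also have "\<dots> = character Y r \<otimes>\<^bsub>K\<^esub> (?q \<oplus>\<^bsub>K\<^esub> c \<otimes>\<^bsub>K\<^esub> ?p)"
      unfolding D_inner[OF r] using cl c by (simp add: K.r_distr K.m_ac)
    finally show "g (r \<odot>\<^bsub>F\<^esub> k) = r \<odot>\<^bsub>simp_mod Y\<^esub> g k"
      using r k cl c by (simp add: g_def lrb_simple_smult)
  qed (simp add: g_def)
  moreover have "phi k = g k" if "k \<in> res_ker0 alg (simp_mod X)" for k
    using that ker_linearD(1)[OF phi that] c
    by (simp add: g_def res_ker0_lrb_simple rho_def scalar_zero iota_linear)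
  ultimately show ?thesis by blast
qed

text \<open>On the summand at 1 a homomorphism multiplies \<open>character Y r\<close> by its value
  at the generator. For \<open>r\<close> the word minus its value under \<open>chi X\<close>, this
  is an inner derivation.\<close>

lemma hom_restricts_to_inner:
  assumes g: "g \<in> left_module_hom alg F (simp_mod Y)" and w: "w \<in> carrier S"
  shows "g (iota \<one>\<^bsub>alg\<^esub>) \<in> carrier K"
    and "g (iota (aug X (elt w))) \<oplus>\<^bsub>K\<^esub> g (iota \<one>\<^bsub>alg\<^esub>) \<otimes>\<^bsub>K\<^esub> chi X w = g (iota \<one>\<^bsub>alg\<^esub>) \<otimes>\<^bsub>K\<^esub> chi Y w"
proof -
  let ?c = "g (iota \<one>\<^bsub>alg\<^esub>)"
  show c: "?c \<in> carrier K"
    using left_module_homD(1)[OF g iota_linear(1)[OF alg.one_closed]] by (simp add: lrb_simple_sel)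
  have g_iota: "g (iota r) = character Y r \<otimes>\<^bsub>K\<^esub> ?c" if "r \<in> carrier alg" for r
    using left_module_homD(3)[OF g that iota_linear(1)[OF alg.one_closed]] that c
    by (simp add: iota_linear(3)[symmetric] lrb_simple_smult)
  have "character Y (aug X (elt w)) = chi Y w \<oplus>\<^bsub>K\<^esub> \<ominus>\<^bsub>K\<^esub> chi X w"
    using w by (simp add: aug_def lin_add_alg character_scalar lin_elt)
  then have "g (iota (aug X (elt w))) = (chi Y w \<oplus>\<^bsub>K\<^esub> \<ominus>\<^bsub>K\<^esub> chi X w) \<otimes>\<^bsub>K\<^esub> ?c"
    using g_iota[of "aug X (elt w)"] by simp
  moreover have "(y \<oplus>\<^bsub>K\<^esub> \<ominus>\<^bsub>K\<^esub> x) \<otimes>\<^bsub>K\<^esub> e \<oplus>\<^bsub>K\<^esub> e \<otimes>\<^bsub>K\<^esub> x = e \<otimes>\<^bsub>K\<^esub> y"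
    if "x \<in> carrier K" "y \<in> carrier K" "e \<in> carrier K" for x y e
    using that by (simp add: K.l_distr K.l_minus K.a_assoc K.l_neg K.m_comm[of e])
  ultimately show "g (iota (aug X (elt w))) \<oplus>\<^bsub>K\<^esub> ?c \<otimes>\<^bsub>K\<^esub> chi X w = ?c \<otimes>\<^bsub>K\<^esub> chi Y w"
    using c by simp
qed

text \<open>The derivation prescribes values only on the elements
  \<open>iota (aug X (elt w))\<close>, whereas the kernel spreads over all coordinates of
  \<open>F\<close>. Weighting each coordinate by its index extends the prescription.\<close>

lemma ker_linear_of_derivation:
  assumes d: "derivation X Y d"
  obtains h where "ker_linear X Y h" and "\<And>w. w \<in> carrier S \<Longrightarrow> h (iota (aug X (elt w))) = d w"
proof -
  have dS: "d \<in> carrier S \<rightarrow> carrier K" using d by (simp add: derivation_def)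
  \<comment> \<open>\<open>h k = \<Sum>m. d (k m) m\<close>, where \<open>h (r k) - \<chi>\<^sub>Y(r) h k = d(r) cover X k\<close> vanishes on the kernel.\<close>
  define h where "h = support_sum alg (carrier K) K (\<lambda>m r. lin d r \<otimes>\<^bsub>K\<^esub> m)"
  interpret H: support_sum_map alg K "carrier K" "\<lambda>m r. lin d r \<otimes>\<^bsub>K\<^esub> m"
    by unfold_locales (simp_all add: dS lin_add_alg K.l_distr)
  have cover_eq: "cover X k = (\<Oplus>\<^bsub>K\<^esub>m\<in>{m \<in> carrier K. k m \<noteq> \<zero>\<^bsub>alg\<^esub>}. character X (k m) \<otimes>\<^bsub>K\<^esub> m)"
    if "k \<in> carrier F" for k
  proof -
    have "cover X k = (\<Oplus>\<^bsub>simp_mod X\<^esub>m\<in>{m \<in> carrier K. k m \<noteq> \<zero>\<^bsub>alg\<^esub>}. k m \<odot>\<^bsub>simp_mod X\<^esub> m)"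
      using that by (simp add: free_cover_eq support_sum_def)
    \<comment> \<open>A finite sum depends only on carrier, zero and addition, and these agree for
      the module and the field.\<close>
    also have "\<dots> = (\<Oplus>\<^bsub>K\<^esub>m\<in>{m \<in> carrier K. k m \<noteq> \<zero>\<^bsub>alg\<^esub>}. k m \<odot>\<^bsub>simp_mod X\<^esub> m)"
      by (simp add: finsum_def finprod_def lrb_simple_def)
    also have "\<dots> = (\<Oplus>\<^bsub>K\<^esub>m\<in>{m \<in> carrier K. k m \<noteq> \<zero>\<^bsub>alg\<^esub>}. character X (k m) \<otimes>\<^bsub>K\<^esub> m)"
      using free_left_moduleD[OF that] by (intro K.finsum_cong') (auto simp: lrb_simple_smult)
    finally show ?thesis .
  qed
  have h_smult: "h (r \<odot>\<^bsub>F\<^esub> k) = character Y r \<otimes>\<^bsub>K\<^esub> h k \<oplus>\<^bsub>K\<^esub> lin d r \<otimes>\<^bsub>K\<^esub> cover X k"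
    if r: "r \<in> carrier alg" and k: "k \<in> carrier F" for r k
  proof -
    let ?T = "{m \<in> carrier K. k m \<noteq> \<zero>\<^bsub>alg\<^esub>}"
    note kD = free_left_moduleD[OF k]
    have cl: "lin d (k m) \<in> carrier K" "character X (k m) \<in> carrier K" "k m \<in> carrier alg" if "m \<in> ?T" for m
      using that kD dS by auto
    have cr: "lin d r \<in> carrier K" "character Y r \<in> carrier K" using r dS by auto
    have "h (r \<odot>\<^bsub>F\<^esub> k) = (\<Oplus>\<^bsub>K\<^esub>m\<in>?T. lin d (r \<otimes>\<^bsub>alg\<^esub> k m) \<otimes>\<^bsub>K\<^esub> m)"
      using H.support_sum_smult[OF r k] by (simp add: h_def support_sum_def)
    \<comment> \<open>The product rule splits each coordinate; the second parts add up to a multiple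
      of the cover.\<close>
    also have "\<dots> = (\<Oplus>\<^bsub>K\<^esub>m\<in>?T. character Y r \<otimes>\<^bsub>K\<^esub> (lin d (k m) \<otimes>\<^bsub>K\<^esub> m) \<oplus>\<^bsub>K\<^esub>
        lin d r \<otimes>\<^bsub>K\<^esub> (character X (k m) \<otimes>\<^bsub>K\<^esub> m))"
      using cl cr r
      by (intro K.finsum_cong')
        (auto simp: lin_derivation[OF dS derivationD(2)[OF d]] K.l_distr K.m_assoc)
    also have "\<dots> = (\<Oplus>\<^bsub>K\<^esub>m\<in>?T. character Y r \<otimes>\<^bsub>K\<^esub> (lin d (k m) \<otimes>\<^bsub>K\<^esub> m)) \<oplus>\<^bsub>K\<^esub>
        (\<Oplus>\<^bsub>K\<^esub>m\<in>?T. lin d r \<otimes>\<^bsub>K\<^esub> (character X (k m) \<otimes>\<^bsub>K\<^esub> m))"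
      using cl cr by (intro K.finsum_addf) auto
    also have "(\<Oplus>\<^bsub>K\<^esub>m\<in>?T. character Y r \<otimes>\<^bsub>K\<^esub> (lin d (k m) \<otimes>\<^bsub>K\<^esub> m)) = character Y r \<otimes>\<^bsub>K\<^esub> h k"
      unfolding h_def support_sum_def using cl cr kD(2) by (intro K.finsum_rdistr[symmetric]) auto
    also have "(\<Oplus>\<^bsub>K\<^esub>m\<in>?T. lin d r \<otimes>\<^bsub>K\<^esub> (character X (k m) \<otimes>\<^bsub>K\<^esub> m)) = lin d r \<otimes>\<^bsub>K\<^esub> cover X k"
      unfolding cover_eq[OF k] using cl cr kD(2) by (intro K.finsum_rdistr[symmetric]) auto
    finally show ?thesis .
  qed
  show ?thesis
  proof (rule that)
    show "ker_linear X Y h"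
      unfolding ker_linear_def
      using H.support_sum_closed H.support_sum_add dS
      by (auto simp: res_ker0_lrb_simple h_smult h_def[symmetric])
  next
    fix w assume w: "w \<in> carrier S"
    have dw: "d w \<in> carrier K" using dS w by auto
    \<comment> \<open>As \<open>d\<close> vanishes at the identity, the scalar subtracted by
      \<open>aug X\<close> does not change the value.\<close>
    have "d \<one>\<^bsub>S\<^esub> = \<zero>\<^bsub>K\<^esub>" using derivation_Nil[OF d] by (simp add: free_lrb_sel)
    then have "lin d (aug X (elt w)) = d w"
      using w dw dS by (simp add: aug_def lin_add_alg lin_scalar lin_elt)
    then show "h (iota (aug X (elt w))) = d w"
      using H.support_sum_single[of "\<one>\<^bsub>K\<^esub>" "aug X (elt w)"] dw by (simp add: h_def iota_def)
  qed
qed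

end

section \<open>The first extension groups\<close>

context free_lrb_algebra
begin

section \<open>The vector space of cocycles\<close>

definition cocycle_space ::
    "'a set \<Rightarrow> 'a set \<Rightarrow> ('k, (('k \<Rightarrow> 'a list \<Rightarrow> 'k) \<Rightarrow> 'a list \<Rightarrow> 'k) \<Rightarrow> 'k) module" where
  "cocycle_space X Y = (hom_space alg (res1 alg (simp_mod X)) (simp_mod Y))
     \<lparr>carrier := ext1_cocycles alg (simp_mod X) (simp_mod Y)\<rparr>"

lemma cocycle_space_sel:
  "carrier (cocycle_space X Y) = ext1_cocycles alg (simp_mod X) (simp_mod Y)"
  "\<zero>\<^bsub>cocycle_space X Y\<^esub> = (\<lambda>x\<in>carrier (res1 alg (simp_mod X)). \<zero>\<^bsub>K\<^esub>)"
  "f \<oplus>\<^bsub>cocycle_space X Y\<^esub> g = (\<lambda>x\<in>carrier (res1 alg (simp_mod X)). f x \<oplus>\<^bsub>K\<^esub> g x)"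
  "c \<odot>\<^bsub>cocycle_space X Y\<^esub> f =
    (\<lambda>x\<in>carrier (res1 alg (simp_mod X)). c \<odot>\<^bsub>restrict_scalars alg (simp_mod Y)\<^esub> f x)"
  by (simp_all add: cocycle_space_def hom_space_def lrb_simple_sel)

lemma cocycleD:
  assumes "f \<in> ext1_cocycles alg (simp_mod X) (simp_mod Y)"
  shows "x \<in> carrier (res1 alg (simp_mod X)) \<Longrightarrow> f x \<in> carrier K"
    and "f \<in> extensional (carrier (res1 alg (simp_mod X)))"
    and "\<lbrakk>x \<in> carrier (res1 alg (simp_mod X)); y \<in> carrier (res1 alg (simp_mod X))\<rbrakk> \<Longrightarrow>
      f (x \<oplus>\<^bsub>res1 alg (simp_mod X)\<^esub> y) = f x \<oplus>\<^bsub>K\<^esub> f y"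
    and "\<lbrakk>r \<in> carrier alg; x \<in> carrier (res1 alg (simp_mod X))\<rbrakk> \<Longrightarrow>
      f (r \<odot>\<^bsub>res1 alg (simp_mod X)\<^esub> x) = character Y r \<otimes>\<^bsub>K\<^esub> f x"
    and "z \<in> carrier (res2 alg (simp_mod X)) \<Longrightarrow> f (res_d2 alg (simp_mod X) z) = \<zero>\<^bsub>K\<^esub>"
proof -
  have hom: "f \<in> left_module_hom alg (res1 alg (simp_mod X)) (simp_mod Y)"
    using assms by (simp add: ext1_cocycles_def)
  show cl: "f x \<in> carrier K" if "x \<in> carrier (res1 alg (simp_mod X))" for x
    using left_module_homD(1)[OF hom that] by (simp add: lrb_simple_sel)
  show "\<lbrakk>x \<in> carrier (res1 alg (simp_mod X)); y \<in> carrier (res1 alg (simp_mod X))\<rbrakk> \<Longrightarrow>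
      f (x \<oplus>\<^bsub>res1 alg (simp_mod X)\<^esub> y) = f x \<oplus>\<^bsub>K\<^esub> f y"
    using left_module_homD(2)[OF hom] by (simp add: lrb_simple_sel)
  show "\<lbrakk>r \<in> carrier alg; x \<in> carrier (res1 alg (simp_mod X))\<rbrakk> \<Longrightarrow>
      f (r \<odot>\<^bsub>res1 alg (simp_mod X)\<^esub> x) = character Y r \<otimes>\<^bsub>K\<^esub> f x"
    using left_module_homD(3)[OF hom] by (simp add: lrb_simple_smult cl)
  show "f \<in> extensional (carrier (res1 alg (simp_mod X)))" by (rule left_module_homD(4)[OF hom])
  show "z \<in> carrier (res2 alg (simp_mod X)) \<Longrightarrow> f (res_d2 alg (simp_mod X) z) = \<zero>\<^bsub>K\<^esub>"
    using assms by (simp add: ext1_cocycles_def lrb_simple_sel)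
qed

lemma cocycleI:
  assumes "\<And>x. x \<in> carrier (res1 alg (simp_mod X)) \<Longrightarrow> f x \<in> carrier K"
    and "f \<in> extensional (carrier (res1 alg (simp_mod X)))"
    and "\<And>x y. \<lbrakk>x \<in> carrier (res1 alg (simp_mod X)); y \<in> carrier (res1 alg (simp_mod X))\<rbrakk> \<Longrightarrow>
      f (x \<oplus>\<^bsub>res1 alg (simp_mod X)\<^esub> y) = f x \<oplus>\<^bsub>K\<^esub> f y"
    and "\<And>r x. \<lbrakk>r \<in> carrier alg; x \<in> carrier (res1 alg (simp_mod X))\<rbrakk> \<Longrightarrow>
      f (r \<odot>\<^bsub>res1 alg (simp_mod X)\<^esub> x) = character Y r \<otimes>\<^bsub>K\<^esub> f x"
    and "\<And>z. z \<in> carrier (res2 alg (simp_mod X)) \<Longrightarrow> f (res_d2 alg (simp_mod X) z) = \<zero>\<^bsub>K\<^esub>"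
  shows "f \<in> ext1_cocycles alg (simp_mod X) (simp_mod Y)"
  using assms
  by (auto simp: ext1_cocycles_def lrb_simple_sel lrb_simple_smult intro!: left_module_homI)

lemma cocycle_smult:
  assumes "c \<in> carrier K" "f \<in> ext1_cocycles alg (simp_mod X) (simp_mod Y)"
  shows "c \<odot>\<^bsub>cocycle_space X Y\<^esub> f = (\<lambda>x\<in>carrier (res1 alg (simp_mod X)). c \<otimes>\<^bsub>K\<^esub> f x)"
  unfolding cocycle_space_sel using assms
  by (intro restrict_ext) (simp add: restrict_scalars_lrb_simple_smult cocycleD(1))

lemma cocycle_space_closed:
  assumes f: "f \<in> ext1_cocycles alg (simp_mod X) (simp_mod Y)"
    and g: "g \<in> ext1_cocycles alg (simp_mod X) (simp_mod Y)" and c: "c \<in> carrier K"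
  shows "f \<oplus>\<^bsub>cocycle_space X Y\<^esub> g \<in> ext1_cocycles alg (simp_mod X) (simp_mod Y)"
    and "c \<odot>\<^bsub>cocycle_space X Y\<^esub> f \<in> ext1_cocycles alg (simp_mod X) (simp_mod Y)"
proof -
  interpret M1: left_module alg "res1 alg (simp_mod X)"
    by (rule left_module_res1[OF left_module_lrb_simple])
  note d2 = res_d1_d2(1)[OF left_module_lrb_simple]
  note fD = cocycleD[OF f] and gD = cocycleD[OF g]
  show "f \<oplus>\<^bsub>cocycle_space X Y\<^esub> g \<in> ext1_cocycles alg (simp_mod X) (simp_mod Y)"
    unfolding cocycle_space_sel
    by (rule cocycleI) (simp_all add: fD gD M1.smult_closed d2 K.r_distr K.a_ac)
  show "c \<odot>\<^bsub>cocycle_space X Y\<^esub> f \<in> ext1_cocycles alg (simp_mod X) (simp_mod Y)"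
    unfolding cocycle_smult[OF c f]
    by (rule cocycleI) (simp_all add: c fD M1.smult_closed d2 K.r_distr K.m_ac)
qed

text \<open>All operations are pointwise, so the axioms come from the field, and extensionality
  turns agreement on the carrier into equality.\<close>

lemma vectorspace_cocycle_space: "vectorspace K (cocycle_space X Y)"
proof (rule vs_criteria)
  let ?C = "cocycle_space X Y" and ?B = "carrier (res1 alg (simp_mod X))"
  show "field K" by (rule K.field_axioms)
  show "\<zero>\<^bsub>?C\<^esub> \<in> carrier ?C"
  proof -
    interpret M1: left_module alg "res1 alg (simp_mod X)"
      by (rule left_module_res1[OF left_module_lrb_simple])
    show ?thesis
      unfolding cocycle_space_sel
      by (rule cocycleI) (simp_all add: M1.smult_closed res_d1_d2(1)[OF left_module_lrb_simple])
  qed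
  note cl = cocycle_space_closed[of _ X Y, folded cocycle_space_sel(1)[of X Y]]
  note sm = cocycle_smult[of _ _ X Y, folded cocycle_space_sel(1)[of X Y]]
  note app = cocycleD(1)[of _ X Y, folded cocycle_space_sel(1)[of X Y]]
  note ext = cocycleD(2)[of _ X Y, folded cocycle_space_sel(1)[of X Y]]
  show "\<forall>v w. v \<in> carrier ?C \<and> w \<in> carrier ?C \<longrightarrow> v \<oplus>\<^bsub>?C\<^esub> w \<in> carrier ?C"
    using cl(1)[OF _ _ K.zero_closed] by blast
  show sclosed: "\<forall>c v. c \<in> carrier K \<and> v \<in> carrier ?C \<longrightarrow> c \<odot>\<^bsub>?C\<^esub> v \<in> carrier ?C"
    using cl(2) by blast
  show "\<forall>v\<in>carrier ?C. \<exists>neg_v\<in>carrier ?C. v \<oplus>\<^bsub>?C\<^esub> neg_v = \<zero>\<^bsub>?C\<^esub>"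
  proof
    fix v assume v: "v \<in> carrier ?C"
    have "v \<oplus>\<^bsub>?C\<^esub> ((\<ominus>\<^bsub>K\<^esub> \<one>\<^bsub>K\<^esub>) \<odot>\<^bsub>?C\<^esub> v) = \<zero>\<^bsub>?C\<^esub>"
      using app[OF v] by (auto simp: sm[OF _ v] cocycle_space_sel(2,3) K.l_minus K.r_neg intro!: restrict_ext)
    moreover have "(\<ominus>\<^bsub>K\<^esub> \<one>\<^bsub>K\<^esub>) \<odot>\<^bsub>?C\<^esub> v \<in> carrier ?C" using sclosed v by simp
    ultimately show "\<exists>neg_v\<in>carrier ?C. v \<oplus>\<^bsub>?C\<^esub> neg_v = \<zero>\<^bsub>?C\<^esub>" by blast
  qed
  show "\<forall>v\<in>carrier ?C. v \<oplus>\<^bsub>?C\<^esub> \<zero>\<^bsub>?C\<^esub> = v"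
  proof
    fix v assume v: "v \<in> carrier ?C"
    show "v \<oplus>\<^bsub>?C\<^esub> \<zero>\<^bsub>?C\<^esub> = v"
      by (rule extensionalityI[of _ ?B]) (simp_all add: cocycle_space_sel(2,3) app[OF v] ext[OF v])
  qed
  show "\<forall>v\<in>carrier ?C. \<one>\<^bsub>K\<^esub> \<odot>\<^bsub>?C\<^esub> v = v"
  proof
    fix v assume v: "v \<in> carrier ?C"
    show "\<one>\<^bsub>K\<^esub> \<odot>\<^bsub>?C\<^esub> v = v"
      by (rule extensionalityI[of _ ?B]) (simp_all add: sm[OF _ v] app[OF v] ext[OF v])
  qed
  show "\<forall>v w. v \<in> carrier ?C \<and> w \<in> carrier ?C \<longrightarrow> v \<oplus>\<^bsub>?C\<^esub> w = w \<oplus>\<^bsub>?C\<^esub> v"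
    using app by (auto simp: cocycle_space_sel(3) K.a_comm intro!: restrict_ext)
  show "\<forall>v w x. v \<in> carrier ?C \<and> w \<in> carrier ?C \<and> x \<in> carrier ?C \<longrightarrow>
      v \<oplus>\<^bsub>?C\<^esub> w \<oplus>\<^bsub>?C\<^esub> x = v \<oplus>\<^bsub>?C\<^esub> (w \<oplus>\<^bsub>?C\<^esub> x)"
    using app by (auto simp: cocycle_space_sel(3) K.a_assoc intro!: restrict_ext)
  show "\<forall>a b v. a \<in> carrier K \<and> b \<in> carrier K \<and> v \<in> carrier ?C \<longrightarrow>
      (a \<otimes>\<^bsub>K\<^esub> b) \<odot>\<^bsub>?C\<^esub> v = a \<odot>\<^bsub>?C\<^esub> (b \<odot>\<^bsub>?C\<^esub> v)"
  proof (intro allI impI, elim conjE)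
    fix a b v assume ab: "a \<in> carrier K" "b \<in> carrier K" and v: "v \<in> carrier ?C"
    have "b \<odot>\<^bsub>?C\<^esub> v \<in> carrier ?C" using sclosed ab v by blast
    then have "a \<odot>\<^bsub>?C\<^esub> (b \<odot>\<^bsub>?C\<^esub> v) = (\<lambda>x\<in>?B. a \<otimes>\<^bsub>K\<^esub> (b \<odot>\<^bsub>?C\<^esub> v) x)" using ab by (intro sm)
    then show "(a \<otimes>\<^bsub>K\<^esub> b) \<odot>\<^bsub>?C\<^esub> v = a \<odot>\<^bsub>?C\<^esub> (b \<odot>\<^bsub>?C\<^esub> v)"
      using ab app[OF v] by (auto simp: sm[OF _ v] K.m_assoc intro!: restrict_ext)
  qed
  show "\<forall>a b v. a \<in> carrier K \<and> b \<in> carrier K \<and> v \<in> carrier ?C \<longrightarrow>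
      (a \<oplus>\<^bsub>K\<^esub> b) \<odot>\<^bsub>?C\<^esub> v = a \<odot>\<^bsub>?C\<^esub> v \<oplus>\<^bsub>?C\<^esub> b \<odot>\<^bsub>?C\<^esub> v"
    using app by (auto simp: sm cocycle_space_sel(3) K.l_distr intro!: restrict_ext)
  show "\<forall>a v w. a \<in> carrier K \<and> v \<in> carrier ?C \<and> w \<in> carrier ?C \<longrightarrow>
      a \<odot>\<^bsub>?C\<^esub> (v \<oplus>\<^bsub>?C\<^esub> w) = a \<odot>\<^bsub>?C\<^esub> v \<oplus>\<^bsub>?C\<^esub> a \<odot>\<^bsub>?C\<^esub> w"
  proof (intro allI impI, elim conjE)
    fix a v w assume a: "a \<in> carrier K" and v: "v \<in> carrier ?C" and w: "w \<in> carrier ?C"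
    have "v \<oplus>\<^bsub>?C\<^esub> w \<in> carrier ?C" using cl(1)[OF v w K.zero_closed] .
    then have "a \<odot>\<^bsub>?C\<^esub> (v \<oplus>\<^bsub>?C\<^esub> w) = (\<lambda>x\<in>?B. a \<otimes>\<^bsub>K\<^esub> (v \<oplus>\<^bsub>?C\<^esub> w) x)" using a by (intro sm)
    then show "a \<odot>\<^bsub>?C\<^esub> (v \<oplus>\<^bsub>?C\<^esub> w) = a \<odot>\<^bsub>?C\<^esub> v \<oplus>\<^bsub>?C\<^esub> a \<odot>\<^bsub>?C\<^esub> w"
      using a app[OF v] app[OF w]
      by (auto simp: sm[OF _ v] sm[OF _ w] cocycle_space_sel(3) K.r_distr intro!: restrict_ext)
  qed
qed

text \<open>Evaluating a cocycle at the generators \<open>(w - \<chi>\<^sub>X(w)) [1]\<close> turns it into a derivation on words.\<close>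

definition cocycle_deriv ::
    "'a set \<Rightarrow> ((('k \<Rightarrow> 'a list \<Rightarrow> 'k) \<Rightarrow> 'a list \<Rightarrow> 'k) \<Rightarrow> 'k) \<Rightarrow> 'a list \<Rightarrow> 'k" where
  "cocycle_deriv X f w = f (res1_gen alg (simp_mod X) (iota (aug X (elt w))))"

lemma ker_linear_cocycle:
  assumes f: "f \<in> ext1_cocycles alg (simp_mod X) (simp_mod Y)"
  shows "ker_linear X Y (\<lambda>k. f (res1_gen alg (simp_mod X) k))"
proof -
  note lin = ext1_cocycle_linear[OF left_module_lrb_simple left_module_lrb_simple f,
      unfolded res0_lrb_simple lrb_simple_sel]
  show ?thesis
    unfolding ker_linear_def using lin by (auto simp: lrb_simple_smult)
qed

lemma derivation_cocycle:
  assumes "f \<in> ext1_cocycles alg (simp_mod X) (simp_mod Y)"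
  shows "derivation X Y (cocycle_deriv X f)"
  using derivation_of_ker_linear[OF ker_linear_cocycle[OF assms]]
  by (simp add: cocycle_deriv_def[abs_def])

text \<open>A cocycle is a coboundary when its linear map on the kernel extends to \<open>F\<close>,
  which happens when its derivation is inner. The condition may be tested on letters because the
  inner equation spreads to words.\<close>

lemma coboundary_iff_inner:
  "f \<in> ext1_coboundaries alg (simp_mod X) (simp_mod Y) \<longleftrightarrow>
     f \<in> ext1_cocycles alg (simp_mod X) (simp_mod Y) \<and>
     (\<exists>c\<in>carrier K. \<forall>a\<in>A. cocycle_deriv X f [a] \<oplus>\<^bsub>K\<^esub> c \<otimes>\<^bsub>K\<^esub> chi X [a] = c \<otimes>\<^bsub>K\<^esub> chi Y [a])"
  (is "?L \<longleftrightarrow> ?C \<and> ?R")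
proof -
  note iff = ext1_coboundary_iff[OF left_module_lrb_simple left_module_lrb_simple,
      of f X Y, unfolded res0_lrb_simple]
  have letter: "[a] \<in> carrier S" if "a \<in> A" for a using that by (simp add: free_lrb_sel)
  have ?R if L: ?L
  proof -
    obtain g where g: "g \<in> left_module_hom alg F (simp_mod Y)"
      and fg: "\<And>k. k \<in> res_ker0 alg (simp_mod X) \<Longrightarrow> f (res1_gen alg (simp_mod X) k) = g k"
      using L iff by blast
    have "cocycle_deriv X f [a] = g (iota (aug X (elt [a])))" for a
      unfolding cocycle_deriv_def by (intro fg iota_aug_ker) simp
    \<comment> \<open>The empty word places \<open>c\<close> in the field even if there are no
      letters.\<close>
    moreover have "[] \<in> carrier S" by (simp add: free_lrb_sel)
    ultimately show ?thesis
      using hom_restricts_to_inner[OF g] letter by (intro bexI[of _ "g (iota \<one>\<^bsub>alg\<^esub>)"]) auto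
  qed
  moreover have ?L if C: ?C and R: ?R
  proof -
    obtain c where c: "c \<in> carrier K"
      and eq: "\<And>a. a \<in> A \<Longrightarrow> cocycle_deriv X f [a] \<oplus>\<^bsub>K\<^esub> c \<otimes>\<^bsub>K\<^esub> chi X [a] = c \<otimes>\<^bsub>K\<^esub> chi Y [a]"
      using R by blast
    have "cocycle_deriv X f w \<oplus>\<^bsub>K\<^esub> c \<otimes>\<^bsub>K\<^esub> chi X w = c \<otimes>\<^bsub>K\<^esub> chi Y w" if "w \<in> carrier S" for w
      using derivation_inner_words[OF derivation_cocycle[OF C] c eq that] .
    then show ?thesis
      using ker_linear_inner_extends[OF ker_linear_cocycle[OF C] c] C iff
      by (simp add: cocycle_deriv_def)
  qed
  ultimately show ?thesis using iff by blast
qed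

text \<open>Every derivation arises from a cocycle: its linear map on the kernel is composed with
  \<open>res_d1\<close>.\<close>

lemma cocycle_of_derivation:
  assumes "derivation X Y d"
  shows "\<exists>f\<in>ext1_cocycles alg (simp_mod X) (simp_mod Y). \<forall>w\<in>carrier S. cocycle_deriv X f w = d w"
proof -
  obtain h where h: "ker_linear X Y h"
    and hd: "\<And>w. w \<in> carrier S \<Longrightarrow> h (iota (aug X (elt w))) = d w"
    using ker_linear_of_derivation[OF assms] by blast
  show ?thesis
  proof (intro bexI ballI)
    show "(\<lambda>x\<in>carrier (res1 alg (simp_mod X)). h (res_d1 alg (simp_mod X) x)) \<in>
        ext1_cocycles alg (simp_mod X) (simp_mod Y)"
      by (rule ext1_cocycle_of_linear[OF left_module_lrb_simple left_module_lrb_simple])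
        (simp_all add: res0_lrb_simple lrb_simple_sel lrb_simple_smult ker_linearD[OF h])
    fix w assume "w \<in> carrier S"
    then show "cocycle_deriv X (\<lambda>x\<in>carrier (res1 alg (simp_mod X)). h (res_d1 alg (simp_mod X) x)) w = d w"
      by (simp add: cocycle_deriv_def res1_gen_closed[OF left_module_lrb_simple]
          res_d1_gen[OF left_module_lrb_simple] iota_aug_ker hd)
  qed
qed

lemma cocycle_deriv_linear:
  assumes "f \<in> ext1_cocycles alg (simp_mod X) (simp_mod Y)"
  shows "cocycle_deriv X (f \<oplus>\<^bsub>cocycle_space X Y\<^esub> g) w = cocycle_deriv X f w \<oplus>\<^bsub>K\<^esub> cocycle_deriv X g w"
    and "c \<in> carrier K \<Longrightarrow> cocycle_deriv X (c \<odot>\<^bsub>cocycle_space X Y\<^esub> f) w = c \<otimes>\<^bsub>K\<^esub> cocycle_deriv X f w"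
  unfolding cocycle_deriv_def cocycle_space_sel(3) using cocycle_smult[OF _ assms]
  by (simp_all add: res1_gen_closed[OF left_module_lrb_simple])

lemma has_dim_ext1_lrb_simple:
  assumes X: "X \<subseteq> A" and Y: "Y \<subseteq> A"
  shows "has_dim K (ext1 alg (simp_mod X) (simp_mod Y)) (if Y \<subset> X then card (X - Y) - 1 else 0)"
proof -
  let ?C = "ext1_cocycles alg (simp_mod X) (simp_mod Y)"
  let ?B = "ext1_coboundaries alg (simp_mod X) (simp_mod Y)"
  let ?D = "cocycle_deriv X"
  note der = derivation_cocycle[of _ X Y]
  have D_cl: "?D f [a] \<in> carrier K" if "f \<in> ?C" "a \<in> A" for f a
    using derivationD(1)[OF der[OF that(1)]] that(2) by (simp add: free_lrb_sel)
  show ?thesis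
  proof (cases "Y \<subset> X")
    case True
    then obtain b where b: "b \<in> X" "b \<notin> Y" by blast
    \<comment> \<open>The letter \<open>b\<close> serves as base point. Its existence also ensures
      that the subtraction in \<open>card (X - Y) - 1\<close> is not truncated.\<close>
    define I where "I = X - Y - {b}"
    have "finite X" using X finite_A finite_subset by blast
    then have I: "finite I" "card I = card (X - Y) - 1" using b by (auto simp: I_def)
    define mu where "mu a f = ?D f [a] \<ominus>\<^bsub>K\<^esub> ?D f [b]" for a f
    have IA: "a \<in> A" if "a \<in> insert b I" for a using that X b by (auto simp: I_def)
    have "\<exists>f. f \<in> ?C \<and> (\<forall>w\<in>carrier S. ?D f w = first_letter X Y j w)" for j
      using cocycle_of_derivation[OF derivation_first_letter[of Y X j]] True by auto
    then obtain q where q: "\<And>j. q j \<in> ?C"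
      and Dq: "\<And>j w. w \<in> carrier S \<Longrightarrow> ?D (q j) w = first_letter X Y j w"
      by metis
    have B: "?B = {f \<in> ?C. \<forall>a\<in>I. mu a f = \<zero>\<^bsub>K\<^esub>}"
    proof (intro Set.set_eqI iffI)
      fix f assume f: "f \<in> ?B"
      then have fC: "f \<in> ?C" unfolding coboundary_iff_inner[of f] by blast
      obtain c where c: "c \<in> carrier K"
        and eq: "\<And>a. a \<in> A \<Longrightarrow> ?D f [a] \<oplus>\<^bsub>K\<^esub> c \<otimes>\<^bsub>K\<^esub> chi X [a] = c \<otimes>\<^bsub>K\<^esub> chi Y [a]"
        using f unfolding coboundary_iff_inner[of f] by blast
      \<comment> \<open>On letters of \<open>X - Y\<close> the inner equation becomes
        \<open>d [a] + c = 0\<close>, so all values there coincide.\<close>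
      have "?D f [a] = \<ominus>\<^bsub>K\<^esub> c" if "a \<in> insert b I" for a
      proof -
        have "?D f [a] \<oplus>\<^bsub>K\<^esub> c = \<zero>\<^bsub>K\<^esub>"
          using eq[OF IA[OF that]] that b c by (auto simp: chi_def I_def)
        then show ?thesis using K.minus_equality D_cl[OF fC IA[OF that]] c by metis
      qed
      then show "f \<in> {f \<in> ?C. \<forall>a\<in>I. mu a f = \<zero>\<^bsub>K\<^esub>}"
        using fC c by (simp add: mu_def)
    next
      fix f assume "f \<in> {f \<in> ?C. \<forall>a\<in>I. mu a f = \<zero>\<^bsub>K\<^esub>}"
      then have f: "f \<in> ?C" and mu: "\<And>a. a \<in> I \<Longrightarrow> mu a f = \<zero>\<^bsub>K\<^esub>" by auto
      have Db: "?D f [b] \<in> carrier K" using D_cl[OF f] IA by blast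
      \<comment> \<open>Conversely, the inner constant is minus the common value on
        \<open>X - Y\<close>.\<close>
      have "?D f [a] \<oplus>\<^bsub>K\<^esub> (\<ominus>\<^bsub>K\<^esub> ?D f [b]) \<otimes>\<^bsub>K\<^esub> chi X [a] = (\<ominus>\<^bsub>K\<^esub> ?D f [b]) \<otimes>\<^bsub>K\<^esub> chi Y [a]"
        if a: "a \<in> A" for a
      proof (cases "a \<in> X \<and> a \<notin> Y")
        case True
        then have "?D f [a] = ?D f [b]"
          using mu[of a] D_cl[OF f a] Db by (cases "a = b") (auto simp: mu_def I_def)
        then show ?thesis using True Db by (simp add: chi_def K.r_neg)
      next
        case False
        then have "a \<in> X \<longleftrightarrow> a \<in> Y" using \<open>Y \<subset> X\<close> by blast
        then show ?thesis
          using derivation_singleton_eq_zero[OF der[OF f] a] Db by (simp add: chi_def)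
      qed
      moreover have "\<ominus>\<^bsub>K\<^esub> ?D f [b] \<in> carrier K" using Db by simp
      ultimately show "f \<in> ?B" using f unfolding coboundary_iff_inner[of f] by blast
    qed
    have "has_dim K (quotient_space (cocycle_space X Y) ?B) (card I)"
    proof (rule has_dim_quotient_space[OF vectorspace_cocycle_space I(1),
          where mu = mu and q = q, unfolded cocycle_space_sel(1)])
      \<comment> \<open>Since \<open>b\<close> is not in \<open>I\<close>, the cocycle
        \<open>q j\<close> has value 0 at \<open>b\<close> and the difference is its value at
        \<open>i\<close>.\<close>
      fix i j assume ij: "i \<in> I" "j \<in> I"
      then have "[i] \<in> carrier S" "[b] \<in> carrier S" using IA by (auto simp: free_lrb_sel)
      then show "mu i (q j) = (if i = j then \<one>\<^bsub>K\<^esub> else \<zero>\<^bsub>K\<^esub>)"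
        using ij b by (auto simp: mu_def Dq first_letter_def I_def K.minus_eq)
    next
      fix i f g assume i: "i \<in> I" and f: "f \<in> ?C" and g: "g \<in> ?C"
      have "?D f [i] \<in> carrier K" "?D g [i] \<in> carrier K" "?D f [b] \<in> carrier K" "?D g [b] \<in> carrier K"
        using D_cl f g IA i by auto
      then show "mu i (f \<oplus>\<^bsub>cocycle_space X Y\<^esub> g) = mu i f \<oplus>\<^bsub>K\<^esub> mu i g"
        using f by (simp add: mu_def cocycle_deriv_linear K.minus_eq K.minus_add K.a_ac)
    next
      fix i c f assume i: "i \<in> I" and c: "c \<in> carrier K" and f: "f \<in> ?C"
      have "?D f [i] \<in> carrier K" "?D f [b] \<in> carrier K" using D_cl f IA i by auto
      then show "mu i (c \<odot>\<^bsub>cocycle_space X Y\<^esub> f) = c \<otimes>\<^bsub>K\<^esub> mu i f"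
        using c f by (simp add: mu_def cocycle_deriv_linear K.minus_eq K.r_distr K.r_minus)
    next
      show "mu i f \<in> carrier K" if "i \<in> I" "f \<in> ?C" for i f
        using D_cl that IA by (simp add: mu_def)
    qed (use B q in auto)
    then show ?thesis using True I(2) by (simp add: ext1_def cocycle_space_def)
  next
    case False
    have "f \<in> ?B" if f: "f \<in> ?C" for f
    proof (cases "Y \<subseteq> X")
      case True
      then have "X = Y" using False by blast
      then have "?D f [a] \<oplus>\<^bsub>K\<^esub> \<zero>\<^bsub>K\<^esub> \<otimes>\<^bsub>K\<^esub> chi X [a] = \<zero>\<^bsub>K\<^esub> \<otimes>\<^bsub>K\<^esub> chi Y [a]" if "a \<in> A" for a
        using derivation_singleton_eq_zero[OF der[OF f] that] by simp
      then show ?thesis using f K.zero_closed unfolding coboundary_iff_inner[of f] by blast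
    next
      case False
      then obtain a0 where a0: "a0 \<in> Y" "a0 \<notin> X" by blast
      then show ?thesis
        using derivation_inner_if_not_subset[OF der[OF f] Y a0] D_cl[OF f, of a0] Y f
        unfolding coboundary_iff_inner[of f] by blast
    qed
    moreover have "f \<in> ?C" if "f \<in> ?B" for f using that unfolding coboundary_iff_inner[of f] by blast
    ultimately have B: "?B = ?C" by blast
    \<comment> \<open>With no functionals at all the common kernel is the whole space, so the
      quotient has dimension 0.\<close>
    have "has_dim K (quotient_space (cocycle_space X Y) ?B) (card ({} :: nat set))"
      by (rule has_dim_quotient_space[OF vectorspace_cocycle_space, unfolded cocycle_space_sel(1)])
        (auto simp: B)
    then show ?thesis using False by (simp add: ext1_def cocycle_space_def)
  qed
qed

end

theorem theorem8p1:
  fixes K :: "('k, 'x) ring_scheme" and A :: "'a set"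
  assumes "field K" and "finite A"
  shows "is_quiver TYPE('v) K (monoid_algebra K (free_lrb A)) (Pow A) (lrb_simple K A)
    (\<lambda>X Y. if Y \<subset> X then card (X - Y) - 1 else 0)"
proof -
  interpret free_lrb_algebra K A
    using assms by (intro free_lrb_algebra.intro free_lrb_algebra_axioms.intro)
  show ?thesis
    unfolding is_quiver_def
  proof (intro conjI ballI allI impI)
    fix V :: "('a list \<Rightarrow> 'k, 'v) module"
    assume "simple_left_module (monoid_algebra K (free_lrb A)) V"
    then show "\<exists>i\<in>Pow A. left_module_iso (monoid_algebra K (free_lrb A)) V (lrb_simple K A i)"
      by (rule simple_module_iso_lrb_simple)
  qed (use simple_lrb_simple has_dim_lrb_simple lrb_simple_iso_imp_eq has_dim_ext1_lrb_simple in auto)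
qed

end
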